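(* Let $d\ge1$, $s\in(d,2d)$ and let $\mathfrak q$ and the functions $\phi_\beta$ be as in the context. Let $\gamma:=\frac{s}{2d}$ and $\Delta:=1/\log_2(2d/s)$. For $\beta>1$ put $m(\beta):=\sup\{k\in\mathbb Z\colon \gamma^{-k}\le\log\beta\}$ and $$u(\beta):=\gamma^{m(\beta)}\log\beta\in[1,\gamma^{-1}),$$ and define $\psi_\beta\colon\mathbb R\to(0,\infty)$ by $\psi_\beta(t):=\phi_\beta\bigl(e^{\gamma^{-t}}\bigr)$. Then for all $t\in[0,1]$, $$(\log\beta)^\Delta\,\psi_{\beta}\biggl(t+\frac{\log\bigl(\frac{u(\beta)}{2d-s}\bigr)}{\log(1/\gamma)}\biggr)\;\underset{\beta\to\infty}\longrightarrow\;\Bigl[\frac{s}{2d-s}(2\gamma)^{-t}-2\,\frac{s-d}{2d-s}\,2^{-t}\Bigr](2d-s)^\Delta,$$ and the limit is uniform in $t\in[0,1]$.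
   Context: Model: $d\ge1$ is an integer, $s\in(d,2d)$, $|\cdot|$ is a norm on $\mathbb R^d$, and $\mathfrak q\colon\mathbb Z^d\to[0,\infty]$ satisfies $\mathfrak q(x)=\mathfrak q(-x)$ for all $x$, $\mathfrak q(x)=+\infty$ whenever $x$ is a nearest neighbor of the origin in $\mathbb Z^d$, and $\mathfrak q(x)|x|^s\to1$ as $|x|\to\infty$. For $\beta>0$ set $\mathfrak p_\beta(x,y):=1-\exp\{-\beta\,\mathfrak q(x-y)\}$ (with $e^{-\infty}:=0$). The long-range percolation graph has vertex set $\mathbb Z^d$ and, for each pair of distinct $x,y\in\mathbb Z^d$, an undirected edge between $x$ and $y$ is present with probability $\mathfrak p_\beta(x,y)$, independently of other edges; its law is $P_\beta$. $D(x,y)$ is the graph (chemical) distance, i.e. the minimal number of edges of a path in this graph connecting $x$ to $y$. $B(x,r):=\{y\in\mathbb Z^d\colon|x-y|<r\}$, $\#$ is cardinality, $\log$ is the natural logarithm. The functions $\phi_\beta$: with $\gamma:=\frac s{2d}$ and $\Delta:=1/\log_2(2d/s)$, $(\phi_\beta)_{\beta>0}$ is the family (whose existence may be taken as known, and which is uniquely determined by the following properties) of continuous functions $\phi_\beta\colon(1,\infty)\to(0,\infty)$ with $\phi_\beta(r^\gamma)=\phi_\beta(r)$ for all $r>1$, such that $\beta\mapsto\phi_\beta(r)$ is non-increasing and left-continuous for each $r>1$ and such that, for some at most countable $\Sigma\subseteq(0,\infty)$ and all $\beta\in(0,\infty)\smallsetminus\Sigma$, the map $\beta\mapsto\phi_\beta(r)$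 is continuous at $\beta$ for each $r>1$ and, for all $\epsilon>0$, $r^{-d}\,\#\{x\in B(0,r)\colon |\frac{D(0,x)}{\phi_\beta(r)(\log r)^\Delta}-1|>\epsilon\}\to0$ in $P_\beta$-probability as $r\to\infty$. *)

theory Defs
  imports "HOL-Probability.Probability"
begin

text \<open>The lattice \<open>\<int>\<^sup>d\<close> is the type \<open>int ^ 'n\<close> with \<open>d = CARD('n)\<close>.\<close>

definition lattice_vec :: "int ^ 'n \<Rightarrow> real ^ 'n" where
  "lattice_vec x = (\<chi> i. real_of_int (x $ i))"

text \<open>Nonnegativity of \<open>N\<close> follows from the three axioms.\<close>

definition is_norm :: "('a::real_vector \<Rightarrow> real) \<Rightarrow> bool" where
  "is_norm N \<longleftrightarrow>
     (\<forall>x. N x = 0 \<longleftrightarrow> x = 0) \<and>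
     (\<forall>c x. N (c *\<^sub>R x) = \<bar>c\<bar> * N x) \<and>
     (\<forall>x y. N (x + y) \<le> N x + N y)"

definition lattice_nn :: "int ^ 'n \<Rightarrow> bool" where
  "lattice_nn x \<longleftrightarrow> (\<Sum>i\<in>UNIV. \<bar>x $ i\<bar>) = 1"

definition admissible_kernel ::
  "real \<Rightarrow> (real ^ 'n \<Rightarrow> real) \<Rightarrow> (int ^ 'n \<Rightarrow> ennreal) \<Rightarrow> bool" where
  "admissible_kernel s N q \<longleftrightarrow>
     (\<forall>x. q (- x) = q x) \<and>
     (\<forall>x. lattice_nn x \<longrightarrow> q x = \<top>) \<and>
     ((\<lambda>x. q x * ennreal (N (lattice_vec x) powr s)) \<longlongrightarrow> 1)
        (filtercomap (\<lambda>x. N (lattice_vec x)) at_top)"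

definition conn_prob :: "(int ^ 'n \<Rightarrow> ennreal) \<Rightarrow> real \<Rightarrow> int ^ 'n \<Rightarrow> int ^ 'n \<Rightarrow> real" where
  "conn_prob q \<beta> x y =
     (if q (x - y) = \<top> then 1 else 1 - exp (- \<beta> * enn2real (q (x - y))))"

definition lrp_edges :: "(int ^ 'n) set set" where
  "lrp_edges = {{x, y} | x y. x \<noteq> y}"

text \<open>The description below is proper because \<open>conn_prob q \<beta>\<close> is symmetric for symmetric \<open>q\<close>.\<close>

definition edge_prob :: "(int ^ 'n \<Rightarrow> ennreal) \<Rightarrow> real \<Rightarrow> (int ^ 'n) set \<Rightarrow> real" where
  "edge_prob q \<beta> e = (THE p. \<exists>x y. e = {x, y} \<and> p = conn_prob q \<beta> x y)"

text \<open>A configuration \<open>\<omega>\<close> maps each edge to whether it is present.\<close>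

definition lrp_measure ::
  "(int ^ 'n \<Rightarrow> ennreal) \<Rightarrow> real \<Rightarrow> ((int ^ 'n) set \<Rightarrow> bool) measure" where
  "lrp_measure q \<beta> =
     Pi\<^sub>M lrp_edges (\<lambda>e. measure_pmf (bernoulli_pmf (edge_prob q \<beta> e)))"

definition lrp_adj :: "((int ^ 'n) set \<Rightarrow> bool) \<Rightarrow> int ^ 'n \<Rightarrow> int ^ 'n \<Rightarrow> bool" where
  "lrp_adj \<omega> x y \<longleftrightarrow> x \<noteq> y \<and> \<omega> {x, y}"

definition lrp_path ::
  "((int ^ 'n) set \<Rightarrow> bool) \<Rightarrow> int ^ 'n \<Rightarrow> (int ^ 'n) list \<Rightarrow> int ^ 'n \<Rightarrow> bool" where
  "lrp_path \<omega> x xs y \<longleftrightarrow>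
     xs \<noteq> [] \<and> hd xs = x \<and> last xs = y \<and> distinct xs \<and> successively (lrp_adj \<omega>) xs"

text \<open>The value is \<open>\<infinity>\<close> if there is no path, which happens with probability zero.\<close>

definition chem_dist ::
  "((int ^ 'n) set \<Rightarrow> bool) \<Rightarrow> int ^ 'n \<Rightarrow> int ^ 'n \<Rightarrow> enat" where
  "chem_dist \<omega> x y = Inf {enat (length xs - 1) | xs. lrp_path \<omega> x xs y}"

definition lattice_ball :: "(real ^ 'n \<Rightarrow> real) \<Rightarrow> int ^ 'n \<Rightarrow> real \<Rightarrow> (int ^ 'n) set" where
  "lattice_ball N x r = {y. N (lattice_vec x - lattice_vec y) < r}"

definition lrp_gamma :: "nat \<Rightarrow> real \<Rightarrow> real" where
  "lrp_gamma d s = s / (2 * real d)"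

definition lrp_Delta :: "nat \<Rightarrow> real \<Rightarrow> real" where
  "lrp_Delta d s = 1 / log 2 (2 * real d / s)"

definition tendsto_zero_in_prob ::
  "'a measure \<Rightarrow> (real \<Rightarrow> 'a \<Rightarrow> real) \<Rightarrow> bool" where
  "tendsto_zero_in_prob M X \<longleftrightarrow>
     (\<forall>\<delta>>0. ((\<lambda>r. measure M {\<omega> \<in> space M. \<bar>X r \<omega>\<bar> > \<delta>}) \<longlongrightarrow> 0) at_top)"

definition atypical_points ::
  "real \<Rightarrow> (real ^ 'n \<Rightarrow> real) \<Rightarrow> (real \<Rightarrow> real) \<Rightarrow> real \<Rightarrow> real
     \<Rightarrow> ((int ^ 'n) set \<Rightarrow> bool) \<Rightarrow> (int ^ 'n) set" where
  "atypical_points s N f \<epsilon> r \<omega> =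
     {x \<in> lattice_ball N 0 r.
        \<bar>ereal_of_enat (chem_dist \<omega> 0 x) / ereal (f r * ln r powr lrp_Delta CARD('n) s) - 1\<bar>
          > ereal \<epsilon>}"

text \<open>The values of \<open>\<phi> \<beta> r\<close> for \<open>\<beta> \<le> 0\<close> or \<open>r \<le> 1\<close> are irrelevant.\<close>

definition phi_family ::
  "real \<Rightarrow> (real ^ 'n \<Rightarrow> real) \<Rightarrow> (int ^ 'n \<Rightarrow> ennreal) \<Rightarrow> (real \<Rightarrow> real \<Rightarrow> real) \<Rightarrow> bool" where
  "phi_family s N q \<phi> \<longleftrightarrow>
     (\<forall>\<beta>>0. continuous_on {1<..} (\<phi> \<beta>) \<and>
        (\<forall>r>1. \<phi> \<beta> r > 0 \<and> \<phi> \<beta> (r powr lrp_gamma CARD('n) s) = \<phi> \<beta> r)) \<and>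
     (\<forall>r>1. antimono_on {0<..} (\<lambda>\<beta>. \<phi> \<beta> r) \<and>
        (\<forall>\<beta>>0. continuous (at_left \<beta>) (\<lambda>\<beta>. \<phi> \<beta> r))) \<and>
     (\<exists>\<Sigma>. countable \<Sigma> \<and> \<Sigma> \<subseteq> {0<..} \<and>
        (\<forall>\<beta>\<in>{0<..} - \<Sigma>.
           (\<forall>r>1. isCont (\<lambda>\<beta>. \<phi> \<beta> r) \<beta>) \<and>
           (\<forall>\<epsilon>>0. tendsto_zero_in_prob (lrp_measure q \<beta>)
              (\<lambda>r \<omega>. real (card (atypical_points s N (\<phi> \<beta>) \<epsilon> r \<omega>)) / r ^ CARD('n)))))"

definition lrp_m :: "nat \<Rightarrow> real \<Rightarrow> real \<Rightarrow> int" where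
  "lrp_m d s \<beta> = Sup {k::int. lrp_gamma d s powi (- k) \<le> ln \<beta>}"

definition lrp_u :: "nat \<Rightarrow> real \<Rightarrow> real \<Rightarrow> real" where
  "lrp_u d s \<beta> = lrp_gamma d s powi lrp_m d s \<beta> * ln \<beta>"

definition lrp_psi :: "nat \<Rightarrow> real \<Rightarrow> (real \<Rightarrow> real \<Rightarrow> real) \<Rightarrow> real \<Rightarrow> real \<Rightarrow> real" where
  "lrp_psi d s \<phi> \<beta> t = \<phi> \<beta> (exp (lrp_gamma d s powr (- t)))"

lemma lrp_u_bounds:
  assumes "d \<ge> 1" "real d < s" "s < 2 * real d" "\<beta> > 1"
  shows "lrp_u d s \<beta> \<in> {1..<1 / lrp_gamma d s}"
proof -
  define g where "g = lrp_gamma d s"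
  have g: "0 < g" "g < 1" using assms by (auto simp: g_def lrp_gamma_def)
  have l: "ln \<beta> > 0" using assms by simp
  define c where "c = ln (ln \<beta>) / ln (1 / g)"
  have lg: "ln (1 / g) > 0" using g by simp
  have "g powi (- k) \<le> ln \<beta> \<longleftrightarrow> k \<le> \<lfloor>c\<rfloor>" for k :: int
  proof -
    have "g powi (- k) = g powr (of_int (- k))"
      using g powr_real_of_int'[of g "- k"] by simp
    also have "\<dots> = exp (of_int k * ln (1 / g))"
      using g by (simp add: powr_def ln_div)
    finally have "g powi (- k) \<le> ln \<beta> \<longleftrightarrow> of_int k * ln (1 / g) \<le> ln (ln \<beta>)"
      using l by (metis exp_le_cancel_iff exp_ln)
    also have "\<dots> \<longleftrightarrow> of_int k \<le> c"
      using lg by (simp add: c_def pos_le_divide_eq)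
    finally show ?thesis by (simp add: le_floor_iff)
  qed
  note iff = this
  have "{k::int. g powi (- k) \<le> ln \<beta>} = {..\<lfloor>c\<rfloor>}" using iff by auto
  then have m: "lrp_m d s \<beta> = \<lfloor>c\<rfloor>" by (simp add: lrp_m_def g_def)
  have 1: "g powi (- \<lfloor>c\<rfloor>) \<le> ln \<beta>" using iff by simp
  have 2: "ln \<beta> < g powi (- (\<lfloor>c\<rfloor> + 1))" using iff[of "\<lfloor>c\<rfloor> + 1"] by linarith
  have p: "g powi \<lfloor>c\<rfloor> > 0" using g by simp
  have "1 = g powi \<lfloor>c\<rfloor> * g powi (- \<lfloor>c\<rfloor>)" using g by (simp add: power_int_minus)
  also have "\<dots> \<le> g powi \<lfloor>c\<rfloor> * ln \<beta>" using 1 p by simp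
  finally have A: "1 \<le> g powi \<lfloor>c\<rfloor> * ln \<beta>" .
  have "g powi \<lfloor>c\<rfloor> * ln \<beta> < g powi \<lfloor>c\<rfloor> * g powi (- (\<lfloor>c\<rfloor> + 1))" using 2 p by simp
  also have "\<dots> = g powi (-1)" using g by (subst power_int_add[symmetric]) auto
  also have "\<dots> = 1 / g" using g by (simp add: power_int_minus field_simps)
  finally show ?thesis using A by (simp add: lrp_u_def m g_def)
qed

end

theory Submission
  imports Defs
begin

text \<open>Put \<open>\<lambda> = ln \<beta>\<close>, and let \<open>\<lambda> \<theta>(n)\<close> be the logarithm of the distance that \<open>n\<close> steps can cover when
  \<open>\<beta>\<close> is large. An edge of length \<open>r\<close> between a set of \<open>V\<close> and a set of \<open>V'\<close> points becomes likely once
  \<open>\<beta> V V' r powr (- s)\<close> is of order one. A path with \<open>n = a + b + 1\<close> edges consists of one long edge between a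
  path with \<open>a\<close> and a path with \<open>b\<close> edges, so that \<open>s \<theta>(n) = 1 + d max (\<theta>(a) + \<theta>(b))\<close> with \<open>\<theta>(0) = 0\<close>. The
  increments of the solution decrease, hence the best choice is to take \<open>a\<close> and \<open>b\<close> as equal as possible, and
  \<open>\<theta>(n) = \<Xi>(n + 1) - 1 / (2 d - s)\<close> for a concave function \<open>\<Xi>\<close> that is affine between consecutive powers of 2
  and satisfies \<open>\<Xi>(2 t) = (2 d / s) \<Xi>(t)\<close>; below it is called \<open>profile\<close>. The distance between points that are
  \<open>r\<close> apart is therefore close to the solution \<open>t\<close> of \<open>\<lambda> \<Xi>(t) = ln r\<close>, and the formula of the theorem is the
  first affine piece of \<open>\<Xi>\<close>, solved for \<open>t\<close>.

  The functions \<open>\<phi> \<beta>\<close> are determined by \<open>r \<rightarrow> \<infinity>\<close> for a fixed \<open>\<beta>\<close>. The heuristic relation must thus be controlled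
  on all scales at once, with a relative error that vanishes as \<open>\<lambda> \<rightarrow> \<infinity>\<close>. Every level of the recursion costs an
  error of the form \<open>E ln t + E'\<close>; lemma \<open>corr_absorbs\<close> shows that all of them together are paid for by a term
  \<open>A t powr \<alpha>\<close> with \<open>2 powr \<alpha> = 2 d / s\<close>, which has the same order of growth as \<open>\<Xi>(t)\<close> but no factor \<open>\<lambda>\<close>.

  Distances are not shorter (\<open>few_close_points\<close>): a path with at most \<open>n\<close> edges has an edge of length at least
  a fraction \<open>1 / (2 n)\<close> of the distance of its ends. Splitting there, treating both pieces in the same way and
  stopping at pieces whose ends are so close that only the trivial bound 1 is available, one finds in every path a
  \<open>skeleton\<close> of long edges. The two pieces of a simple path share no edge, so the probability of a skeleton is a
  product, and the sum over all skeletons obeys the recursion above.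

  Distances are not longer (\<open>many_close_points\<close>): a point \<open>x\<close> at the scale of \<open>n\<close> steps joins the cluster of \<open>z\<close> if
  the smaller cluster of \<open>z\<close> with \<open>a\<close> steps and that of \<open>x\<close> with \<open>b\<close> steps are linked by an edge. The clusters
  of far apart points are independent, so by Chebyshev's inequality nearly the expected proportion of the points
  \<open>x\<close> has a large cluster. Only the failure at \<open>z\<close> itself is inherited from one scale to the next, with coefficient
  one, and the remaining errors are summable over the scales.

  Finally, \<open>F(y) = \<phi> \<beta> (e^y) y powr \<Delta>\<close> satisfies \<open>F((2 d / s) y) = 2 F(y)\<close>. Reading the two bounds at the scales
  \<open>n + 1 = \<lfloor>2^K t\<rfloor>\<close> with \<open>K \<rightarrow> \<infinity>\<close> gives \<open>F(\<lambda> \<Xi>(t) - A t powr \<alpha>) \<le> t \<le> F(\<lambda> \<Xi>(t) + A' t powr \<alpha>)\<close> for all large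
  \<open>\<beta>\<close> outside a countable set; monotonicity in \<open>\<beta>\<close> and continuity remove the exception (\<open>scaled_upper\<close>, \<open>scaled_lower\<close>). As
  \<open>\<lambda> \<rightarrow> \<infinity>\<close> this squeezes \<open>F(\<lambda> \<Xi>(t))\<close> to \<open>t\<close> uniformly on compact sets, which is the theorem in other
  coordinates (\<open>psi_eq\<close>).\<close>

section \<open>The limiting profile\<close>

locale lrp_exponents =
  fixes d s :: real
  assumes d_pos: "0 < d" and d_less_s: "d < s" and s_less_2d: "s < 2 * d"
begin

text \<open>The numbers \<open>growth\<close> and \<open>vol_exp\<close> are \<open>1 / \<gamma>\<close> and \<open>1 / \<Delta>\<close>.\<close>

definition growth :: real where "growth = 2 * d / s"
definition vol_exp :: real where "vol_exp = log 2 growth"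

lemma s_pos: "0 < s"
  using d_pos d_less_s by simp

lemma growth_bounds: "1 < growth" "growth < 2"
  using d_pos d_less_s s_less_2d by (auto simp: growth_def field_simps)

lemma s_growth: "s * growth = 2 * d"
  using s_pos by (simp add: growth_def)

lemma vol_exp_bounds: "0 < vol_exp" "vol_exp < 1"
  using growth_bounds by (auto simp: vol_exp_def log_less_one_cancel_iff)

lemma two_powr_vol_exp: "2 powr vol_exp = growth"
  using growth_bounds by (simp add: vol_exp_def)

lemma two_power_powr_vol_exp: "(2 ^ k) powr vol_exp = growth ^ k"
proof -
  have "((2::real) ^ k) powr vol_exp = (2 powr vol_exp) powr real k"
    by (simp add: powr_realpow[symmetric] powr_powr mult.commute)
  also have "\<dots> = growth ^ k"
    using growth_bounds by (simp add: two_powr_vol_exp powr_realpow)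
  finally show ?thesis .
qed

text \<open>The affine piece of the profile on \<open>[2^k, 2^(k+1)]\<close>. The first piece gives \<open>\<theta>(0) = 0\<close> and
  \<open>\<theta>(1) = 1 / s\<close> with \<open>\<theta>(n) = line 0 (n + 1) - 1 / (2 d - s)\<close>: points within distance \<open>\<beta> powr (1 / s)\<close> are
  neighbours. The other pieces follow from \<open>\<Xi>(2 t) = growth * \<Xi>(t)\<close>.\<close>

definition line :: "nat \<Rightarrow> real \<Rightarrow> real" where
  "line k t = growth ^ k * ((t / 2 ^ k - 1) / s + 1 / (2 * d - s))"

definition slope :: "nat \<Rightarrow> real" where
  "slope k = (growth / 2) ^ k / s"

definition level :: "real \<Rightarrow> nat" where
  "level t = nat \<lfloor>log 2 t\<rfloor>"

definition profile :: "real \<Rightarrow> real" where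
  "profile t = line (level t) t"

lemma slope_bounds: "0 < slope k" "slope k \<le> 1 / s"
proof -
  show "0 < slope k" using growth_bounds s_pos by (simp add: slope_def)
  have "(growth / 2) ^ k \<le> 1" using growth_bounds by (intro power_le_one) auto
  then show "slope k \<le> 1 / s" using s_pos by (simp add: slope_def divide_right_mono)
qed

lemma line_affine: "line k t - line k t' = slope k * (t - t')"
  using s_pos by (simp add: line_def slope_def power_divide field_simps)

lemma line_Suc: "line (Suc k) t = line k t + growth ^ k * ((1 - t / 2 ^ Suc k) * (2 - growth) / s)"
proof -
  define x where "x = t / 2 ^ Suc k"
  have x: "t / 2 ^ k = 2 * x" by (simp add: x_def)
  have g: "(growth - 1) / (2 * d - s) = 1 / s"
    using s_pos s_less_2d by (simp add: growth_def field_simps)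
  have "growth * ((x - 1) / s + 1 / (2 * d - s)) - ((2 * x - 1) / s + 1 / (2 * d - s))
      = (growth * (x - 1) - (2 * x - 1)) / s + (growth - 1) / (2 * d - s)"
    by (simp add: field_simps add_divide_distrib diff_divide_distrib)
  also have "\<dots> = (1 - x) * (2 - growth) / s"
    unfolding g using s_pos by (simp add: field_simps)
  finally have *: "growth * ((x - 1) / s + 1 / (2 * d - s))
      = ((2 * x - 1) / s + 1 / (2 * d - s)) + (1 - x) * (2 - growth) / s"
    by (simp only: diff_eq_eq add.commute)
  have "line (Suc k) t = growth ^ k * (growth * ((x - 1) / s + 1 / (2 * d - s)))"
    unfolding line_def x_def by simp
  also have "\<dots> = line k t + growth ^ k * ((1 - x) * (2 - growth) / s)"
    unfolding * line_def x by (simp add: distrib_left)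
  finally show ?thesis by (simp add: x_def)
qed

lemma line_le_Suc: "t \<le> 2 ^ Suc k \<Longrightarrow> line k t \<le> line (Suc k) t"
  and line_Suc_le: "2 ^ Suc k \<le> t \<Longrightarrow> line (Suc k) t \<le> line k t"
proof -
  assume "t \<le> 2 ^ Suc k"
  then have "0 \<le> growth ^ k * ((1 - t / 2 ^ Suc k) * (2 - growth) / s)"
    using growth_bounds s_pos by simp
  then show "line k t \<le> line (Suc k) t" unfolding line_Suc by simp
next
  assume "2 ^ Suc k \<le> t"
  then have "(1 - t / 2 ^ Suc k) \<le> 0" by (simp add: field_simps)
  then have "(1 - t / 2 ^ Suc k) * (2 - growth) / s \<le> 0"
    using growth_bounds s_pos by (intro divide_nonpos_pos mult_nonpos_nonneg) auto
  then have "growth ^ k * ((1 - t / 2 ^ Suc k) * (2 - growth) / s) \<le> 0"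
    using growth_bounds by (intro mult_nonneg_nonpos) auto
  then show "line (Suc k) t \<le> line k t" unfolding line_Suc by simp
qed

text \<open>Consecutive lines cross at \<open>2^(k+1)\<close>, and the slopes decrease with \<open>k\<close> because \<open>growth < 2\<close>.\<close>

lemma line_min:
  assumes "2 ^ k \<le> t" "t \<le> 2 ^ Suc k"
  shows "line k t \<le> line j t"
proof (cases "k \<le> j")
  case True
  then show ?thesis
  proof (induction j rule: dec_induct)
    case (step j)
    have "t \<le> 2 ^ Suc k" by fact
    also have "\<dots> \<le> (2::real) ^ Suc j" using step.hyps by (intro power_increasing) auto
    finally show ?case using line_le_Suc step.IH by (meson order_trans)
  qed simp
next
  case False
  then have "j \<le> k" by simp
  then show ?thesis
  proof (induction j rule: inc_induct)
    case (step j)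
    have "(2::real) ^ Suc j \<le> 2 ^ k" using step.hyps by (intro power_increasing) auto
    also have "\<dots> \<le> t" by fact
    finally show ?case using line_Suc_le step.IH by (meson order_trans)
  qed simp
qed

lemma level_bounds:
  assumes "1 \<le> t"
  shows "2 ^ level t \<le> t" "t < 2 ^ Suc (level t)"
proof -
  have "0 \<le> log 2 t" using assms by simp
  then have l: "real (level t) \<le> log 2 t" "log 2 t < real (Suc (level t))"
    unfolding level_def by linarith+
  have "2 ^ level t = 2 powr real (level t)" by (simp add: powr_realpow)
  also have "\<dots> \<le> t" using l(1) assms by (simp add: le_log_iff)
  finally show "2 ^ level t \<le> t" .
  have "t < 2 powr real (Suc (level t))" using l(2) assms by (simp add: log_less_iff)
  also have "\<dots> = 2 ^ Suc (level t)" by (subst powr_realpow) auto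
  finally show "t < 2 ^ Suc (level t)" .
qed

lemma profile_le_line: "1 \<le> t \<Longrightarrow> profile t \<le> line k t"
  unfolding profile_def using level_bounds[of t] by (intro line_min) auto

lemma profile_eq_line: "2 ^ k \<le> t \<Longrightarrow> t \<le> 2 ^ Suc k \<Longrightarrow> profile t = line k t"
proof (rule antisym)
  assume t: "2 ^ k \<le> t" "t \<le> 2 ^ Suc k"
  have "1 \<le> t" using t(1) one_le_power[of "2::real" k] by linarith
  then show "profile t \<le> line k t" by (rule profile_le_line)
  show "line k t \<le> profile t" unfolding profile_def by (rule line_min[OF t])
qed

lemma line_Suc_double: "line (Suc k) (2 * t) = growth * line k t"
  by (simp add: line_def)

lemma profile_double:
  assumes "1 \<le> t" shows "profile (2 * t) = growth * profile t"
proof -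
  have "profile (2 * t) = line (Suc (level t)) (2 * t)"
    using level_bounds[OF assms] by (intro profile_eq_line) auto
  then show ?thesis by (simp add: line_Suc_double profile_def)
qed

lemma profile_two_power: "1 \<le> t \<Longrightarrow> profile (2 ^ k * t) = growth ^ k * profile t"
proof (induction k)
  case (Suc k)
  have "profile (2 * (2 ^ k * t)) = growth * profile (2 ^ k * t)"
    using Suc.prems by (intro profile_double) (simp add: mult_ge1_I)
  then show ?case using Suc by (simp add: mult.assoc)
qed simp

lemma profile_slope:
  assumes "1 \<le> t" "1 \<le> t'"
  shows "profile t' \<le> profile t + slope (level t) * (t' - t)"
  using profile_le_line[OF assms(2), of "level t"] line_affine[of "level t" t' t]
  by (simp add: profile_def)

text \<open>As a minimum of affine functions the profile is concave.\<close>

lemma profile_midpoint: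
  assumes "1 \<le> a" "1 \<le> b"
  shows "profile a + profile b \<le> 2 * profile ((a + b) / 2)"
proof -
  let ?m = "(a + b) / 2"
  have m: "1 \<le> ?m" using assms by simp
  have "profile a + profile b \<le> 2 * profile ?m + slope (level ?m) * ((a - ?m) + (b - ?m))"
    using profile_slope[OF m assms(1)] profile_slope[OF m assms(2)]
    unfolding distrib_left[of "slope (level ?m)"] by linarith
  moreover have "(a - ?m) + (b - ?m) = 0" by (simp add: field_simps)
  ultimately show ?thesis by simp
qed

text \<open>The profile is affine between consecutive integers, so nothing is lost when an odd number is
  split into two halves that differ by one.\<close>

lemma profile_halves:
  assumes "2 \<le> (n::nat)"
  shows "profile (real (n div 2)) + profile (real (n - n div 2)) = 2 * profile (n / 2)"
proof -
  define a where "a = n div 2"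
  have a1: "1 \<le> real a" using assms by (simp add: a_def)
  define k where "k = level a"
  have ka: "2 ^ k \<le> a" "a < 2 ^ Suc k"
    using level_bounds[OF a1] unfolding k_def[symmetric]
    by (simp_all only: numeral_power_le_of_nat_cancel_iff of_nat_less_numeral_power_cancel_iff)
  consider "n = 2 * a" | "n = 2 * a + 1" unfolding a_def by (metis div_mult_mod_eq mod2_eq_if mult.commute add.right_neutral)
  then show ?thesis
  proof cases
    case 1
    then show ?thesis unfolding a_def[symmetric] by simp
  next
    case 2
    from ka have "a + 1 \<le> 2 ^ Suc k" by simp
    then have le: "real (a + 1) \<le> 2 ^ Suc k" by (simp only: of_nat_le_numeral_power_cancel_iff)
    have ge: "2 ^ k \<le> real a" using ka by (simp only: numeral_power_le_of_nat_cancel_iff)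
    have b: "real (n - a) = real a + 1" "real n / 2 = a + 1 / 2" using 2 by (auto simp: field_simps)
    have "profile a = line k a" "profile (real a + 1) = line k (real a + 1)"
      "profile (a + 1 / 2) = line k (a + 1 / 2)"
      using le ge by (auto intro!: profile_eq_line simp del: of_nat_power numeral_power_le_of_nat_cancel_iff)
    then show ?thesis
      unfolding a_def[symmetric] b
      using line_affine[of k "real a + 1" "a + 1 / 2"] line_affine[of k "real a" "a + 1 / 2"]
      by simp
  qed
qed

lemma profile_ge_growth: "1 \<le> t \<Longrightarrow> growth ^ level t / (2 * d - s) \<le> profile t"
proof -
  assume t: "1 \<le> t"
  have "0 \<le> (t / 2 ^ level t - 1) / s"
    using level_bounds(1)[OF t] s_pos by (simp add: field_simps)
  then have "growth ^ level t * (1 / (2 * d - s)) \<le> profile t"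
    unfolding profile_def line_def using growth_bounds by (intro mult_left_mono) auto
  then show ?thesis by simp
qed

lemma profile_pos:
  assumes "1 \<le> t" shows "0 < profile t"
proof -
  have "0 < growth ^ level t / (2 * d - s)" using growth_bounds s_less_2d by simp
  then show ?thesis using profile_ge_growth[OF assms] by linarith
qed

lemma powr_vol_exp_le_growth:
  assumes "1 \<le> t" shows "t powr vol_exp \<le> growth * growth ^ level t"
proof -
  have "t powr vol_exp \<le> (2 ^ Suc (level t)) powr vol_exp"
    using level_bounds(2)[OF assms] assms vol_exp_bounds by (intro powr_mono2) auto
  then show ?thesis unfolding two_power_powr_vol_exp by simp
qed

text \<open>By concavity the slope of the profile on \<open>[t', t]\<close> is at least its slope at \<open>t\<close>, which is of order
  \<open>t powr (vol_exp - 1)\<close>.\<close>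

lemma profile_increment:
  assumes "1 \<le> t'" "t' \<le> 3 / 4 * t"
  shows "t powr vol_exp / (4 * growth * s) \<le> profile t - profile t'"
proof -
  have t: "1 \<le> t" using assms by simp
  let ?k = "level t"
  have "t powr vol_exp / (4 * growth * s) \<le> (growth * growth ^ ?k) / (4 * growth * s)"
    using powr_vol_exp_le_growth[OF t] growth_bounds s_pos by (intro divide_right_mono) auto
  also have "\<dots> = slope ?k * (2 ^ ?k / 4)" 
    using growth_bounds by (simp add: slope_def power_divide)
  also have "\<dots> \<le> slope ?k * (t - t')"
    using level_bounds(1)[OF t] assms slope_bounds(1)[of ?k] by (intro mult_left_mono) auto
  also have "\<dots> \<le> profile t - profile t'"
    using profile_slope[OF t assms(1)] by (simp add: algebra_simps)
  finally show ?thesis .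
qed

lemma profile_lipschitz:
  assumes "1 \<le> t" "1 \<le> t'"
  shows "\<bar>profile t - profile t'\<bar> \<le> \<bar>t - t'\<bar> / s"
proof -
  have "profile a - profile b \<le> \<bar>t - t'\<bar> / s" if "1 \<le> a" "1 \<le> b" "\<bar>t - t'\<bar> = \<bar>a - b\<bar>" for a b
  proof -
    have "profile a - profile b \<le> slope (level b) * (a - b)"
      using profile_slope[OF that(2,1)] by simp
    also have "\<dots> \<le> slope (level b) * \<bar>a - b\<bar>"
      using slope_bounds(1)[of "level b"] by (intro mult_left_mono) auto
    also have "\<dots> \<le> 1 / s * \<bar>a - b\<bar>" using slope_bounds(2) by (intro mult_right_mono) auto
    finally show ?thesis using that by simp
  qed
  from this[of t t'] this[of t' t] show ?thesis using assms by (simp add: abs_minus_commute abs_le_iff)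
qed

lemma continuous_on_profile: "continuous_on {1..} profile"
proof -
  have "dist (profile x') (profile x) < e" if "dist x' x < e * s" "1 \<le> x" "1 \<le> x'" for x x' e
  proof -
    have "dist (profile x') (profile x) \<le> dist x' x / s"
      using profile_lipschitz[of x' x] that by (simp add: dist_real_def)
    also have "\<dots> < e" using that s_pos by (simp add: field_simps)
    finally show ?thesis .
  qed
  note close = this
  show ?thesis unfolding continuous_on_iff
  proof (intro ballI allI impI)
    fix x e :: real assume "x \<in> {1..}" "0 < e"
    then show "\<exists>\<delta>>0. \<forall>x'\<in>{1..}. dist x' x < \<delta> \<longrightarrow> dist (profile x') (profile x) < e"
      using close s_pos by (intro exI[of _ "e * s"]) auto
  qed
qed

section \<open>A correction that absorbs logarithmic errors\<close>

text \<open>The correction that will be added to or subtracted from \<open>\<lambda> \<Xi>(t)\<close>.\<close>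

definition corr :: "real \<Rightarrow> real \<Rightarrow> real \<Rightarrow> real \<Rightarrow> real" where
  "corr A B C t = A * t powr vol_exp - B * ln t - C"

lemma corr_midpoint:
  assumes A: "B \<le> A * (vol_exp * (1 - vol_exp))" and B: "0 \<le> B" and ab: "1 \<le> a" "1 \<le> b"
  shows "corr A B C a + corr A B C b \<le> 2 * corr A B C ((a + b) / 2)"
proof -
  define f' where "f' t = A * (vol_exp * t powr (vol_exp - 1)) - B / t" for t
  define f'' where "f'' t = A * (vol_exp * ((vol_exp - 1) * t powr (vol_exp - 2))) + B / t ^ 2" for t
  have "concave_on {1..} (corr A B C)"
  proof (rule f''_le0_imp_concave)
    show "(corr A B C has_real_derivative f' t) (at t)" if "t \<in> {1..}" for t
      unfolding corr_def[abs_def] f'_def using that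
      by (auto intro!: derivative_eq_intros simp: field_simps)
    show "(f' has_real_derivative f'' t) (at t)" if "t \<in> {1..}" for t
      unfolding f'_def[abs_def] f''_def using that
      by (auto intro!: derivative_eq_intros simp: field_simps power2_eq_square)
    show "f'' t \<le> 0" if "t \<in> {1..}" for t
    proof -
      have t: "1 \<le> t" using that by simp
      have p: "t powr (vol_exp - 2) = t powr vol_exp / t ^ 2"
        using t by (simp add: powr_diff powr_numeral)
      have A0: "0 \<le> A * (vol_exp * (1 - vol_exp))" using A B by simp
      have "B \<le> A * (vol_exp * (1 - vol_exp)) * 1" using A by simp
      also have "\<dots> \<le> A * (vol_exp * (1 - vol_exp)) * t powr vol_exp"
        using A0 t vol_exp_bounds by (intro mult_left_mono) (auto intro: ge_one_powr_ge_zero)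
      finally have "(B - A * (vol_exp * (1 - vol_exp)) * t powr vol_exp) / t ^ 2 \<le> 0"
        by (intro divide_nonpos_nonneg) auto
      then show ?thesis unfolding f''_def p using t by (simp add: field_simps)
    qed
  qed auto
  from concave_onD[OF this, of "1/2" a b] ab
  show ?thesis by (simp add: field_simps)
qed

text \<open>The same inequality serves both directions, as the correction enters the two recursions with opposite
  signs. The term \<open>A t powr vol_exp\<close> satisfies \<open>s f(t) = 2 d f(t/2)\<close> exactly and is concave enough
  to make up for the convex term \<open>- B ln t\<close>; that term in turn gains a multiple of \<open>ln t\<close> under
  halving, because \<open>s < 2 d\<close>.\<close>

lemma corr_absorbs:
  assumes E: "0 \<le> E" "0 \<le> E'"
  obtains A B C where "0 \<le> A" "0 \<le> B" "0 \<le> C"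
    "\<And>a b. 1 \<le> a \<Longrightarrow> 1 \<le> b \<Longrightarrow>
       d * (corr A B C a + corr A B C b) + E * ln (a + b) + E' \<le> s * corr A B C (a + b)"
    "\<And>t. 1 \<le> t \<Longrightarrow> 0 \<le> corr A B C t"
proof -
  define B where "B = E / (2 * d - s)"
  define C where "C = (E' + 2 * d * B * ln 2) / (2 * d - s)"
  define A where "A = max C (B / (vol_exp * (1 - vol_exp)))"
  have v: "0 < vol_exp * (1 - vol_exp)" using vol_exp_bounds by simp
  have B0: "0 \<le> B" using E s_less_2d by (simp add: B_def)
  have C0: "0 \<le> C" using E s_less_2d B0 d_pos by (simp add: C_def)
  have A0: "0 \<le> A" using C0 by (simp add: A_def)
  have BA: "B \<le> A * (vol_exp * (1 - vol_exp))"
    using v by (simp add: A_def pos_divide_le_eq[symmetric])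
  have "A * (vol_exp * (1 - vol_exp)) \<le> A * vol_exp"
    using A0 vol_exp_bounds by (intro mult_left_mono) (auto simp: mult_le_cancel_left2)
  then have BA': "B \<le> A * vol_exp" using BA by simp
  show thesis
  proof (rule that[OF A0 B0 C0])
    fix t :: real assume t: "1 \<le> t"
    have "B * ln t + C \<le> A * vol_exp * ln t + A"
      using BA' t by (intro add_mono mult_right_mono) (auto simp: A_def)
    also have "\<dots> = A * (1 + vol_exp * ln t)" by (simp add: algebra_simps)
    also have "\<dots> \<le> A * exp (vol_exp * ln t)" using A0 by (intro mult_left_mono exp_ge_add_one_self) auto
    finally show "0 \<le> corr A B C t" using t by (simp add: corr_def powr_def)
  next
    fix a b :: real assume ab: "1 \<le> a" "1 \<le> b"
    define t where "t = a + b"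
    have t: "0 < t" using ab by (simp add: t_def)
    have half: "s * (t powr vol_exp) = 2 * d * (t / 2) powr vol_exp"
      using t s_growth growth_bounds by (simp add: powr_divide two_powr_vol_exp field_simps)
    have "d * (corr A B C a + corr A B C b) \<le> 2 * d * corr A B C (t / 2)"
      using corr_midpoint[OF BA B0 ab, of C] d_pos by (simp add: t_def)
    also have "\<dots> = A * (s * t powr vol_exp) - 2 * d * B * (ln t - ln 2) - 2 * d * C"
      unfolding half corr_def using t by (simp add: ln_div algebra_simps)
    also have "\<dots> = s * corr A B C t - (2 * d - s) * B * ln t - (2 * d - s) * C + 2 * d * B * ln 2"
      by (simp add: corr_def algebra_simps)
    also have "\<dots> = s * corr A B C t - E * ln t - E'"
      using s_less_2d by (simp add: B_def C_def)
    finally show "d * (corr A B C a + corr A B C b) + E * ln (a + b) + E' \<le> s * corr A B C (a + b)"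
      by (simp add: t_def)
  qed
qed

lemma corr_le: "0 \<le> B \<Longrightarrow> 0 \<le> C \<Longrightarrow> 1 \<le> t \<Longrightarrow> corr A B C t \<le> A * t powr vol_exp"
  unfolding corr_def using mult_nonneg_nonneg[of B "ln t"] ln_ge_zero[of t] by linarith

section \<open>Logarithmic radii\<close>

text \<open>The number \<open>- 1 / (2 d - s)\<close> is the constant solution of \<open>s f(t) = 1 + 2 d f(t / 2)\<close>, so that adding it turns
  the homogeneous recursion for the profile into the one for the radii.\<close>

definition rad :: "real \<Rightarrow> real \<Rightarrow> real" where
  "rad lam t = lam * (profile t - 1 / (2 * d - s))"

lemma rad_double:
  assumes "2 \<le> t" shows "s * rad lam t = lam + 2 * d * rad lam (t / 2)"
proof -
  have "profile t = growth * profile (t / 2)" using profile_double[of "t / 2"] assms by simp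
  then have "s * rad lam t = lam * (s * growth * profile (t / 2) - s / (2 * d - s))"
    by (simp add: rad_def algebra_simps)
  also have "\<dots> = lam * (2 * d * profile (t / 2) + (1 - 2 * d / (2 * d - s)))"
    using s_less_2d unfolding s_growth by (simp add: field_simps)
  finally show ?thesis by (simp add: rad_def algebra_simps)
qed

lemma rad_split_le:
  assumes "0 \<le> lam" "1 \<le> a" "1 \<le> b"
  shows "lam + d * (rad lam a + rad lam b) \<le> s * rad lam (a + b)"
proof -
  have "lam * (profile a + profile b) \<le> lam * (2 * profile ((a + b) / 2))"
    using assms by (intro mult_left_mono profile_midpoint) auto
  then have "d * (rad lam a + rad lam b) \<le> d * (2 * rad lam ((a + b) / 2))"
    using d_pos by (intro mult_left_mono) (auto simp: rad_def algebra_simps)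
  then show ?thesis using rad_double[of "a + b"] assms by simp
qed

lemma rad_split_eq:
  assumes "2 \<le> (n::nat)"
  shows "lam + d * (rad lam (real (n div 2)) + rad lam (real (n - n div 2))) = s * rad lam n"
proof -
  have "rad lam (real (n div 2)) + rad lam (real (n - n div 2)) = 2 * rad lam (n / 2)"
  proof -
    have "lam * (profile (real (n div 2)) + profile (real (n - n div 2))) = lam * (2 * profile (n / 2))"
      by (simp only: profile_halves[OF assms])
    then have "lam * profile (real (n div 2)) + lam * profile (real (n - n div 2)) = 2 * (lam * profile (n / 2))"
      by (simp only: distrib_left mult.left_commute[of lam 2])
    then show ?thesis unfolding rad_def right_diff_distrib by linarith
  qed
  then show ?thesis using rad_double[of "real n"] assms by simp
qed

lemma rad_one: "rad lam 1 = 0"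
  using profile_eq_line[of 0 1] by (simp add: rad_def line_def)

lemma nat_floor_scaled:
  assumes "1 \<le> t"
  shows "(\<lambda>K. real (nat \<lfloor>2 ^ K * t\<rfloor>) / 2 ^ K) \<longlonglongrightarrow> t"
    and "\<And>K. 2 ^ K \<le> real (nat \<lfloor>2 ^ K * t\<rfloor>)" and "\<And>K. real (nat \<lfloor>2 ^ K * t\<rfloor>) \<le> 2 ^ K * t"
proof -
  have p: "2 ^ K \<le> 2 ^ K * t" for K using assms by simp
  have fl: "real (nat \<lfloor>2 ^ K * t\<rfloor>) = of_int \<lfloor>2 ^ K * t\<rfloor>" for K
    using assms by (intro of_nat_nat) (simp add: zero_le_mult_iff)
  show le: "real (nat \<lfloor>2 ^ K * t\<rfloor>) \<le> 2 ^ K * t" for K unfolding fl by linarith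
  show "2 ^ K \<le> real (nat \<lfloor>2 ^ K * t\<rfloor>)" for K
  proof -
    have "\<lfloor>2 ^ K :: real\<rfloor> \<le> \<lfloor>2 ^ K * t\<rfloor>" using p by (rule floor_mono)
    moreover have "\<lfloor>2 ^ K :: real\<rfloor> = 2 ^ K" using floor_of_int[of "2 ^ K"] by simp
    ultimately have "(2::int) ^ K \<le> \<lfloor>2 ^ K * t\<rfloor>" by simp
    then have "real_of_int (2 ^ K) \<le> of_int \<lfloor>2 ^ K * t\<rfloor>" by (simp only: of_int_le_iff)
    then show ?thesis unfolding fl by simp
  qed
  have lo: "t - (1/2) ^ K \<le> real (nat \<lfloor>2 ^ K * t\<rfloor>) / 2 ^ K" for K
  proof -
    have "2 ^ K * t - 1 \<le> real (nat \<lfloor>2 ^ K * t\<rfloor>)" unfolding fl by linarith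
    then have "(2 ^ K * t - 1) / 2 ^ K \<le> real (nat \<lfloor>2 ^ K * t\<rfloor>) / 2 ^ K"
      by (intro divide_right_mono) auto
    then show ?thesis by (simp add: diff_divide_distrib power_one_over)
  qed
  have "(\<lambda>K. t - (1/2) ^ K) \<longlonglongrightarrow> t - 0" by (intro tendsto_intros LIMSEQ_realpow_zero) auto
  then have lim: "(\<lambda>K. t - (1/2) ^ K) \<longlonglongrightarrow> t" by simp
  show "(\<lambda>K. real (nat \<lfloor>2 ^ K * t\<rfloor>) / 2 ^ K) \<longlonglongrightarrow> t"
    by (rule tendsto_sandwich[OF _ _ lim tendsto_const[of t]])
       (use lo le in \<open>auto simp: field_simps intro!: always_eventually\<close>)
qed

lemma linear_over_growth_power: "(\<lambda>K. (c * real K + c') / growth ^ K) \<longlonglongrightarrow> 0"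
proof -
  have "(\<lambda>K. c * (real K / growth ^ K) + c' * (1 / growth) ^ K) \<longlonglongrightarrow> c * 0 + c' * 0"
  proof (intro tendsto_add tendsto_mult tendsto_const)
    have "(\<lambda>n. real n * (1 / growth) ^ n) \<longlonglongrightarrow> 0"
      using growth_bounds by (intro powser_times_n_limit_0) auto
    then show "(\<lambda>K. real K / growth ^ K) \<longlonglongrightarrow> 0" by (simp add: power_one_over)
    show "(^) (1 / growth) \<longlonglongrightarrow> 0"
      using growth_bounds by (intro LIMSEQ_realpow_zero) auto
  qed
  then show ?thesis by (simp add: power_one_over add_divide_distrib)
qed

text \<open>Along the path lengths \<open>\<lfloor>2^K t\<rfloor> - 1\<close> the logarithmic radii, divided by \<open>growth^K\<close>, converge: the
  exactly homogeneous terms keep their form, and everything of lower order disappears.\<close>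

lemma rad_scaled_limit:
  assumes "1 \<le> t"
  shows "(\<lambda>K. rad lam (nat \<lfloor>2 ^ K * t\<rfloor>) / growth ^ K) \<longlonglongrightarrow> lam * profile t"
proof -
  define \<sigma> where "\<sigma> K = real (nat \<lfloor>2 ^ K * t\<rfloor>) / 2 ^ K" for K
  have \<sigma>1: "1 \<le> \<sigma> K" for K using nat_floor_scaled(2)[OF assms, of K] by (simp add: \<sigma>_def field_simps)
  have "(\<lambda>K. profile (\<sigma> K)) \<longlonglongrightarrow> profile t"
    by (rule continuous_on_tendsto_compose[OF continuous_on_profile])
       (use nat_floor_scaled(1)[OF assms] \<sigma>1 assms in \<open>auto simp: \<sigma>_def[abs_def]\<close>)
  then have "(\<lambda>K. lam * profile (\<sigma> K) - (0 * real K + lam / (2 * d - s)) / growth ^ K)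
      \<longlonglongrightarrow> lam * profile t - 0"
    by (intro tendsto_intros linear_over_growth_power)
  moreover have "lam * profile (\<sigma> K) - (0 * real K + lam / (2 * d - s)) / growth ^ K
      = rad lam (nat \<lfloor>2 ^ K * t\<rfloor>) / growth ^ K" for K
  proof -
    have "profile (nat \<lfloor>2 ^ K * t\<rfloor>) = growth ^ K * profile (\<sigma> K)"
      using profile_two_power[OF \<sigma>1[of K], of K] by (simp add: \<sigma>_def)
    then show ?thesis using growth_bounds s_less_2d by (simp add: rad_def field_simps)
  qed
  ultimately show ?thesis by simp
qed

lemma corr_scaled_limit:
  assumes "1 \<le> t"
  shows "(\<lambda>K. corr A B C (nat \<lfloor>2 ^ K * t\<rfloor>) / growth ^ K) \<longlonglongrightarrow> A * t powr vol_exp"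
proof -
  define m where "m K = real (nat \<lfloor>2 ^ K * t\<rfloor>)" for K
  have m1: "1 \<le> m K" for K
    using nat_floor_scaled(2)[OF assms, of K] one_le_power[of "2::real" K] unfolding m_def by linarith
  have "(\<lambda>K. (m K / 2 ^ K) powr vol_exp) \<longlonglongrightarrow> t powr vol_exp"
    using nat_floor_scaled(1)[OF assms] assms unfolding m_def by (intro tendsto_intros) auto
  moreover have "(m K / 2 ^ K) powr vol_exp = m K powr vol_exp / growth ^ K" for K
    using m1[of K] by (simp add: powr_divide two_power_powr_vol_exp)
  ultimately have l1: "(\<lambda>K. m K powr vol_exp / growth ^ K) \<longlonglongrightarrow> t powr vol_exp" by simp
  have l2: "(\<lambda>K. ln (m K) / growth ^ K) \<longlonglongrightarrow> 0"
  proof (rule tendsto_sandwich[OF _ _ tendsto_const[of 0] linear_over_growth_power[of "ln 2" "ln t"]])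
    have "ln (m K) \<le> ln 2 * real K + ln t" for K
    proof -
      have "ln (m K) \<le> ln (2 ^ K * t)"
        using m1[of K] nat_floor_scaled(3)[OF assms, of K] unfolding m_def by (intro ln_mono) auto
      then show ?thesis using assms by (simp add: ln_mult ln_realpow mult.commute)
    qed
    then show "\<forall>\<^sub>F K in sequentially. ln (m K) / growth ^ K \<le> (ln 2 * real K + ln t) / growth ^ K"
      using growth_bounds by (auto intro!: always_eventually divide_right_mono)
    show "\<forall>\<^sub>F K in sequentially. 0 \<le> ln (m K) / growth ^ K"
      using growth_bounds m1 by (auto intro!: always_eventually)
  qed
  have "(\<lambda>K. A * (m K powr vol_exp / growth ^ K) - B * (ln (m K) / growth ^ K)
      - (0 * real K + C) / growth ^ K) \<longlonglongrightarrow> A * t powr vol_exp - B * 0 - 0"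
    by (intro tendsto_intros l1 l2 linear_over_growth_power)
  then show ?thesis by (simp add: corr_def m_def diff_divide_distrib)
qed

end

section \<open>Lattice points in norm balls\<close>

lemma lattice_vec_simps [simp]:
  "lattice_vec (x - y) = lattice_vec x - lattice_vec y"
  "lattice_vec (x + y) = lattice_vec x + lattice_vec y"
  "lattice_vec (- x) = - lattice_vec x"
  "lattice_vec 0 = 0"
  "lattice_vec x = 0 \<longleftrightarrow> x = 0"
  by (auto simp: lattice_vec_def vec_eq_iff)

lemma card_box:
  fixes S :: "int set"
  assumes "finite S"
  shows "card {x :: int ^ 'n. \<forall>i. x $ i \<in> S} = card S ^ CARD('n)"
    and "finite {x :: int ^ 'n. \<forall>i. x $ i \<in> S}"
proof -
  have eq: "{x :: int ^ 'n. \<forall>i. x $ i \<in> S} = vec_lambda ` (UNIV \<rightarrow>\<^sub>E S)"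
  proof (intro equalityI subsetI)
    fix x :: "int ^ 'n" assume "x \<in> {x. \<forall>i. x $ i \<in> S}"
    then show "x \<in> vec_lambda ` (UNIV \<rightarrow>\<^sub>E S)"
      by (intro image_eqI[of _ _ "vec_nth x"]) auto
  qed (auto simp: PiE_iff)
  have "inj_on vec_lambda (UNIV \<rightarrow>\<^sub>E S :: ('n \<Rightarrow> int) set)"
    by (auto intro!: inj_onI simp: vec_lambda_inject)
  then show "card {x :: int ^ 'n. \<forall>i. x $ i \<in> S} = card S ^ CARD('n)"
    unfolding eq by (simp add: card_image card_PiE)
  show "finite {x :: int ^ 'n. \<forall>i. x $ i \<in> S}"
    unfolding eq using assms by (intro finite_imageI finite_PiE) auto
qed

locale lattice_norm =
  fixes N :: "real ^ 'n \<Rightarrow> real"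
  assumes norm_N: "is_norm N"
begin

abbreviation len :: "int ^ 'n \<Rightarrow> real" where "len x \<equiv> N (lattice_vec x)"

lemma N_scale: "N (c *\<^sub>R x) = \<bar>c\<bar> * N x"
  and N_triangle: "N (x + y) \<le> N x + N y"
  and N_eq_0: "N x = 0 \<longleftrightarrow> x = 0"
  using norm_N by (auto simp: is_norm_def)

lemma N_zero [simp]: "N 0 = 0"
  by (simp add: N_eq_0)

lemma N_minus [simp]: "N (- x) = N x"
  using N_scale[of "-1" x] by simp

lemma N_minus_commute: "N (x - y) = N (y - x)"
  using N_minus[of "x - y"] by simp

lemma N_nonneg [simp]: "0 \<le> N x"
  using N_triangle[of x "- x"] by simp

lemma N_pos: "x \<noteq> 0 \<Longrightarrow> 0 < N x"
  using N_nonneg[of x] N_eq_0[of x] by linarith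

lemma N_triangle_sub: "N (x - z) \<le> N (x - y) + N (y - z)"
  using N_triangle[of "x - y" "y - z"] by simp

lemma N_sum_le: "finite I \<Longrightarrow> N (\<Sum>i\<in>I. f i) \<le> (\<Sum>i\<in>I. N (f i))"
proof (induction I rule: finite_induct)
  case (insert i I)
  then show ?case using N_triangle[of "f i" "sum f I"] by simp
qed simp

definition coord_bound :: real where
  "coord_bound = (\<Sum>i\<in>UNIV. N (axis i 1)) + 1"

lemma coord_bound_pos: "0 < coord_bound"
  unfolding coord_bound_def by (simp add: add_nonneg_pos sum_nonneg)

lemma N_le_coords:
  assumes "\<And>i. \<bar>x $ i\<bar> \<le> M" shows "N x \<le> coord_bound * M"
proof -
  have M: "0 \<le> M" using assms[of undefined] by simp
  have "N x = N (\<Sum>i\<in>UNIV. x $ i *\<^sub>R axis i 1)"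
    by (simp add: basis_expansion[of x, unfolded scalar_mult_eq_scaleR])
  also have "\<dots> \<le> (\<Sum>i\<in>UNIV. N (x $ i *\<^sub>R axis i 1))"
    by (rule N_sum_le) simp
  also have "\<dots> \<le> (\<Sum>i\<in>UNIV. M * N (axis i 1))"
    unfolding N_scale by (intro sum_mono mult_right_mono assms) auto
  also have "\<dots> = (\<Sum>i\<in>UNIV. N (axis i 1)) * M" by (simp add: sum_distrib_left mult.commute)
  also have "\<dots> \<le> coord_bound * M"
    using M by (intro mult_right_mono) (auto simp: coord_bound_def)
  finally show ?thesis .
qed

lemma continuous_on_N: "continuous_on S N"
proof -
  have lip: "N x - N y \<le> coord_bound * norm (x - y)" for x y
  proof -
    have "N x - N y \<le> N (x - y)" using N_triangle[of "x - y" y] by simp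
    also have "\<dots> \<le> coord_bound * norm (x - y)" by (intro N_le_coords component_le_norm_cart)
    finally show ?thesis .
  qed
  have close: "dist (N x') (N x) \<le> coord_bound * dist x' x" for x x'
    using lip[of x x'] lip[of x' x] by (simp add: dist_real_def dist_norm norm_minus_commute)
  show ?thesis unfolding continuous_on_iff
  proof (intro ballI allI impI)
    fix x and e :: real assume "0 < e"
    show "\<exists>\<delta>>0. \<forall>x'\<in>S. dist x' x < \<delta> \<longrightarrow> dist (N x') (N x) < e"
    proof (intro exI[of _ "e / coord_bound"] conjI ballI impI)
      fix x' assume "dist x' x < e / coord_bound"
      then have "coord_bound * dist x' x < e"
        using coord_bound_pos by (simp add: field_simps)
      then show "dist (N x') (N x) < e" using close[of x' x] by simp
    qed (use \<open>0 < e\<close> coord_bound_pos in auto)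
  qed
qed

text \<open>By compactness \<open>N\<close> is bounded away from 0 on the Euclidean unit sphere.\<close>

lemma coord_le_N: obtains a where "0 < a" "\<And>x i. a * \<bar>x $ i\<bar> \<le> N x"
proof -
  let ?S = "sphere (0 :: real ^ 'n) 1"
  have "axis undefined 1 \<in> ?S" by simp
  then have "?S \<noteq> {}" by blast
  then obtain e where e: "e \<in> ?S" "\<And>x. x \<in> ?S \<Longrightarrow> N e \<le> N x"
    using continuous_attains_inf[OF compact_sphere _ continuous_on_N, of 0 1] by blast
  have "N e * \<bar>x $ i\<bar> \<le> N x" for x i
  proof (cases "x = 0")
    case False
    have "N e * norm x \<le> N ((1 / norm x) *\<^sub>R x) * norm x"
      using False by (intro mult_right_mono e(2)) auto
    also have "\<dots> = N x" using False by (simp add: N_scale)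
    finally have "N e * norm x \<le> N x" .
    moreover have "N e * \<bar>x $ i\<bar> \<le> N e * norm x" by (intro mult_left_mono component_le_norm_cart) auto
    ultimately show ?thesis by simp
  qed simp
  moreover have "0 < N e" using e(1) by (intro N_pos) auto
  ultimately show thesis using that by blast
qed

lemma lattice_ball_translate: "lattice_ball N z r = (\<lambda>y. z + y) ` lattice_ball N 0 r"
proof (intro equalityI subsetI)
  fix y assume "y \<in> lattice_ball N z r"
  then show "y \<in> (\<lambda>y. z + y) ` lattice_ball N 0 r"
    using N_minus_commute[of "lattice_vec y" "lattice_vec z"]
    by (intro image_eqI[of _ _ "y - z"]) (auto simp: lattice_ball_def)
qed (auto simp: lattice_ball_def)

lemma card_lattice_ball_translate: "card (lattice_ball N z r) = card (lattice_ball N 0 r)"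
  unfolding lattice_ball_translate[of z] by (intro card_image) (auto intro: inj_onI)

lemma ball_subset_box:
  obtains a where "0 < a"
    "\<And>r. lattice_ball N 0 r \<subseteq> {x. \<forall>i. x $ i \<in> {- int (nat \<lfloor>r / a\<rfloor>)..int (nat \<lfloor>r / a\<rfloor>)}}"
proof -
  obtain a where a: "0 < a" "\<And>x i. a * \<bar>x $ i\<bar> \<le> N x" using coord_le_N by blast
  have "x $ i \<in> {- int (nat \<lfloor>r / a\<rfloor>)..int (nat \<lfloor>r / a\<rfloor>)}" if "x \<in> lattice_ball N 0 r" for x r i
  proof -
    have "a * \<bar>lattice_vec x $ i\<bar> < r"
      using a(2)[of "lattice_vec x" i] that by (simp add: lattice_ball_def)
    then have "real_of_int \<bar>x $ i\<bar> \<le> r / a" using a(1) by (simp add: field_simps lattice_vec_def)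
    then have "\<bar>x $ i\<bar> \<le> int (nat \<lfloor>r / a\<rfloor>)" by linarith
    then show ?thesis by (auto simp: abs_le_iff)
  qed
  then show thesis using that[OF a(1)] by blast
qed

lemma finite_ball: "finite (lattice_ball N z r)"
proof -
  obtain a where "lattice_ball N 0 r
      \<subseteq> {x. \<forall>i. x $ i \<in> {- int (nat \<lfloor>r / a\<rfloor>)..int (nat \<lfloor>r / a\<rfloor>)}}"
    using ball_subset_box by metis
  then have "finite (lattice_ball N 0 r)"
    by (rule finite_subset) (rule card_box(2), simp)
  then show ?thesis unfolding lattice_ball_translate[of z] by simp
qed

lemma card_lattice_ball_lower:
  obtains c where "0 < c" "\<And>z r. 0 < r \<Longrightarrow> c * r ^ CARD('n) \<le> real (card (lattice_ball N z r))"
proof -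
  have "(1 / (2 * coord_bound)) ^ CARD('n) * r ^ CARD('n) \<le> real (card (lattice_ball N z r))"
    if r: "0 < r" for z r
  proof -
    define k where "k = nat \<lfloor>r / (2 * coord_bound)\<rfloor>"
    let ?B = "{x :: int ^ 'n. \<forall>i. x $ i \<in> {- int k..int k}}"
    have "0 \<le> r / (2 * coord_bound)" using r coord_bound_pos by simp
    then have k: "real k \<le> r / (2 * coord_bound)" "r / (2 * coord_bound) \<le> real k + 1"
      unfolding k_def by linarith+
    have sub: "?B \<subseteq> lattice_ball N 0 r"
    proof
      fix x :: "int ^ 'n" assume x: "x \<in> ?B"
      have "len x \<le> coord_bound * real k"
      proof (rule N_le_coords)
        fix i
        from x have "\<bar>x $ i\<bar> \<le> int k" by (auto simp: abs_le_iff minus_le_iff)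
        then have "real_of_int \<bar>x $ i\<bar> \<le> real k" by linarith
        then show "\<bar>lattice_vec x $ i\<bar> \<le> real k" by (simp add: lattice_vec_def)
      qed
      also have "\<dots> \<le> r / 2" using k(1) coord_bound_pos by (simp add: field_simps)
      also have "\<dots> < r" using r by simp
      finally show "x \<in> lattice_ball N 0 r" by (simp add: lattice_ball_def)
    qed
    have "(1 / (2 * coord_bound)) ^ CARD('n) * r ^ CARD('n) = (r / (2 * coord_bound)) ^ CARD('n)"
      by (simp add: power_mult_distrib[symmetric])
    also have "\<dots> \<le> real (2 * k + 1) ^ CARD('n)"
      using k(2) r coord_bound_pos by (intro power_mono) auto
    also have "\<dots> = real (card ?B)"
      by (subst card_box) (auto simp: add.commute)
    also have "\<dots> \<le> real (card (lattice_ball N 0 r))"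
      using card_mono[OF finite_ball sub] by simp
    also have "\<dots> = real (card (lattice_ball N z r))" by (simp add: card_lattice_ball_translate[of z])
    finally show ?thesis .
  qed
  then show thesis using that[of "(1 / (2 * coord_bound)) ^ CARD('n)"] coord_bound_pos by simp
qed

lemma card_lattice_ball_upper:
  obtains c where "0 < c" "\<And>z r. 1 \<le> r \<Longrightarrow> real (card (lattice_ball N z r)) \<le> c * r ^ CARD('n)"
proof -
  obtain a where a: "0 < a"
    "\<And>r. lattice_ball N 0 r \<subseteq> {x. \<forall>i. x $ i \<in> {- int (nat \<lfloor>r / a\<rfloor>)..int (nat \<lfloor>r / a\<rfloor>)}}"
    using ball_subset_box by blast
  have "real (card (lattice_ball N z r)) \<le> (2 / a + 1) ^ CARD('n) * r ^ CARD('n)" if r: "1 \<le> r" for z r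
  proof -
    define k where "k = nat \<lfloor>r / a\<rfloor>"
    let ?B = "{x :: int ^ 'n. \<forall>i. x $ i \<in> {- int k..int k}}"
    have "finite ?B" by (rule card_box) simp
    moreover have "lattice_ball N 0 r \<subseteq> ?B" unfolding k_def by (rule a(2))
    ultimately have "card (lattice_ball N 0 r) \<le> card ?B" by (rule card_mono)
    then have "real (card (lattice_ball N z r)) \<le> real (card ?B)"
      by (simp add: card_lattice_ball_translate[of z])
    also have "\<dots> = real (2 * k + 1) ^ CARD('n)"
      by (subst card_box) (auto simp: add.commute)
    also have "\<dots> \<le> ((2 / a + 1) * r) ^ CARD('n)"
    proof (rule power_mono)
      have "real k \<le> r / a" using r a(1) unfolding k_def by simp
      moreover have "(2 / a + 1) * r = 2 * (r / a) + r" by (simp add: distrib_right)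
      ultimately show "real (2 * k + 1) \<le> (2 / a + 1) * r" using r by simp
    qed simp
    finally show ?thesis by (simp add: power_mult_distrib)
  qed
  moreover have "0 < (2 / a + 1) ^ CARD('n)" using a(1) by (simp add: add_pos_pos)
  ultimately show thesis using that by blast
qed

definition annulus :: "real \<Rightarrow> int ^ 'n \<Rightarrow> real \<Rightarrow> (int ^ 'n) set" where
  "annulus \<eta> z r = {x \<in> lattice_ball N z r. \<eta> * r \<le> len (z - x)}"

lemma finite_annulus: "finite (annulus \<eta> z r)"
  unfolding annulus_def using finite_ball by simp

text \<open>For small \<open>\<eta>\<close> the inner ball holds at most half of the lower bound for the number of points in the ball.\<close>

lemma card_annulus_lower:
  obtains \<eta> c where "0 < \<eta>" "\<eta> < 1" "0 < c"
    "\<And>z r. 1 \<le> \<eta> * r \<Longrightarrow> c * r ^ CARD('n) \<le> real (card (annulus \<eta> z r))"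
proof -
  obtain c1 where c1: "0 < c1" "\<And>z r. 0 < r \<Longrightarrow> c1 * r ^ CARD('n) \<le> real (card (lattice_ball N z r))"
    using card_lattice_ball_lower by blast
  obtain c2 where c2: "0 < c2" "\<And>z r. 1 \<le> r \<Longrightarrow> real (card (lattice_ball N z r)) \<le> c2 * r ^ CARD('n)"
    using card_lattice_ball_upper by blast
  define \<eta> where "\<eta> = min (1 / 2) (c1 / (2 * c2))"
  have \<eta>: "0 < \<eta>" "\<eta> < 1" "\<eta> \<le> c1 / (2 * c2)" using c1(1) c2(1) by (auto simp: \<eta>_def)
  have "\<eta> ^ CARD('n) \<le> \<eta> ^ 1" using \<eta> by (intro power_decreasing) auto
  then have \<eta>d: "c2 * \<eta> ^ CARD('n) \<le> c1 / 2" 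
  proof -
    have "c2 * \<eta> ^ CARD('n) \<le> c2 * \<eta>" using \<open>\<eta> ^ CARD('n) \<le> \<eta> ^ 1\<close> c2(1) by simp
    also have "\<dots> \<le> c1 / 2" using \<eta>(3) c2(1) by (simp add: field_simps)
    finally show ?thesis .
  qed
  have "c1 / 2 * r ^ CARD('n) \<le> real (card (annulus \<eta> z r))" if r: "1 \<le> \<eta> * r" for z r
  proof -
    have r0: "0 < r" using r \<eta>(1) by (metis less_le_trans zero_less_mult_pos zero_less_one)
    have "lattice_ball N z r \<subseteq> annulus \<eta> z r \<union> lattice_ball N z (\<eta> * r)"
      by (auto simp: annulus_def lattice_ball_def)
    then have "card (lattice_ball N z r) \<le> card (annulus \<eta> z r \<union> lattice_ball N z (\<eta> * r))"
      by (intro card_mono) (auto simp: finite_annulus finite_ball)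
    also have "\<dots> \<le> card (annulus \<eta> z r) + card (lattice_ball N z (\<eta> * r))" by (rule card_Un_le)
    finally have "c1 * r ^ CARD('n) \<le> real (card (annulus \<eta> z r)) + real (card (lattice_ball N z (\<eta> * r)))"
      using c1(2)[OF r0, of z] by linarith
    moreover have "real (card (lattice_ball N z (\<eta> * r))) \<le> c2 * \<eta> ^ CARD('n) * r ^ CARD('n)"
      using c2(2)[OF r, of z] by (simp add: power_mult_distrib mult.assoc)
    moreover have "c2 * \<eta> ^ CARD('n) * r ^ CARD('n) \<le> c1 / 2 * r ^ CARD('n)"
      using \<eta>d r0 by (intro mult_right_mono) auto
    ultimately show ?thesis by simp
  qed
  then show thesis using that[of \<eta> "c1 / 2"] \<eta> c1(1) by simp
qed

text \<open>The decay profile of the connection probabilities, cut off at the radius \<open>R\<close>.\<close>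

definition tail :: "real \<Rightarrow> real \<Rightarrow> int ^ 'n \<Rightarrow> real" where
  "tail s R x = (if len x \<le> R then 1 else (R / len x) powr s)"

lemma tail_nonneg: "0 \<le> tail s R x"
  by (simp add: tail_def)

text \<open>Summation over the dyadic shells around the ball of radius \<open>R\<close>: since \<open>s\<close> exceeds the dimension the
  ball itself dominates.\<close>

lemma tail_sum_bound:
  assumes s: "real CARD('n) < s"
  obtains C where "0 < C" "\<And>R. 1 \<le> R \<Longrightarrow>
    (\<integral>\<^sup>+x. ennreal (tail s R x) \<partial>count_space UNIV) \<le> ennreal (C * R ^ CARD('n))"
proof -
  let ?d = "CARD('n)"
  obtain c where c: "0 < c" "\<And>z r. 1 \<le> r \<Longrightarrow> real (card (lattice_ball N z r)) \<le> c * r ^ ?d"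
    using card_lattice_ball_upper by metis
  define \<rho> where "\<rho> = (2::real) ^ ?d * 2 powr (- s)"
  have \<rho>: "0 < \<rho>" "\<rho> < 1"
  proof -
    have "\<rho> = 2 powr (real ?d - s)" by (simp add: \<rho>_def powr_diff powr_minus powr_realpow field_simps)
    then show "0 < \<rho>" "\<rho> < 1" using s by (auto simp: powr_less_one)
  qed
  define C where "C = c * 2 ^ ?d * (1 / (1 - \<rho>))"
  have "0 < C" using c(1) \<rho> by (simp add: C_def)
  moreover have "(\<integral>\<^sup>+x. ennreal (tail s R x) \<partial>count_space UNIV) \<le> ennreal (C * R ^ ?d)" if R: "1 \<le> R" for R
  proof -
    let ?w = "\<lambda>k. (2 powr (- s)) ^ k :: real"
    let ?B = "\<lambda>k. lattice_ball N 0 (2 ^ Suc k * R)"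
    have pt: "ennreal (tail s R x) \<le> (\<Sum>k. ennreal (?w k) * indicator (?B k) x)" for x
    proof -
      have "\<exists>k. tail s R x \<le> ?w k \<and> x \<in> ?B k"
      proof (cases "len x \<le> R")
        case True
        then show ?thesis using R by (intro exI[of _ 0]) (auto simp: tail_def lattice_ball_def)
      next
        case False
        define t where "t = len x / R"
        define k where "k = nat \<lfloor>log 2 t\<rfloor>"
        have t: "1 < t" using False R by (simp add: t_def)
        have l: "real k \<le> log 2 t" "log 2 t < real (Suc k)"
          using t zero_less_log_cancel_iff[of 2 t] unfolding k_def by linarith+
        have lo: "2 powr real k \<le> t" using l(1) t by (simp add: le_log_iff)
        have "t < 2 powr real (Suc k)" using l(2) t by (simp add: log_less_iff)
        then have hi: "t < 2 ^ Suc k" by (subst (asm) powr_realpow) auto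
        have "tail s R x = t powr (- s)"
          using False R by (simp add: tail_def t_def powr_minus powr_divide field_simps)
        also have "\<dots> \<le> (2 powr real k) powr (- s)"
          using lo s t by (intro powr_mono2') auto
        also have "\<dots> = ?w k" by (simp add: powr_powr powr_realpow[symmetric] mult.commute)
        finally have "tail s R x \<le> ?w k" .
        moreover have "x \<in> ?B k" using hi R by (simp add: lattice_ball_def t_def field_simps)
        ultimately show ?thesis by blast
      qed
      then obtain k where k: "tail s R x \<le> ?w k" "x \<in> ?B k" by blast
      have "ennreal (tail s R x) \<le> (\<Sum>k\<in>{k}. ennreal (?w k) * indicator (?B k) x)"
        using k by (simp add: ennreal_leI)
      also have "\<dots> \<le> (\<Sum>k. ennreal (?w k) * indicator (?B k) x)"
        by (rule sum_le_suminf) auto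
      finally show ?thesis .
    qed
    have "(\<integral>\<^sup>+x. ennreal (tail s R x) \<partial>count_space UNIV)
        \<le> (\<integral>\<^sup>+x. (\<Sum>k. ennreal (?w k) * indicator (?B k) x) \<partial>count_space UNIV)"
      by (rule nn_integral_mono) (use pt in auto)
    also have "\<dots> = (\<Sum>k. \<integral>\<^sup>+x. ennreal (?w k) * indicator (?B k) x \<partial>count_space UNIV)"
      by (rule nn_integral_suminf) auto
    also have "\<dots> = (\<Sum>k. ennreal (?w k * real (card (?B k))))"
      by (simp add: nn_integral_cmult finite_ball ennreal_mult' ennreal_of_nat_eq_real_of_nat)
    also have "\<dots> \<le> (\<Sum>k. ennreal (c * 2 ^ ?d * R ^ ?d * \<rho> ^ k))"
    proof (intro suminf_le ennreal_leI)
      fix k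
      have "1 * 1 \<le> 2 ^ Suc k * R" using R one_le_power[of "2::real" "Suc k"] by (intro mult_mono) auto
      then have "?w k * real (card (?B k)) \<le> ?w k * (c * (2 ^ Suc k * R) ^ ?d)"
        by (intro mult_left_mono c(2)) auto
      also have "\<dots> = c * 2 ^ ?d * R ^ ?d * \<rho> ^ k"
        by (simp add: \<rho>_def power_mult_distrib power_mult[symmetric] mult.commute[of k])
      finally show "?w k * real (card (?B k)) \<le> c * 2 ^ ?d * R ^ ?d * \<rho> ^ k" .
    qed auto
    also have "\<dots> = ennreal (\<Sum>k. c * 2 ^ ?d * R ^ ?d * \<rho> ^ k)"
      using \<rho> R c by (intro suminf_ennreal2 summable_mult summable_geometric) auto
    also have "(\<Sum>k. c * 2 ^ ?d * R ^ ?d * \<rho> ^ k) = C * R ^ ?d"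
      using \<rho> by (subst suminf_mult) (auto simp: C_def suminf_geometric summable_geometric)
    finally show ?thesis .
  qed
  ultimately show thesis using that by blast
qed

end

section \<open>Connection probabilities\<close>

locale lrp_kernel = lattice_norm N for N :: "real ^ 'n \<Rightarrow> real" +
  fixes s :: real and q :: "int ^ 'n \<Rightarrow> ennreal"
  assumes admissible: "admissible_kernel s N q" and s_gt_d: "real CARD('n) < s"
begin

lemma q_minus: "q (- x) = q x"
  using admissible by (simp add: admissible_kernel_def)

lemma conn_prob_commute: "conn_prob q \<beta> x y = conn_prob q \<beta> y x"
  using q_minus[of "x - y"] by (simp add: conn_prob_def)

lemma conn_prob_bounds:
  assumes "0 \<le> \<beta>" shows "0 \<le> conn_prob q \<beta> x y" "conn_prob q \<beta> x y \<le> 1"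
  using assms by (auto simp: conn_prob_def)

lemma edge_prob_eq: "edge_prob q \<beta> {x, y} = conn_prob q \<beta> x y"
  unfolding edge_prob_def
  by (rule the_equality) (auto simp: doubleton_eq_iff conn_prob_commute)

lemma kernel_asymptotics:
  obtains r0 where "1 \<le> r0"
    "\<And>x. r0 \<le> len x \<Longrightarrow> q x \<noteq> \<top> \<and>
       1 / 2 * len x powr (- s) \<le> enn2real (q x) \<and>
       enn2real (q x) \<le> 2 * len x powr (- s)"
proof -
  let ?f = "\<lambda>x. q x * ennreal (len x powr s)"
  have "(?f \<longlongrightarrow> 1) (filtercomap (\<lambda>x. len x) at_top)"
    using admissible by (simp add: admissible_kernel_def)
  moreover have "(1::ennreal) \<in> {ennreal (1/2)<..<2}"
    using ennreal_less_iff[of "1/2" 1] by simp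
  ultimately have "\<forall>\<^sub>F x in filtercomap (\<lambda>x. len x) at_top. ?f x \<in> {ennreal (1/2)<..<2}"
    by (intro topological_tendstoD) auto
  then obtain r where r: "\<And>x. r \<le> len x \<Longrightarrow> ?f x \<in> {ennreal (1/2)<..<2}"
    unfolding eventually_filtercomap eventually_at_top_linorder by blast
  show thesis
  proof (rule that[of "max 1 r"])
    fix x :: "int ^ 'n" assume x: "max 1 r \<le> len x"
    define p where "p = len x powr s"
    have p: "0 < p" using x by (auto simp: p_def)
    have f: "ennreal (1/2) < q x * ennreal p" "q x * ennreal p < 2"
      using r[of x] x by (auto simp: p_def)
    have fin: "q x \<noteq> \<top>" using f(2) p by (auto simp: ennreal_top_mult)
    then obtain v where v: "q x = ennreal v" "0 \<le> v" by (cases "q x") auto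
    have "q x * ennreal p = ennreal (v * p)" using v p by (simp add: ennreal_mult')
    then have "ennreal (1 / 2) < ennreal (v * p)" "ennreal (v * p) < ennreal 2"
      using f by simp_all
    then have b: "1 / 2 < v * p" "v * p < 2" using v p by (simp_all only: ennreal_less_iff)
    have np: "len x powr (- s) = 1 / p" by (simp add: p_def powr_minus divide_inverse)
    have "1 / 2 * (1 / p) \<le> v" "v \<le> 2 * (1 / p)"
      using b p by (simp_all add: field_simps)
    then show "q x \<noteq> \<top> \<and> 1 / 2 * len x powr (- s) \<le> enn2real (q x) \<and>
       enn2real (q x) \<le> 2 * len x powr (- s)"
      unfolding np using fin v by simp
  qed simp
qed

text \<open>Differences too short for the asymptotics of \<open>q\<close> are covered by the trivial bound 1 and a large constant; this
  uses \<open>\<beta> \<ge> 1\<close>.\<close>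

lemma conn_prob_upper:
  obtains c where "1 \<le> c"
    "\<And>\<beta> x y. 1 \<le> \<beta> \<Longrightarrow> x \<noteq> y \<Longrightarrow>
       conn_prob q \<beta> x y \<le> c * \<beta> * len (x - y) powr (- s)"
proof -
  obtain r0 where r0: "1 \<le> r0"
    "\<And>x. r0 \<le> len x \<Longrightarrow> q x \<noteq> \<top> \<and>
       1 / 2 * len x powr (- s) \<le> enn2real (q x) \<and>
       enn2real (q x) \<le> 2 * len x powr (- s)" using kernel_asymptotics by blast
  have s: "0 < s" using s_gt_d by (rule le_less_trans[rotated]) simp
  show thesis
  proof (rule that[of "max 2 (r0 powr s)"])
    fix \<beta> :: real and x y :: "int ^ 'n" assume \<beta>: "1 \<le> \<beta>" and xy: "x \<noteq> y"
    define n where "n = len (x - y)"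
    have n: "0 < n" unfolding n_def using xy by (intro N_pos) (simp flip: lattice_vec_simps(1))
    have np: "0 < n powr (- s)" using n by simp
    show "conn_prob q \<beta> x y \<le> max 2 (r0 powr s) * \<beta> * len (x - y) powr (- s)"
    proof (cases "r0 \<le> n")
      case True
      then have q: "q (x - y) \<noteq> \<top>" "enn2real (q (x - y)) \<le> 2 * n powr (- s)"
        using r0(2)[of "x - y"] unfolding n_def by auto
      have "conn_prob q \<beta> x y = 1 - exp (- \<beta> * enn2real (q (x - y)))"
        using q(1) by (simp add: conn_prob_def)
      also have "\<dots> \<le> \<beta> * enn2real (q (x - y))"
        using exp_ge_add_one_self[of "- \<beta> * enn2real (q (x - y))"] by simp
      also have "\<dots> \<le> \<beta> * (2 * n powr (- s))" using q(2) \<beta> by (intro mult_left_mono) auto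
      also have "\<dots> \<le> max 2 (r0 powr s) * \<beta> * n powr (- s)" using \<beta> np by simp
      finally show ?thesis by (simp add: n_def)
    next
      case False
      have "conn_prob q \<beta> x y \<le> 1 * 1" using conn_prob_bounds[of \<beta>] \<beta> by simp
      also have "\<dots> \<le> \<beta> * ((r0 / n) powr s)"
        using False \<beta> s n by (intro mult_mono ge_one_powr_ge_zero) auto
      also have "\<dots> = r0 powr s * \<beta> * n powr (- s)"
        using n r0(1) by (simp add: powr_divide powr_minus field_simps)
      also have "\<dots> \<le> max 2 (r0 powr s) * \<beta> * n powr (- s)"
        using \<beta> np by (intro mult_right_mono) auto
      finally show ?thesis by (simp add: n_def)
    qed
  qed simp
qed

text \<open>Here a lower bound \<open>r0\<close> on the distance is essential, as \<open>q\<close> may vanish at short differences.\<close>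

lemma conn_prob_lower:
  obtains r0 where "1 \<le> r0"
    "\<And>\<beta> x y. 0 \<le> \<beta> \<Longrightarrow> r0 \<le> len (x - y) \<Longrightarrow>
       1 - conn_prob q \<beta> x y \<le> exp (- (\<beta> / 2 * len (x - y) powr (- s)))"
proof -
  obtain r0 where r0: "1 \<le> r0"
    "\<And>x. r0 \<le> len x \<Longrightarrow> q x \<noteq> \<top> \<and>
       1 / 2 * len x powr (- s) \<le> enn2real (q x) \<and>
       enn2real (q x) \<le> 2 * len x powr (- s)" using kernel_asymptotics by blast
  show thesis
  proof (rule that[OF r0(1)])
    fix \<beta> :: real and x y :: "int ^ 'n"
    assume \<beta>: "0 \<le> \<beta>" and xy: "r0 \<le> len (x - y)"
    note q = r0(2)[OF xy]
    have "\<beta> * (1 / 2 * len (x - y) powr (- s)) \<le> \<beta> * enn2real (q (x - y))"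
      using q \<beta> by (intro mult_left_mono) auto
    then show "1 - conn_prob q \<beta> x y \<le> exp (- (\<beta> / 2 * len (x - y) powr (- s)))"
      using q by (simp add: conn_prob_def)
  qed
qed

end

section \<open>Independence of edges\<close>

definition depends_on :: "(('e \<Rightarrow> bool) \<Rightarrow> bool) \<Rightarrow> 'e set \<Rightarrow> bool" where
  "depends_on P F \<longleftrightarrow> (\<forall>\<omega> \<omega>'. (\<forall>e\<in>F. \<omega> e = \<omega>' e) \<longrightarrow> P \<omega> = P \<omega>')"

lemma depends_onD: "depends_on P F \<Longrightarrow> (\<And>e. e \<in> F \<Longrightarrow> \<omega> e = \<omega>' e) \<Longrightarrow> P \<omega> = P \<omega>'"
  unfolding depends_on_def by blast

lemma depends_on_mono: "depends_on P F \<Longrightarrow> F \<subseteq> G \<Longrightarrow> depends_on P G"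
  unfolding depends_on_def subset_iff by simp

lemma depends_on_conj: "depends_on P F \<Longrightarrow> depends_on Q F \<Longrightarrow> depends_on (\<lambda>\<omega>. P \<omega> \<and> Q \<omega>) F"
  unfolding depends_on_def by blast

lemma depends_on_not: "depends_on P F \<Longrightarrow> depends_on (\<lambda>\<omega>. \<not> P \<omega>) F"
  unfolding depends_on_def by blast

lemma doubleton_lrp_edges [simp]: "{x, y} \<in> lrp_edges \<longleftrightarrow> x \<noteq> y"
  by (auto simp: lrp_edges_def doubleton_eq_iff)

locale lrp = lrp_kernel N s q for N :: "real ^ 'n \<Rightarrow> real" and s q +
  fixes \<beta> :: real
  assumes \<beta>_pos: "0 < \<beta>"
begin

abbreviation M :: "((int ^ 'n) set \<Rightarrow> bool) measure" where "M \<equiv> lrp_measure q \<beta>"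

abbreviation p :: "(int ^ 'n) set \<Rightarrow> real" where "p \<equiv> edge_prob q \<beta>"

sublocale edges: product_prob_space "\<lambda>e. measure_pmf (bernoulli_pmf (p e))" lrp_edges
  by unfold_locales

sublocale prob_space M
  unfolding lrp_measure_def by unfold_locales

lemma p_bounds: "e \<in> lrp_edges \<Longrightarrow> 0 \<le> p e" "e \<in> lrp_edges \<Longrightarrow> p e \<le> 1"
  using conn_prob_bounds[of \<beta>] \<beta>_pos by (auto simp: lrp_edges_def edge_prob_eq)

lemma edge_measurable:
  "e \<in> lrp_edges \<Longrightarrow> (\<lambda>\<omega>. \<omega> e) \<in> measurable M (count_space UNIV)"
proof -
  assume "e \<in> lrp_edges"
  then have "(\<lambda>\<omega>. \<omega> e) \<in> measurable M (measure_pmf (bernoulli_pmf (p e)))"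
    unfolding lrp_measure_def by (rule measurable_component_singleton)
  then show ?thesis by simp
qed

text \<open>The probability that, among the edges in \<open>F\<close>, exactly those in \<open>A\<close> are present.\<close>

definition cylinder_weight :: "(int ^ 'n) set set \<Rightarrow> (int ^ 'n) set set \<Rightarrow> real" where
  "cylinder_weight F A = (\<Prod>e\<in>F. if e \<in> A then p e else 1 - p e)"

lemma cylinder_sets:
  assumes "finite F" "F \<subseteq> lrp_edges"
  shows "{\<omega> \<in> space M. \<forall>e\<in>F. \<omega> e = (e \<in> A)} \<in> sets M"
proof (rule sets.sets_Collect_finite_All[OF _ assms(1)])
  fix e assume "e \<in> F"
  then have "(\<lambda>\<omega>. \<omega> e) -` {e \<in> A} \<inter> space M \<in> sets M"
    using assms(2) by (intro measurable_sets[OF edge_measurable]) auto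
  moreover have "(\<lambda>\<omega>. \<omega> e) -` {e \<in> A} \<inter> space M = {\<omega> \<in> space M. \<omega> e = (e \<in> A)}" by blast
  ultimately show "{\<omega> \<in> space M. \<omega> e = (e \<in> A)} \<in> sets M" by simp
qed

lemma prob_cylinder:
  assumes "finite F" "F \<subseteq> lrp_edges"
  shows "prob {\<omega> \<in> space M. \<forall>e\<in>F. \<omega> e = (e \<in> A)} = cylinder_weight F A"
proof -
  have "emeasure M {\<omega> \<in> space M. \<forall>e\<in>F. \<omega> e \<in> {e \<in> A}}
      = (\<Prod>e\<in>F. emeasure (measure_pmf (bernoulli_pmf (p e))) {e \<in> A})"
    unfolding lrp_measure_def using assms by (intro edges.emeasure_PiM_Collect) auto
  also have "\<dots> = (\<Prod>e\<in>F. ennreal (if e \<in> A then p e else 1 - p e))"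
    using assms p_bounds by (intro prod.cong refl) (auto simp: emeasure_pmf_single)
  also have "\<dots> = ennreal (cylinder_weight F A)"
    unfolding cylinder_weight_def using assms p_bounds by (intro prod_ennreal) auto
  finally have "emeasure M {\<omega> \<in> space M. \<forall>e\<in>F. \<omega> e = (e \<in> A)} = ennreal (cylinder_weight F A)"
    by simp
  moreover have "0 \<le> cylinder_weight F A"
    unfolding cylinder_weight_def using assms p_bounds by (intro prod_nonneg) auto
  ultimately show ?thesis by (simp add: measure_def)
qed

lemma dependent_event:
  assumes F: "finite F" "F \<subseteq> lrp_edges" and P: "depends_on P F"
  shows "{\<omega> \<in> space M. P \<omega>} \<in> sets M"
    and "prob {\<omega> \<in> space M. P \<omega>} = (\<Sum>A | A \<subseteq> F \<and> P (\<lambda>e. e \<in> A). cylinder_weight F A)"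
proof -
  let ?I = "{A. A \<subseteq> F \<and> P (\<lambda>e. e \<in> A)}"
  let ?C = "\<lambda>A. {\<omega> \<in> space M. \<forall>e\<in>F. \<omega> e = (e \<in> A)}"
  have fin: "finite ?I" using F(1) by simp
  have eq: "{\<omega> \<in> space M. P \<omega>} = (\<Union>A\<in>?I. ?C A)"
  proof (intro equalityI subsetI)
    fix \<omega> assume w: "\<omega> \<in> {\<omega> \<in> space M. P \<omega>}"
    have "P (\<lambda>e. e \<in> {e \<in> F. \<omega> e})" using w depends_onD[OF P, of \<omega> "\<lambda>e. e \<in> {e \<in> F. \<omega> e}"] by auto
    then show "\<omega> \<in> (\<Union>A\<in>?I. ?C A)" using w by (intro UN_I[of "{e \<in> F. \<omega> e}"]) auto
  next
    fix \<omega> assume "\<omega> \<in> (\<Union>A\<in>?I. ?C A)"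
    then obtain A where "A \<in> ?I" "\<omega> \<in> ?C A" by blast
    then show "\<omega> \<in> {\<omega> \<in> space M. P \<omega>}" using depends_onD[OF P, of \<omega> "\<lambda>e. e \<in> A"] by auto
  qed
  show "{\<omega> \<in> space M. P \<omega>} \<in> sets M"
    unfolding eq using fin cylinder_sets[OF F] by (intro sets.finite_UN) auto
  have "disjoint_family_on ?C ?I" by (auto simp: disjoint_family_on_def)
  then have "prob (\<Union>A\<in>?I. ?C A) = (\<Sum>A\<in>?I. prob (?C A))"
    using cylinder_sets[OF F] fin by (intro finite_measure_finite_Union) auto
  then show "prob {\<omega> \<in> space M. P \<omega>} = (\<Sum>A\<in>?I. cylinder_weight F A)"
    unfolding eq prob_cylinder[OF F] .
qed

text \<open>Events that depend on finitely many edges are finite disjoint unions of cylinders, and cylinder weights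
  factorise over disjoint sets of edges.\<close>

lemma prob_independent:
  assumes F: "finite F" "F \<subseteq> lrp_edges" "depends_on P F"
    and G: "finite G" "G \<subseteq> lrp_edges" "depends_on Q G" and disj: "F \<inter> G = {}"
  shows "prob {\<omega> \<in> space M. P \<omega> \<and> Q \<omega>} = prob {\<omega> \<in> space M. P \<omega>} * prob {\<omega> \<in> space M. Q \<omega>}"
proof -
  let ?I = "{A. A \<subseteq> F \<and> P (\<lambda>e. e \<in> A)}"
  let ?J = "{B. B \<subseteq> G \<and> Q (\<lambda>e. e \<in> B)}"
  let ?K = "{A. A \<subseteq> F \<union> G \<and> P (\<lambda>e. e \<in> A) \<and> Q (\<lambda>e. e \<in> A)}"
  have "depends_on (\<lambda>\<omega>. P \<omega> \<and> Q \<omega>) (F \<union> G)"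
    using depends_on_mono[OF F(3)] depends_on_mono[OF G(3)] by (intro depends_on_conj) auto
  then have "prob {\<omega> \<in> space M. P \<omega> \<and> Q \<omega>} = (\<Sum>A\<in>?K. cylinder_weight (F \<union> G) A)"
    using F G by (intro dependent_event(2)) auto
  also have "\<dots> = (\<Sum>(A, B)\<in>?I \<times> ?J. cylinder_weight F A * cylinder_weight G B)"
  proof (rule sum.reindex_bij_witness[of _ "\<lambda>(A, B). A \<union> B" "\<lambda>A. (A \<inter> F, A \<inter> G)"])
    fix A assume A: "A \<in> ?K"
    show "(case (A \<inter> F, A \<inter> G) of (A, B) \<Rightarrow> A \<union> B) = A" using A by auto
    have "P (\<lambda>e. e \<in> A \<inter> F)" "Q (\<lambda>e. e \<in> A \<inter> G)"
      using A depends_onD[OF F(3), of "\<lambda>e. e \<in> A" "\<lambda>e. e \<in> A \<inter> F"]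
        depends_onD[OF G(3), of "\<lambda>e. e \<in> A" "\<lambda>e. e \<in> A \<inter> G"] by auto
    then show "(A \<inter> F, A \<inter> G) \<in> ?I \<times> ?J" by auto
    have "cylinder_weight (F \<union> G) A = cylinder_weight F A * cylinder_weight G A"
      unfolding cylinder_weight_def using F G disj by (intro prod.union_disjoint) auto
    moreover have "cylinder_weight F A = cylinder_weight F (A \<inter> F)" "cylinder_weight G A = cylinder_weight G (A \<inter> G)"
      unfolding cylinder_weight_def by (auto intro!: prod.cong)
    ultimately show "(case (A \<inter> F, A \<inter> G) of (A, B) \<Rightarrow> cylinder_weight F A * cylinder_weight G B)
        = cylinder_weight (F \<union> G) A" by simp
  next
    fix AB assume "AB \<in> ?I \<times> ?J"
    then obtain A B where AB: "AB = (A, B)" "A \<in> ?I" "B \<in> ?J" by blast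
    then have i: "(A \<union> B) \<inter> F = A" "(A \<union> B) \<inter> G = B" using disj by auto
    then show "((case AB of (A, B) \<Rightarrow> A \<union> B) \<inter> F, (case AB of (A, B) \<Rightarrow> A \<union> B) \<inter> G) = AB"
      using AB by simp
    have "P (\<lambda>e. e \<in> A \<union> B)" "Q (\<lambda>e. e \<in> A \<union> B)"
      using AB i depends_onD[OF F(3), of "\<lambda>e. e \<in> A" "\<lambda>e. e \<in> A \<union> B"]
        depends_onD[OF G(3), of "\<lambda>e. e \<in> B" "\<lambda>e. e \<in> A \<union> B"] by auto
    then show "(case AB of (A, B) \<Rightarrow> A \<union> B) \<in> ?K" using AB by auto
  qed
  also have "\<dots> = (\<Sum>A\<in>?I. cylinder_weight F A) * (\<Sum>B\<in>?J. cylinder_weight G B)"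
    by (simp add: sum_product sum.cartesian_product)
  also have "\<dots> = prob {\<omega> \<in> space M. P \<omega>} * prob {\<omega> \<in> space M. Q \<omega>}"
    using dependent_event(2)[OF F] dependent_event(2)[OF G] by simp
  finally show ?thesis .
qed

lemma present_sets:
  assumes "finite K" "K \<subseteq> lrp_edges" shows "{\<omega> \<in> space M. \<forall>e\<in>K. \<omega> e} \<in> sets M"
proof -
  have "{\<omega> \<in> space M. \<forall>e\<in>K. \<omega> e} = {\<omega> \<in> space M. \<forall>e\<in>K. \<omega> e = (e \<in> K)}" by blast
  then show ?thesis using cylinder_sets[OF assms, of K] by (simp only:)
qed

lemma prob_present:
  assumes "finite K" "K \<subseteq> lrp_edges"
  shows "prob {\<omega> \<in> space M. \<forall>e\<in>K. \<omega> e} = (\<Prod>e\<in>K. p e)"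
proof -
  have "{\<omega> \<in> space M. \<forall>e\<in>K. \<omega> e} = {\<omega> \<in> space M. \<forall>e\<in>K. \<omega> e = (e \<in> K)}" by blast
  then have "prob {\<omega> \<in> space M. \<forall>e\<in>K. \<omega> e} = cylinder_weight K K"
    using prob_cylinder[OF assms, of K] by (simp only:)
  also have "\<dots> = (\<Prod>e\<in>K. p e)" unfolding cylinder_weight_def by (rule prod.cong) auto
  finally show ?thesis .
qed

lemma prob_absent:
  assumes "finite K" "K \<subseteq> lrp_edges"
  shows "prob {\<omega> \<in> space M. \<forall>e\<in>K. \<not> \<omega> e} = (\<Prod>e\<in>K. 1 - p e)"
  using prob_cylinder[OF assms, of "{}"] by (simp add: cylinder_weight_def)

end

section \<open>Walks and the chemical distance\<close>

lemma sets_Collect_subset_of_points: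
  assumes "finite B" and P: "\<And>x. {\<omega> \<in> space M. P x \<omega>} \<in> sets M"
  shows "{\<omega> \<in> space M. Q {x \<in> B. P x \<omega>}} \<in> sets M"
proof -
  have "{\<omega> \<in> space M. \<exists>S\<in>Pow B. Q S \<and> (\<forall>x\<in>B. P x \<omega> = (x \<in> S))} \<in> sets M"
  proof (intro sets.sets_Collect_finite_Ex sets.sets_Collect_conj sets.sets_Collect_const
      sets.sets_Collect_finite_All)
    fix S x
    show "{\<omega> \<in> space M. P x \<omega> = (x \<in> S)} \<in> sets M"
      using P[of x] sets.sets_Collect_neg[OF P[of x]] by (cases "x \<in> S") auto
  qed (use assms(1) in auto)
  moreover have "(\<exists>S\<in>Pow B. Q S \<and> (\<forall>x\<in>B. P x \<omega> = (x \<in> S))) \<longleftrightarrow> Q {x \<in> B. P x \<omega>}" for \<omega>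
  proof
    assume "\<exists>S\<in>Pow B. Q S \<and> (\<forall>x\<in>B. P x \<omega> = (x \<in> S))"
    then obtain S where S: "S \<subseteq> B" "Q S" "\<forall>x\<in>B. P x \<omega> = (x \<in> S)" by blast
    then have "{x \<in> B. P x \<omega>} = S" by blast
    then show "Q {x \<in> B. P x \<omega>}" using S by simp
  qed blast
  ultimately show ?thesis by simp
qed

lemma lrp_adj_commute: "lrp_adj \<omega> x y \<longleftrightarrow> lrp_adj \<omega> y x"
  by (auto simp: lrp_adj_def insert_commute)

abbreviation adj_rel :: "((int ^ 'n) set \<Rightarrow> bool) \<Rightarrow> ((int ^ 'n) \<times> (int ^ 'n)) set" where
  "adj_rel \<omega> \<equiv> {(x, y). lrp_adj \<omega> x y}"

lemma walk_commute: "(x, y) \<in> adj_rel \<omega> ^^ n \<Longrightarrow> (y, x) \<in> adj_rel \<omega> ^^ n"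
proof (induction n arbitrary: y)
  case (Suc n)
  from Suc.prems obtain z where z: "(x, z) \<in> adj_rel \<omega> ^^ n" "(z, y) \<in> adj_rel \<omega>"
    by (rule relpow_Suc_E)
  have "(y, z) \<in> adj_rel \<omega>" using z(2) lrp_adj_commute[of \<omega> y z] by simp
  then show ?case using Suc.IH[OF z(1)] by (rule relpow_Suc_I2)
qed auto

text \<open>If the path found for the first \<open>n\<close> steps already visits the end point of the next step, it is cut there.\<close>

lemma walk_imp_path:
  assumes "(x, y) \<in> adj_rel \<omega> ^^ n"
  shows "\<exists>xs. lrp_path \<omega> x xs y \<and> length xs \<le> Suc n"
  using assms
proof (induction n arbitrary: y)
  case 0
  then show ?case by (intro exI[of _ "[x]"]) (auto simp: lrp_path_def)
next
  case (Suc n)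
  from Suc.prems obtain z where "(x, z) \<in> adj_rel \<omega> ^^ n" and zy: "(z, y) \<in> adj_rel \<omega>"
    by (rule relpow_Suc_E)
  then obtain xs where xs: "lrp_path \<omega> x xs z" "length xs \<le> Suc n" using Suc.IH by blast
  show ?case
  proof (cases "y \<in> set xs")
    case False
    then show ?thesis using xs zy
      by (intro exI[of _ "xs @ [y]"]) (auto simp: lrp_path_def successively_append_iff)
  next
    case True
    then obtain as bs where ab: "xs = as @ y # bs" by (meson split_list)
    then show ?thesis using xs
      by (intro exI[of _ "as @ [y]"]) (auto simp: lrp_path_def successively_append_iff hd_append)
  qed
qed

lemma Inf_enat_empty: "Inf {} = (\<infinity>::enat)"
  by (simp add: Inf_enat_def)

lemma Inf_enat_in: "A \<noteq> {} \<Longrightarrow> Inf A \<in> A" for A :: "enat set"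
  unfolding Inf_enat_def by (metis LeastI ex_in_conv)

lemma chem_dist_le_iff:
  "chem_dist \<omega> x y \<le> enat n \<longleftrightarrow> (\<exists>xs. lrp_path \<omega> x xs y \<and> length xs \<le> Suc n)"
proof
  let ?S = "{enat (length xs - 1) |xs. lrp_path \<omega> x xs y}"
  assume le: "chem_dist \<omega> x y \<le> enat n"
  have "?S \<noteq> {}"
  proof
    assume "?S = {}"
    then have "chem_dist \<omega> x y = \<infinity>" unfolding chem_dist_def by (simp only: Inf_enat_empty)
    then show False using le by simp
  qed
  then have "Inf ?S \<in> ?S" by (rule Inf_enat_in)
  then obtain xs where xs: "chem_dist \<omega> x y = enat (length xs - 1)" "lrp_path \<omega> x xs y"
    unfolding chem_dist_def by blast
  then show "\<exists>xs. lrp_path \<omega> x xs y \<and> length xs \<le> Suc n" using le by (intro exI[of _ xs]) auto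
next
  assume "\<exists>xs. lrp_path \<omega> x xs y \<and> length xs \<le> Suc n"
  then obtain xs where xs: "lrp_path \<omega> x xs y" "length xs \<le> Suc n" by blast
  have "chem_dist \<omega> x y \<le> enat (length xs - 1)"
    unfolding chem_dist_def using xs by (intro Inf_lower) auto
  also have "\<dots> \<le> enat n" using xs by simp
  finally show "chem_dist \<omega> x y \<le> enat n" .
qed

lemma walk_chem_dist: "(x, y) \<in> adj_rel \<omega> ^^ n \<Longrightarrow> chem_dist \<omega> x y \<le> enat n"
  by (simp add: chem_dist_le_iff walk_imp_path)

context lrp
begin

lemma adj_sets: "{\<omega> \<in> space M. lrp_adj \<omega> x y} \<in> sets M"
proof (cases "x = y")
  case False
  then have "(\<lambda>\<omega>. \<omega> {x, y}) \<in> measurable M (count_space UNIV)" by (intro edge_measurable) simp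
  then show ?thesis using False by (auto simp: lrp_adj_def)
qed (simp add: lrp_adj_def)

lemma path_sets: "{\<omega> \<in> space M. lrp_path \<omega> x xs y} \<in> sets M"
proof -
  have "{\<omega> \<in> space M. successively (lrp_adj \<omega>) xs} \<in> sets M"
  proof (induction xs rule: induct_list012)
    case (3 a b xs)
    have "{\<omega> \<in> space M. lrp_adj \<omega> a b \<and> successively (lrp_adj \<omega>) (b # xs)} \<in> sets M"
      by (intro sets.sets_Collect_conj adj_sets 3)
    then show ?case by simp
  qed auto
  then have "{\<omega> \<in> space M. xs \<noteq> [] \<and> hd xs = x \<and> last xs = y \<and> distinct xs \<and> successively (lrp_adj \<omega>) xs} \<in> sets M"
    by (intro sets.sets_Collect_conj sets.sets_Collect_const)
  then show ?thesis unfolding lrp_path_def .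
qed

lemma chem_dist_le_sets: "{\<omega> \<in> space M. chem_dist \<omega> x y \<le> enat n} \<in> sets M"
proof -
  have "{\<omega> \<in> space M. chem_dist \<omega> x y \<le> enat n}
      = (\<Union>xs\<in>{xs. length xs \<le> Suc n}. {\<omega> \<in> space M. lrp_path \<omega> x xs y})"
    unfolding chem_dist_le_iff by blast
  also have "\<dots> \<in> sets M" by (rule sets.countable_UN'[OF countableI_type]) (intro image_subsetI path_sets)
  finally show ?thesis .
qed

lemma chem_dist_measurable: "{\<omega> \<in> space M. Q (chem_dist \<omega> x y)} \<in> sets M"
proof -
  have le: "{\<omega> \<in> space M. chem_dist \<omega> x y \<le> k} \<in> sets M" for k
    by (cases k) (auto intro: chem_dist_le_sets)
  have "{\<omega> \<in> space M. chem_dist \<omega> x y < k} \<in> sets M" for k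
  proof -
    have "{\<omega> \<in> space M. chem_dist \<omega> x y < k} = (\<Union>j\<in>{..<k}. {\<omega> \<in> space M. chem_dist \<omega> x y \<le> j})"
      by (auto intro: le_less_trans)
    also have "\<dots> \<in> sets M" by (rule sets.countable_UN'[OF countableI_type]) (intro image_subsetI le)
    finally show ?thesis .
  qed
  then have "(\<Union>k\<in>Collect Q. {\<omega> \<in> space M. chem_dist \<omega> x y \<le> k} - {\<omega> \<in> space M. chem_dist \<omega> x y < k}) \<in> sets M"
    by (intro sets.countable_UN'[OF countableI_type] image_subsetI sets.Diff le)
  also have "(\<Union>k\<in>Collect Q. {\<omega> \<in> space M. chem_dist \<omega> x y \<le> k} - {\<omega> \<in> space M. chem_dist \<omega> x y < k})
      = {\<omega> \<in> space M. Q (chem_dist \<omega> x y)}"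
  proof (intro equalityI subsetI)
    fix \<omega> assume "\<omega> \<in> {\<omega> \<in> space M. Q (chem_dist \<omega> x y)}"
    then show "\<omega> \<in> (\<Union>k\<in>Collect Q. {\<omega> \<in> space M. chem_dist \<omega> x y \<le> k} - {\<omega> \<in> space M. chem_dist \<omega> x y < k})"
      by (intro UN_I[of "chem_dist \<omega> x y"]) auto
  next
    fix \<omega>
    assume "\<omega> \<in> (\<Union>k\<in>Collect Q. {\<omega> \<in> space M. chem_dist \<omega> x y \<le> k} - {\<omega> \<in> space M. chem_dist \<omega> x y < k})"
    then obtain k where k: "Q k" "\<omega> \<in> space M" "chem_dist \<omega> x y \<le> k" "\<not> chem_dist \<omega> x y < k" by blast
    then have "chem_dist \<omega> x y = k" by simp
    then show "\<omega> \<in> {\<omega> \<in> space M. Q (chem_dist \<omega> x y)}" using k by simp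
  qed
  finally show ?thesis .
qed

lemma point_set_measurable:
  "finite B \<Longrightarrow> {\<omega> \<in> space M. Q {x \<in> B. P x (chem_dist \<omega> 0 x)}} \<in> sets M"
  by (rule sets_Collect_subset_of_points[OF _ chem_dist_measurable])

end

section \<open>Two elementary bounds on counts of events\<close>

context prob_space
begin

lemma integrable_event: "E \<in> sets M \<Longrightarrow> integrable M (indicator E :: 'a \<Rightarrow> real)"
  by (intro integrable_real_indicator) (auto simp: emeasure_eq_measure)

text \<open>A step from one scale to the next tolerates two kinds of failures, each at up to a quarter of the points;
  this explains the proportion in the next two lemmas.\<close>

lemma prob_many_events_markov:
  assumes A: "finite A" "A \<noteq> {}" and meas: "\<And>x. x \<in> A \<Longrightarrow> {\<omega> \<in> space M. B x \<omega>} \<in> sets M"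
    and le: "\<And>x. x \<in> A \<Longrightarrow> prob {\<omega> \<in> space M. B x \<omega>} \<le> \<delta>"
  shows "prob {\<omega> \<in> space M. real (card A) / 4 \<le> real (card {x\<in>A. B x \<omega>})} \<le> 4 * \<delta>"
proof -
  define X where "X \<omega> = (\<Sum>x\<in>A. indicator {\<omega> \<in> space M. B x \<omega>} \<omega> :: real)" for \<omega>
  have X: "X \<omega> = real (card {x\<in>A. B x \<omega>})" if "\<omega> \<in> space M" for \<omega>
  proof -
    have "X \<omega> = (\<Sum>x\<in>A. if B x \<omega> then 1 else 0)"
      unfolding X_def using that by (intro sum.cong) (auto simp: indicator_def)
    also have "\<dots> = real (card {x\<in>A. B x \<omega>})" using A(1) by (simp add: sum.If_cases Int_def)
    finally show ?thesis .
  qed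
  have int: "integrable M X" unfolding X_def
    using meas by (intro Bochner_Integration.integrable_sum integrable_event)
  have card: "0 < real (card A)" using A by (simp add: card_gt_0_iff)
  have "expectation X = (\<Sum>x\<in>A. prob {\<omega> \<in> space M. B x \<omega>})"
    unfolding X_def using meas
    by (subst Bochner_Integration.integral_sum) (auto intro!: integrable_event sum.cong)
  also have "\<dots> \<le> real (card A) * \<delta>" using le by (intro sum_bounded_above) auto
  finally have E: "expectation X \<le> real (card A) * \<delta>" .
  have "{\<omega> \<in> space M. real (card A) / 4 \<le> real (card {x\<in>A. B x \<omega>})}
      = {\<omega> \<in> space M. real (card A) / 4 \<le> X \<omega>}" using X by auto
  also have "prob \<dots> \<le> expectation X / (real (card A) / 4)"
  proof (intro integral_Markov_inequality_measure[where A = "{}"] int)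
    show "AE \<omega> in M. 0 \<le> X \<omega>" unfolding X_def by (intro AE_I2 sum_nonneg) auto
  qed (use card in auto)
  also have "\<dots> \<le> (real (card A) * \<delta>) / (real (card A) / 4)"
    using E card by (intro divide_right_mono) auto
  also have "\<dots> = 4 * \<delta>" using card by simp
  finally show ?thesis .
qed

text \<open>Chebyshev's inequality: pairwise independence of most pairs keeps the number of events close to
  its mean.\<close>

lemma prob_many_events_chebyshev:
  assumes A: "finite A" "A \<noteq> {}" and meas: "\<And>x. x \<in> A \<Longrightarrow> {\<omega> \<in> space M. B x \<omega>} \<in> sets M"
    and le: "\<And>x. x \<in> A \<Longrightarrow> prob {\<omega> \<in> space M. B x \<omega>} \<le> 1 / 8"
    and few: "\<And>x. x \<in> A \<Longrightarrow> real (card {y\<in>A. near x y}) \<le> k"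
    and indep: "\<And>x y. x \<in> A \<Longrightarrow> y \<in> A \<Longrightarrow> \<not> near x y \<Longrightarrow>
      prob {\<omega> \<in> space M. B x \<omega> \<and> B y \<omega>} = prob {\<omega> \<in> space M. B x \<omega>} * prob {\<omega> \<in> space M. B y \<omega>}"
  shows "prob {\<omega> \<in> space M. real (card A) / 4 \<le> real (card {x\<in>A. B x \<omega>})} \<le> 64 * k / real (card A)"
proof -
  let ?E = "\<lambda>x. {\<omega> \<in> space M. B x \<omega>}"
  let ?n = "real (card A)"
  define X where "X \<omega> = (\<Sum>x\<in>A. indicator (?E x) \<omega> - prob (?E x))" for \<omega>
  have n: "0 < ?n" using A by (simp add: card_gt_0_iff)
  have X: "?n / 8 \<le> X \<omega>" if "\<omega> \<in> space M" "?n / 4 \<le> real (card {x\<in>A. B x \<omega>})" for \<omega>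
  proof -
    have "(\<Sum>x\<in>A. indicator (?E x) \<omega> :: real) = (\<Sum>x\<in>A. if B x \<omega> then 1 else 0)"
      using that by (intro sum.cong) (auto simp: indicator_def)
    also have "\<dots> = real (card {x\<in>A. B x \<omega>})" using A(1) by (simp add: sum.If_cases Int_def)
    moreover have "(\<Sum>x\<in>A. prob (?E x)) \<le> ?n * (1 / 8)"
      using le by (intro sum_bounded_above) auto
    ultimately show ?thesis using that(2) unfolding X_def sum_subtractf by linarith
  qed
  have sq: "(X \<omega>)\<^sup>2 = (\<Sum>x\<in>A. \<Sum>y\<in>A. (indicator (?E x) \<omega> - prob (?E x)) * (indicator (?E y) \<omega> - prob (?E y)))" for \<omega>
    unfolding X_def power2_eq_square sum_product ..
  have term_int: "integrable M (\<lambda>\<omega>. (indicator (?E x) \<omega> - prob (?E x)) * (indicator (?E y) \<omega> - prob (?E y)) :: real)"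
    (is "integrable M (?t x y)")
    and term_val: "expectation (\<lambda>\<omega>. (indicator (?E x) \<omega> - prob (?E x)) * (indicator (?E y) \<omega> - prob (?E y)) :: real)
      = prob {\<omega> \<in> space M. B x \<omega> \<and> B y \<omega>} - prob (?E x) * prob (?E y)"
    if "x \<in> A" "y \<in> A" for x y
  proof -
    have m: "?E x \<in> sets M" "?E y \<in> sets M" using meas that by auto
    have eq: "?t x y = (\<lambda>\<omega>. indicator (?E x \<inter> ?E y) \<omega> - prob (?E y) * indicator (?E x) \<omega>
        - prob (?E x) * indicator (?E y) \<omega> + prob (?E x) * prob (?E y))"
      by (auto simp: fun_eq_iff indicator_def algebra_simps)
    have "?E x \<inter> ?E y \<in> sets M" using m by simp
    note m = m this
    note i = m[THEN integrable_event]
    show "integrable M (?t x y)" unfolding eq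
      by (intro Bochner_Integration.integrable_add Bochner_Integration.integrable_diff
          integrable_mult_right integrable_const i)
    have "?E x \<inter> ?E y = {\<omega> \<in> space M. B x \<omega> \<and> B y \<omega>}" by auto
    then show "expectation (?t x y) = prob {\<omega> \<in> space M. B x \<omega> \<and> B y \<omega>} - prob (?E x) * prob (?E y)"
      unfolding eq using m i by (simp add: prob_space)
  qed
  have int: "integrable M (\<lambda>\<omega>. (X \<omega>)\<^sup>2)"
    unfolding sq by (intro Bochner_Integration.integrable_sum term_int)
  have "expectation (\<lambda>\<omega>. (X \<omega>)\<^sup>2)
      = (\<Sum>x\<in>A. \<Sum>y\<in>A. prob {\<omega> \<in> space M. B x \<omega> \<and> B y \<omega>} - prob (?E x) * prob (?E y))"
    unfolding sq
    by (simp add: Bochner_Integration.integral_sum Bochner_Integration.integrable_sum term_int term_val)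
  also have "\<dots> \<le> (\<Sum>x\<in>A. \<Sum>y\<in>A. if near x y then 1 else 0)"
  proof (intro sum_mono)
    fix x y assume xy: "x \<in> A" "y \<in> A"
    have "prob {\<omega> \<in> space M. B x \<omega> \<and> B y \<omega>} \<le> 1" by simp
    moreover have "0 \<le> prob (?E x) * prob (?E y)" by simp
    ultimately have "prob {\<omega> \<in> space M. B x \<omega> \<and> B y \<omega>} - prob (?E x) * prob (?E y) \<le> 1" by linarith
    then show "prob {\<omega> \<in> space M. B x \<omega> \<and> B y \<omega>} - prob (?E x) * prob (?E y) \<le> (if near x y then 1 else 0)"
      using indep[OF xy] by simp
  qed
  also have "\<dots> = (\<Sum>x\<in>A. real (card {y\<in>A. near x y}))"
    using A(1) by (simp add: sum.If_cases Int_def)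
  also have "\<dots> \<le> ?n * k" using few by (intro sum_bounded_above) auto
  finally have E: "expectation (\<lambda>\<omega>. (X \<omega>)\<^sup>2) \<le> ?n * k" .
  have "prob {\<omega> \<in> space M. ?n / 4 \<le> real (card {x\<in>A. B x \<omega>})} \<le> prob {\<omega> \<in> space M. (?n / 8)\<^sup>2 \<le> (X \<omega>)\<^sup>2}"
  proof (rule finite_measure_mono)
    show "{\<omega> \<in> space M. (?n / 8)\<^sup>2 \<le> (X \<omega>)\<^sup>2} \<in> sets M"
      using int by measurable
    show "{\<omega> \<in> space M. ?n / 4 \<le> real (card {x\<in>A. B x \<omega>})} \<subseteq> {\<omega> \<in> space M. (?n / 8)\<^sup>2 \<le> (X \<omega>)\<^sup>2}"
      using X by (auto intro!: power_mono)
  qed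
  also have "\<dots> \<le> expectation (\<lambda>\<omega>. (X \<omega>)\<^sup>2) / (?n / 8)\<^sup>2"
    using int n by (intro integral_Markov_inequality_measure[where A = "{}"]) auto
  also have "\<dots> \<le> ?n * k / (?n / 8)\<^sup>2" using E by (intro divide_right_mono) auto
  also have "\<dots> = 64 * k / ?n" using n by (simp add: power2_eq_square field_simps)
  finally show ?thesis .
qed

end

section \<open>Sums over countable families\<close>

text \<open>Different indices may produce the same edge set, so passing to the image can only decrease a sum.\<close>

lemma nn_integral_image_le:
  fixes w :: "'b \<Rightarrow> ennreal"
  shows "(\<integral>\<^sup>+y. w y * indicator (f ` I) y \<partial>count_space UNIV)
    \<le> (\<integral>\<^sup>+x. w (f x) * indicator I x \<partial>count_space UNIV)"
proof -
  let ?g = "inv_into I f"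
  have bij: "bij_betw ?g (f ` I) (?g ` f ` I)"
    by (intro inj_on_imp_bij_betw inj_on_inv_into) auto
  have sub: "?g ` f ` I \<subseteq> I" using inv_into_into[of _ f I] by blast
  have "(\<integral>\<^sup>+y. w y * indicator (f ` I) y \<partial>count_space UNIV) = (\<integral>\<^sup>+y. w y \<partial>count_space (f ` I))"
    by (simp add: nn_integral_count_space_indicator)
  also have "\<dots> = (\<integral>\<^sup>+y. w (f (?g y)) \<partial>count_space (f ` I))"
    by (intro nn_integral_cong) (simp add: f_inv_into_f)
  also have "\<dots> = (\<integral>\<^sup>+x. w (f x) \<partial>count_space (?g ` f ` I))"
    by (rule nn_integral_bij_count_space[OF bij])
  also have "\<dots> = (\<integral>\<^sup>+x. w (f x) * indicator (?g ` f ` I) x \<partial>count_space UNIV)"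
    by (simp add: nn_integral_count_space_indicator)
  also have "\<dots> \<le> (\<integral>\<^sup>+x. w (f x) * indicator I x \<partial>count_space UNIV)"
    using sub by (intro nn_integral_mono) (auto simp: indicator_def)
  finally show ?thesis .
qed

lemma emeasure_countable_UN_le:
  assumes I: "countable I" and A: "\<And>i. i \<in> I \<Longrightarrow> A i \<in> sets M"
  shows "emeasure M (\<Union>i\<in>I. A i) \<le> (\<integral>\<^sup>+i. emeasure M (A i) \<partial>count_space I)"
proof -
  have U: "(\<Union>i\<in>I. A i) \<in> sets M" using I A by (intro sets.countable_UN') auto
  have "emeasure M (\<Union>i\<in>I. A i) = (\<integral>\<^sup>+x. indicator (\<Union>i\<in>I. A i) x \<partial>M)"
    using U by simp
  also have "\<dots> \<le> (\<integral>\<^sup>+x. \<integral>\<^sup>+i. indicator (A i) x \<partial>count_space I \<partial>M)"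
  proof (intro nn_integral_mono)
    fix x
    show "indicator (\<Union>i\<in>I. A i) x \<le> (\<integral>\<^sup>+i. indicator (A i) x \<partial>count_space I)"
    proof (cases "x \<in> (\<Union>i\<in>I. A i)")
      case True
      then obtain i where i: "i \<in> I" "x \<in> A i" by blast
      have "(1::ennreal) = (\<integral>\<^sup>+j. indicator {i} j \<partial>count_space I)" using i by simp
      also have "\<dots> \<le> (\<integral>\<^sup>+j. indicator (A j) x \<partial>count_space I)"
        using i by (intro nn_integral_mono) (auto simp: indicator_def)
      finally show ?thesis using True by simp
    qed simp
  qed
  also have "\<dots> = (\<integral>\<^sup>+i. \<integral>\<^sup>+x. indicator (A i) x \<partial>M \<partial>count_space I)"
    using I A by (intro nn_integral_count_space_nn_integral) auto
  also have "\<dots> = (\<integral>\<^sup>+i. emeasure M (A i) \<partial>count_space I)"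
    using A by (intro nn_integral_cong) simp
  finally show ?thesis .
qed

section \<open>Edges of a path\<close>

fun path_edges :: "'a list \<Rightarrow> 'a set set" where
  "path_edges [] = {}"
| "path_edges [x] = {}"
| "path_edges (x # y # xs) = insert {x, y} (path_edges (y # xs))"

lemma path_edges_append:
  "as \<noteq> [] \<Longrightarrow> bs \<noteq> [] \<Longrightarrow>
    path_edges (as @ bs) = path_edges as \<union> path_edges bs \<union> {{last as, hd bs}}"
proof (induction as rule: path_edges.induct)
  case (2 x)
  then show ?case by (cases bs) auto
qed auto

lemma path_edges_subset: "e \<in> path_edges xs \<Longrightarrow> e \<subseteq> set xs \<and> e \<noteq> {}"
  by (induction xs rule: path_edges.induct) auto

lemma path_edges_present:
  "successively (lrp_adj \<omega>) xs \<Longrightarrow> e \<in> path_edges xs \<Longrightarrow> \<omega> e"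
  by (induction xs rule: path_edges.induct) (auto simp: lrp_adj_def)

definition simple_list :: "'a \<Rightarrow> 'a list \<Rightarrow> 'a \<Rightarrow> bool" where
  "simple_list x xs y \<longleftrightarrow> xs \<noteq> [] \<and> hd xs = x \<and> last xs = y \<and> distinct xs"

text \<open>The probability that a path exists is at most the sum, over such a family, of the probabilities that all the
  edges of a member are present.\<close>

definition skeletons :: "(int ^ 'n) set set set \<Rightarrow> nat \<Rightarrow> int ^ 'n \<Rightarrow> int ^ 'n \<Rightarrow> bool" where
  "skeletons \<K> n x y \<longleftrightarrow>
     (\<forall>K\<in>\<K>. finite K \<and> K \<subseteq> lrp_edges) \<and>
     (\<forall>xs. simple_list x xs y \<and> length xs \<le> Suc n \<longrightarrow> (\<exists>K\<in>\<K>. K \<subseteq> path_edges xs))"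

context lattice_norm
begin

text \<open>By the triangle inequality not all steps of a path can be shorter than the average.\<close>

lemma long_step:
  assumes "xs \<noteq> []"
    and "\<And>as bs. xs = as @ bs \<Longrightarrow> as \<noteq> [] \<Longrightarrow> bs \<noteq> [] \<Longrightarrow>
      len (last as - hd bs) \<le> \<delta>"
  shows "len (hd xs - last xs) \<le> real (length xs - 1) * \<delta>"
  using assms
proof (induction xs)
  case (Cons x xs)
  show ?case
  proof (cases "xs = []")
    case False
    have "len (hd xs - last xs) \<le> real (length xs - 1) * \<delta>"
    proof (rule Cons.IH[OF False])
      fix as bs assume "xs = as @ bs" "as \<noteq> []" "bs \<noteq> []"
      then show "len (last as - hd bs) \<le> \<delta>" using Cons.prems(2)[of "x # as" bs] by simp
    qed
    moreover have "len (x - hd xs) \<le> \<delta>" using Cons.prems(2)[of "[x]" xs] False by simp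
    moreover have "len (x - last xs) \<le> len (x - hd xs) + len (hd xs - last xs)"
      using N_triangle_sub by simp
    moreover have "real (length (x # xs) - 1) * \<delta> = real (length xs - 1) * \<delta> + \<delta>"
      using False by (cases xs) (auto simp: algebra_simps)
    ultimately show ?thesis using False by simp
  qed simp
qed simp

end

section \<open>Short paths are unlikely\<close>

context lrp
begin

definition weight :: "(int ^ 'n) set set \<Rightarrow> ennreal" where
  "weight K = ennreal (\<Prod>e\<in>K. p e)"

definition total_weight :: "(int ^ 'n) set set set \<Rightarrow> ennreal" where
  "total_weight \<K> = (\<integral>\<^sup>+K. weight K * indicator \<K> K \<partial>count_space UNIV)"

lemma prob_skeletons:
  assumes "skeletons \<K> n x y"
  shows "emeasure M {\<omega> \<in> space M. chem_dist \<omega> x y \<le> enat n} \<le> total_weight \<K>"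
proof -
  have \<K>: "finite K" "K \<subseteq> lrp_edges" if "K \<in> \<K>" for K
    using assms that by (auto simp: skeletons_def)
  have "countable (lrp_edges :: (int ^ 'n) set set)"
  proof (rule countable_subset)
    show "countable ((\<lambda>(x, y). {x, y}) ` (UNIV :: ((int ^ 'n) \<times> (int ^ 'n)) set))" by simp
  qed (auto simp: lrp_edges_def)
  then have "countable {K :: (int ^ 'n) set set. finite K \<and> K \<subseteq> lrp_edges}"
    by (rule countable_Collect_finite_subset)
  then have cK: "countable \<K>" by (rule countable_subset[rotated]) (use \<K> in auto)
  let ?A = "\<lambda>K. {\<omega> \<in> space M. \<forall>e\<in>K. \<omega> e}"
  have sub: "{\<omega> \<in> space M. chem_dist \<omega> x y \<le> enat n} \<subseteq> (\<Union>K\<in>\<K>. ?A K)"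
  proof
    fix \<omega> assume w: "\<omega> \<in> {\<omega> \<in> space M. chem_dist \<omega> x y \<le> enat n}"
    then obtain xs where xs: "lrp_path \<omega> x xs y" "length xs \<le> Suc n" by (auto simp: chem_dist_le_iff)
    then have "simple_list x xs y" by (auto simp: simple_list_def lrp_path_def)
    then obtain K where K: "K \<in> \<K>" "K \<subseteq> path_edges xs" using assms xs(2) unfolding skeletons_def by blast
    have "\<forall>e\<in>K. \<omega> e" using K(2) xs(1) path_edges_present unfolding lrp_path_def by blast
    then show "\<omega> \<in> (\<Union>K\<in>\<K>. ?A K)" using K(1) w by blast
  qed
  have "(\<Union>K\<in>\<K>. ?A K) \<in> sets M" using cK \<K> present_sets by (intro sets.countable_UN') auto
  then have "emeasure M {\<omega> \<in> space M. chem_dist \<omega> x y \<le> enat n} \<le> emeasure M (\<Union>K\<in>\<K>. ?A K)"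
    using sub by (intro emeasure_mono)
  also have "\<dots> \<le> (\<integral>\<^sup>+K. emeasure M (?A K) \<partial>count_space \<K>)"
    using cK \<K> present_sets by (intro emeasure_countable_UN_le) auto
  also have "\<dots> = (\<integral>\<^sup>+K. weight K \<partial>count_space \<K>)"
    using \<K> by (intro nn_integral_cong) (simp add: emeasure_eq_measure prob_present weight_def)
  also have "\<dots> = total_weight \<K>"
    by (simp add: total_weight_def nn_integral_count_space_indicator)
  finally show ?thesis .
qed

text \<open>The index \<open>(a, u, v, K1, K2)\<close> stands for a long edge \<open>{u, v}\<close> that is preceded by at most \<open>a\<close> edges with skeleton
  \<open>K1\<close> and followed by at most \<open>n - 1 - a\<close> edges with skeleton \<open>K2\<close>.\<close>

definition join :: "nat \<times> (int ^ 'n) \<times> (int ^ 'n) \<times> (int ^ 'n) set set \<times> (int ^ 'n) set set \<Rightarrow> (int ^ 'n) set set" where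
  "join = (\<lambda>(a, u, v, K1, K2). insert {u, v} (K1 \<union> K2))"

definition join_index where
  "join_index \<K> n \<delta> x y =
     {(a, u, v, K1, K2). a < n \<and> u \<noteq> v \<and> \<delta> < len (u - v) \<and>
        K1 \<in> \<K> a x u \<and> K2 \<in> \<K> (n - 1 - a) v y \<and> K1 \<inter> K2 = {} \<and> {u, v} \<notin> K1 \<union> K2}"

text \<open>Cutting a simple path at a long edge leaves two pieces without common points, hence with disjoint skeletons
  that do not contain the cut edge.\<close>

lemma join_skeletons:
  assumes \<K>: "\<And>m x y. m < n \<Longrightarrow> skeletons (\<K> m x y) m x y"
    and \<delta>: "0 \<le> \<delta>" "real n * \<delta> < len (x - y)"
  shows "skeletons (join ` join_index \<K> n \<delta> x y) n x y"
  unfolding skeletons_def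
proof (intro conjI ballI allI impI)
  fix K assume "K \<in> join ` join_index \<K> n \<delta> x y"
  then obtain a u v K1 K2 where K: "K = insert {u, v} (K1 \<union> K2)" "a < n" "u \<noteq> v"
    "K1 \<in> \<K> a x u" "K2 \<in> \<K> (n - 1 - a) v y"
    by (auto simp: join_def join_index_def)
  have "n - 1 - a < n" using K(2) by simp
  then have "finite K1 \<and> K1 \<subseteq> lrp_edges" "finite K2 \<and> K2 \<subseteq> lrp_edges"
    using \<K>[of a x u] \<K>[of "n - 1 - a" v y] K by (auto simp: skeletons_def)
  then show "finite K" "K \<subseteq> lrp_edges" using K by auto
next
  fix xs assume xs: "simple_list x xs y \<and> length xs \<le> Suc n"
  then have ne: "xs \<noteq> []" and hl: "hd xs = x" "last xs = y" and dist: "distinct xs" and len: "length xs \<le> Suc n"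
    by (auto simp: simple_list_def)
  have "\<exists>as bs. xs = as @ bs \<and> as \<noteq> [] \<and> bs \<noteq> [] \<and> \<delta> < len (last as - hd bs)"
  proof (rule ccontr)
    assume "\<not> ?thesis"
    then have "len (hd xs - last xs) \<le> real (length xs - 1) * \<delta>"
      by (intro long_step[OF ne]) (metis not_less)
    also have "\<dots> \<le> real n * \<delta>" using len \<delta>(1) by (intro mult_right_mono) auto
    finally show False using \<delta>(2) hl by simp
  qed
  then obtain as bs where ab: "xs = as @ bs" "as \<noteq> []" "bs \<noteq> []" "\<delta> < len (last as - hd bs)"
    by blast
  define a where "a = length as - 1"
  have la: "0 < length as" "0 < length bs" using ab by auto
  have a: "a < n" "length as \<le> Suc a" "length bs \<le> Suc (n - 1 - a)"
    unfolding a_def using la len[unfolded ab(1) length_append] by linarith+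
  have "simple_list x as (last as)" "simple_list (hd bs) bs y"
    using ab hl dist by (auto simp: simple_list_def)
  note s = this
  obtain K1 where K1: "K1 \<in> \<K> a x (last as)" "K1 \<subseteq> path_edges as"
    using \<K>[OF a(1), of x "last as"] s(1) a(2) unfolding skeletons_def by blast
  have "n - 1 - a < n" using a(1) by simp
  from \<K>[OF this, of "hd bs" y] s(2) a(3) obtain K2
    where K2: "K2 \<in> \<K> (n - 1 - a) (hd bs) y" "K2 \<subseteq> path_edges bs"
    unfolding skeletons_def by blast
  note K = K1 K2
  have d: "set as \<inter> set bs = {}" using dist ab(1) by simp
  have in_sets: "last as \<in> set as" "hd bs \<in> set bs" using ab by auto
  have "K1 \<inter> K2 = {}"
  proof (rule ccontr)
    assume "K1 \<inter> K2 \<noteq> {}"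
    then obtain e where "e \<in> path_edges as" "e \<in> path_edges bs" using K by blast
    then show False using path_edges_subset[of e as] path_edges_subset[of e bs] d by blast
  qed
  moreover have "{last as, hd bs} \<notin> K1 \<union> K2"
  proof
    assume "{last as, hd bs} \<in> K1 \<union> K2"
    then have "{last as, hd bs} \<subseteq> set as \<or> {last as, hd bs} \<subseteq> set bs"
      using K path_edges_subset by blast
    then show False using d in_sets by blast
  qed
  moreover have "last as \<noteq> hd bs" using d in_sets by auto
  ultimately have "(a, last as, hd bs, K1, K2) \<in> join_index \<K> n \<delta> x y"
    using a ab K unfolding join_index_def by simp
  moreover have "join (a, last as, hd bs, K1, K2) \<subseteq> path_edges xs"
    using K unfolding ab(1) path_edges_append[OF ab(2,3)] by (auto simp: join_def)
  ultimately show "\<exists>K\<in>join ` join_index \<K> n \<delta> x y. K \<subseteq> path_edges xs" by blast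
qed

text \<open>Disjointness in \<open>join_index\<close> makes the weight of a joined skeleton the product of three weights, so the sum over
  all of them is at most a product of sums.\<close>

lemma join_weight:
  assumes \<K>: "\<And>m x y. m < n \<Longrightarrow> skeletons (\<K> m x y) m x y"
    and pt: "\<And>u v. u \<noteq> v \<Longrightarrow> \<delta> < len (u - v) \<Longrightarrow> conn_prob q \<beta> u v \<le> P"
  shows "total_weight (join ` join_index \<K> n \<delta> x y) \<le>
    (\<Sum>a<n. ennreal P * (\<integral>\<^sup>+u. total_weight (\<K> a x u) \<partial>count_space UNIV)
      * (\<integral>\<^sup>+v. total_weight (\<K> (n - 1 - a) v y) \<partial>count_space UNIV))"
proof -
  define W where "W \<K> K = weight K * indicator \<K> K" for \<K> and K :: "(int ^ 'n) set set"
  have W: "(\<integral>\<^sup>+K. W \<K> K \<partial>count_space UNIV) = total_weight \<K>" for \<K>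
    by (simp add: W_def total_weight_def)
  define G where "G = (\<lambda>(a, u, v, K1, K2). ennreal P * (indicator {..<n} a * (W (\<K> a x u) K1 * W (\<K> (n - 1 - a) v y) K2)))"
  have "total_weight (join ` join_index \<K> n \<delta> x y)
      \<le> (\<integral>\<^sup>+i. weight (join i) * indicator (join_index \<K> n \<delta> x y) i \<partial>count_space UNIV)"
    unfolding total_weight_def by (rule nn_integral_image_le)
  also have "\<dots> \<le> (\<integral>\<^sup>+i. G i \<partial>count_space UNIV)"
  proof (intro nn_integral_mono)
    fix i
    show "weight (join i) * indicator (join_index \<K> n \<delta> x y) i \<le> G i"
    proof (cases "i \<in> join_index \<K> n \<delta> x y")
      case True
      then obtain a u v K1 K2 where i: "i = (a, u, v, K1, K2)" "a < n" "u \<noteq> v" "\<delta> < len (u - v)"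
          "K1 \<in> \<K> a x u" "K2 \<in> \<K> (n - 1 - a) v y" "K1 \<inter> K2 = {}" "{u, v} \<notin> K1 \<union> K2"
        by (auto simp: join_index_def)
      have "n - 1 - a < n" using i(2) by simp
      then have fin: "finite K1" "K1 \<subseteq> lrp_edges" "finite K2" "K2 \<subseteq> lrp_edges"
        using \<K>[of a x u] \<K>[of "n - 1 - a" v y] i by (auto simp: skeletons_def)
      have nn: "0 \<le> (\<Prod>e\<in>K1. p e)" "0 \<le> (\<Prod>e\<in>K2. p e)"
        using fin p_bounds by (auto intro!: prod_nonneg)
      have "(\<Prod>e\<in>join i. p e) = p {u, v} * ((\<Prod>e\<in>K1. p e) * (\<Prod>e\<in>K2. p e))"
        using i fin by (simp add: join_def prod.union_disjoint)
      also have "\<dots> \<le> P * ((\<Prod>e\<in>K1. p e) * (\<Prod>e\<in>K2. p e))"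
        using pt[OF i(3,4)] nn by (intro mult_right_mono) (auto simp: edge_prob_eq)
      finally have "weight (join i) \<le> ennreal (P * ((\<Prod>e\<in>K1. p e) * (\<Prod>e\<in>K2. p e)))"
        unfolding weight_def by (rule ennreal_leI)
      also have "\<dots> = ennreal P * (weight K1 * weight K2)"
        using nn by (simp add: weight_def ennreal_mult ennreal_mult'')
      also have "\<dots> = G i" using i by (simp add: G_def W_def)
      finally show ?thesis using True by simp
    qed simp
  qed
  also have "\<dots> = (\<integral>\<^sup>+a. \<integral>\<^sup>+r. G (a, r) \<partial>count_space UNIV \<partial>count_space UNIV)"
    by (rule nn_integral_fst_count_space[symmetric])
  also have "\<dots> = (\<integral>\<^sup>+a. \<integral>\<^sup>+u. \<integral>\<^sup>+r. G (a, u, r) \<partial>count_space UNIV \<partial>count_space UNIV \<partial>count_space UNIV)"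
    by (intro nn_integral_cong) (rule nn_integral_fst_count_space[symmetric])
  also have "\<dots> = (\<integral>\<^sup>+a. \<integral>\<^sup>+u. \<integral>\<^sup>+v. \<integral>\<^sup>+r. G (a, u, v, r) \<partial>count_space UNIV \<partial>count_space UNIV \<partial>count_space UNIV \<partial>count_space UNIV)"
    by (intro nn_integral_cong) (rule nn_integral_fst_count_space[symmetric])
  also have "\<dots> = (\<integral>\<^sup>+a. \<integral>\<^sup>+u. \<integral>\<^sup>+v. \<integral>\<^sup>+K1. \<integral>\<^sup>+K2. G (a, u, v, K1, K2) \<partial>count_space UNIV \<partial>count_space UNIV \<partial>count_space UNIV \<partial>count_space UNIV \<partial>count_space UNIV)"
    by (intro nn_integral_cong) (rule nn_integral_fst_count_space[symmetric])
  also have "\<dots> = (\<integral>\<^sup>+a. ennreal P * (indicator {..<n} a * ((\<integral>\<^sup>+u. total_weight (\<K> a x u) \<partial>count_space UNIV)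
      * (\<integral>\<^sup>+v. total_weight (\<K> (n - 1 - a) v y) \<partial>count_space UNIV))) \<partial>count_space UNIV)"
    by (simp add: G_def nn_integral_cmult nn_integral_multc W)
  also have "\<dots> = (\<Sum>a<n. ennreal P * (\<integral>\<^sup>+u. total_weight (\<K> a x u) \<partial>count_space UNIV)
      * (\<integral>\<^sup>+v. total_weight (\<K> (n - 1 - a) v y) \<partial>count_space UNIV))"
    by (subst nn_integral_count_space'[of "{..<n}"]) (auto simp: mult.assoc)
  finally show ?thesis .
qed

lemma tail_translate:
  "(\<integral>\<^sup>+u. ennreal (tail s r (x - u)) \<partial>count_space UNIV) = (\<integral>\<^sup>+u. ennreal (tail s r u) \<partial>count_space UNIV)"
  "(\<integral>\<^sup>+v. ennreal (tail s r (v - x)) \<partial>count_space UNIV) = (\<integral>\<^sup>+u. ennreal (tail s r u) \<partial>count_space UNIV)"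
proof -
  have "bij_betw (\<lambda>u. x - u) UNIV UNIV" by (rule bij_betwI[where g = "\<lambda>u. x - u"]) auto
  moreover have "bij_betw (\<lambda>v. v - x) UNIV UNIV" by (rule bij_betwI[where g = "\<lambda>u. u + x"]) auto
  ultimately
  show "(\<integral>\<^sup>+u. ennreal (tail s r (x - u)) \<partial>count_space UNIV) = (\<integral>\<^sup>+u. ennreal (tail s r u) \<partial>count_space UNIV)"
    "(\<integral>\<^sup>+v. ennreal (tail s r (v - x)) \<partial>count_space UNIV) = (\<integral>\<^sup>+u. ennreal (tail s r u) \<partial>count_space UNIV)"
    by (auto intro: nn_integral_bij_count_space[of _ UNIV UNIV "\<lambda>u. ennreal (tail s r u)"])
qed

text \<open>For ends at distance at most \<open>R n\<close> the empty skeleton is used, which has weight 1. Otherwise the bound for the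
  weights of the pieces is summable over the free end points, with sums of order \<open>R a ^ d\<close> and \<open>R b ^ d\<close>, and the
  last assumption is exactly what closes the induction.\<close>

proposition skeletons_exist:
  fixes R :: "nat \<Rightarrow> real"
  assumes \<beta>: "1 \<le> \<beta>"
    and c: "0 < c" "\<And>x y. x \<noteq> y \<Longrightarrow> conn_prob q \<beta> x y \<le> c * \<beta> * len (x - y) powr (- s)"
    and C: "0 < C" "\<And>r. 1 \<le> r \<Longrightarrow>
      (\<integral>\<^sup>+x. ennreal (tail s r x) \<partial>count_space UNIV) \<le> ennreal (C * r ^ CARD('n))"
    and R1: "\<And>n. 1 \<le> R n"
    and R: "\<And>a b. c * \<beta> * (2 * real (a + b + 1)) powr s * (C * R a ^ CARD('n)) * (C * R b ^ CARD('n)) * real (a + b + 1)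
      \<le> R (a + b + 1) powr s"
  shows "\<exists>\<K>. skeletons \<K> n x y \<and> total_weight \<K> \<le> ennreal (tail s (R n) (x - y))"
proof (induction n arbitrary: x y rule: less_induct)
  case (less n)
  define D where "D = len (x - y)"
  have s0: "0 < s" using s_gt_d by (rule le_less_trans[rotated]) simp
  show ?case
  proof (cases "D \<le> R n")
    case True
    have "total_weight {{}} = 1"
    proof -
      have "total_weight {{}} = (\<integral>\<^sup>+K. weight K \<partial>count_space {{}})"
        by (simp add: total_weight_def nn_integral_count_space_indicator)
      also have "\<dots> = 1" by (simp add: nn_integral_count_space_finite weight_def)
      finally show ?thesis .
    qed
    then show ?thesis using True by (intro exI[of _ "{{}}"]) (auto simp: skeletons_def tail_def D_def)
  next
    case False
    then have D: "R n < D" "0 < D" using R1[of n] by auto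
    show ?thesis
    proof (cases "n = 0")
      case True
      have "x \<noteq> y" using D(2) by (auto simp: D_def)
      then have "\<not> (simple_list x xs y \<and> length xs \<le> Suc 0)" for xs
        by (cases xs; cases "tl xs") (auto simp: simple_list_def)
      then show ?thesis using True by (intro exI[of _ "{}"]) (auto simp: skeletons_def total_weight_def)
    next
      case False
      then have n: "1 \<le> real n" by simp
      have "\<forall>m x y. \<exists>\<K>. m < n \<longrightarrow> skeletons \<K> m x y \<and> total_weight \<K> \<le> ennreal (tail s (R m) (x - y))"
        using less.IH by blast
      then obtain \<K> where \<K>: "\<And>m x y. m < n \<Longrightarrow> skeletons (\<K> m x y) m x y"
        "\<And>m x y. m < n \<Longrightarrow> total_weight (\<K> m x y) \<le> ennreal (tail s (R m) (x - y))"
        by metis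
      \<comment> \<open>Half of the average step, so that the inequality for the length of the long edge is strict.\<close>
      define \<delta> where "\<delta> = D / (2 * real n)"
      have \<delta>: "0 < \<delta>" "real n * \<delta> < D" using D n by (auto simp: \<delta>_def)
      define P where "P = c * \<beta> * (2 * real n) powr s * D powr (- s)"
      have P: "conn_prob q \<beta> u v \<le> P" if "u \<noteq> v" "\<delta> < len (u - v)" for u v
      proof -
        have "conn_prob q \<beta> u v \<le> c * \<beta> * len (u - v) powr (- s)" by (rule c(2)[OF that(1)])
        also have "\<dots> \<le> c * \<beta> * \<delta> powr (- s)"
          using that(2) \<delta>(1) s0 c(1) \<beta> by (intro mult_left_mono powr_mono2') auto
        also have "\<delta> powr (- s) = (2 * real n) powr s * D powr (- s)"
          using D n by (simp add: \<delta>_def powr_divide powr_minus field_simps)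
        finally show ?thesis by (simp add: P_def mult.assoc)
      qed
      have P0: "0 \<le> P" using c(1) \<beta> by (simp add: P_def)
      have bound: "ennreal P * (\<integral>\<^sup>+u. total_weight (\<K> a x u) \<partial>count_space UNIV)
          * (\<integral>\<^sup>+v. total_weight (\<K> (n - 1 - a) v y) \<partial>count_space UNIV)
          \<le> ennreal ((R n / D) powr s / real n)" if "a < n" for a
      proof -
        define b where "b = n - 1 - a"
        have b: "b < n" "a + b + 1 = n" using that by (auto simp: b_def)
        have "(\<integral>\<^sup>+u. total_weight (\<K> a x u) \<partial>count_space UNIV) \<le> (\<integral>\<^sup>+u. ennreal (tail s (R a) (x - u)) \<partial>count_space UNIV)"
          by (intro nn_integral_mono \<K>(2) that)
        also have "\<dots> \<le> ennreal (C * R a ^ CARD('n))" unfolding tail_translate by (rule C(2)[OF R1])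
        finally have 1: "(\<integral>\<^sup>+u. total_weight (\<K> a x u) \<partial>count_space UNIV) \<le> ennreal (C * R a ^ CARD('n))" .
        have "(\<integral>\<^sup>+v. total_weight (\<K> b v y) \<partial>count_space UNIV) \<le> (\<integral>\<^sup>+v. ennreal (tail s (R b) (v - y)) \<partial>count_space UNIV)"
          by (intro nn_integral_mono \<K>(2) b)
        also have "\<dots> \<le> ennreal (C * R b ^ CARD('n))" unfolding tail_translate by (rule C(2)[OF R1])
        finally have 2: "(\<integral>\<^sup>+v. total_weight (\<K> b v y) \<partial>count_space UNIV) \<le> ennreal (C * R b ^ CARD('n))" .
        have Rp: "0 \<le> C * R m ^ CARD('n)" for m using C(1) R1[of m] by simp
        have "ennreal P * (\<integral>\<^sup>+u. total_weight (\<K> a x u) \<partial>count_space UNIV)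
            * (\<integral>\<^sup>+v. total_weight (\<K> b v y) \<partial>count_space UNIV)
            \<le> ennreal P * ennreal (C * R a ^ CARD('n)) * ennreal (C * R b ^ CARD('n))"
          by (intro mult_mono 1 2) auto
        also have "\<dots> = ennreal (P * (C * R a ^ CARD('n)) * (C * R b ^ CARD('n)))"
          using P0 Rp by (simp add: ennreal_mult)
        also have "\<dots> \<le> ennreal ((R n / D) powr s / real n)"
        proof (rule ennreal_leI)
          have "P * (C * R a ^ CARD('n)) * (C * R b ^ CARD('n)) * real n
              = (c * \<beta> * (2 * real n) powr s * (C * R a ^ CARD('n)) * (C * R b ^ CARD('n)) * real n) * D powr (- s)"
            by (simp add: P_def)
          also have "\<dots> \<le> R n powr s * D powr (- s)"
            using R[of a b] unfolding b(2) by (intro mult_right_mono) auto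
          also have "\<dots> = (R n / D) powr s"
            using D R1[of n] by (simp add: powr_divide powr_minus field_simps)
          finally show "P * (C * R a ^ CARD('n)) * (C * R b ^ CARD('n)) \<le> (R n / D) powr s / real n"
            using n by (simp add: field_simps)
        qed
        finally show ?thesis by (simp add: b_def)
      qed
      have "total_weight (join ` join_index \<K> n \<delta> x y) \<le>
        (\<Sum>a<n. ennreal P * (\<integral>\<^sup>+u. total_weight (\<K> a x u) \<partial>count_space UNIV)
        * (\<integral>\<^sup>+v. total_weight (\<K> (n - 1 - a) v y) \<partial>count_space UNIV))"
        by (rule join_weight[OF \<K>(1) P])
      also have "\<dots> \<le> (\<Sum>a<n. ennreal ((R n / D) powr s / real n))"
        by (intro sum_mono bound) simp
      also have "\<dots> = ennreal (tail s (R n) (x - y))"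
        using n D by (simp add: tail_def D_def ennreal_of_nat_eq_real_of_nat flip: ennreal_mult)
      finally show ?thesis
        using join_skeletons[OF \<K>(1) less_imp_le[OF \<delta>(1)] \<delta>(2)[unfolded D_def]] by blast
    qed
  qed
qed

end

section \<open>Hierarchical clusters\<close>

text \<open>The radius \<open>R n\<close> is the scale that is reached by \<open>n\<close> steps, and \<open>n = m + 1\<close> steps are composed of \<open>m div 2\<close>
  steps, one long edge and \<open>(m + 1) div 2\<close> steps. By \<open>connect\<close> two clusters of the smaller scales are joined with
  high probability, by \<open>scales\<close> they are disjoint, and by \<open>sparse\<close> few pairs of points at the larger scale have
  clusters that may intersect.\<close>

locale lrp_hierarchy = lrp N s q \<beta> for N :: "real ^ 'n \<Rightarrow> real" and s q \<beta> +
  fixes R :: "nat \<Rightarrow> real" and \<eta> c vol r0 :: real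
  assumes R_pos: "0 < R n" and \<eta>: "0 < \<eta>" "\<eta> < 1" and c_pos: "0 < c" and r0_pos: "1 \<le> r0"
    and annulus_card: "1 \<le> \<eta> * r \<Longrightarrow> 2 * c * r ^ CARD('n) \<le> real (card (annulus \<eta> z r))"
    and ball_card: "1 \<le> r \<Longrightarrow> real (card (lattice_ball N z r)) \<le> vol * r ^ CARD('n)"
    and absent: "r0 \<le> len (x - y) \<Longrightarrow>
       1 - conn_prob q \<beta> x y \<le> exp (- (\<beta> / 2 * len (x - y) powr (- s)))"
    and start: "c * R 0 ^ CARD('n) \<le> 1"
    and scales: "8 * R (m div 2) \<le> \<eta> * R (Suc m)" "8 * R (Suc m div 2) \<le> \<eta> * R (Suc m)"
    and large: "2 * r0 \<le> \<eta> * R (Suc m)"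
    and connect: "ln (64 * real (m + 2)) \<le>
       \<beta> / 2 * (2 * R (Suc m)) powr (- s) * ((c * R (m div 2) ^ CARD('n)) * (c * R (Suc m div 2) ^ CARD('n)))"
    and sparse: "64 * (vol * max 1 (4 * R (Suc m div 2)) ^ CARD('n)) * (16 * real (m + 2))
       \<le> 2 * c * R (Suc m) ^ CARD('n)"
begin

text \<open>The restriction to an annulus keeps the end points of the long edge apart, so that the asymptotic lower bound for
  its probability applies and the clusters of \<open>z\<close> and \<open>x\<close> use different edges.\<close>

function cluster :: "nat \<Rightarrow> int ^ 'n \<Rightarrow> ((int ^ 'n) set \<Rightarrow> bool) \<Rightarrow> (int ^ 'n) set" where
  "cluster 0 z \<omega> = {z}"
| "cluster (Suc m) z \<omega> = {x \<in> annulus \<eta> z (R (Suc m)).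
     \<exists>u\<in>cluster (m div 2) z \<omega>. \<exists>v\<in>cluster (Suc m div 2) x \<omega>. \<omega> {u, v}}"
  by pat_completeness auto
termination by (relation "Wellfounded.measure (\<lambda>(n, z, \<omega>). n)") auto

lemma cluster_subset: "cluster n z \<omega> \<subseteq> lattice_ball N z (R n)"
  by (cases n) (use R_pos in \<open>auto simp: annulus_def lattice_ball_def\<close>)

lemma finite_cluster: "finite (cluster n z \<omega>)"
  using cluster_subset finite_ball by (rule finite_subset)

text \<open>Points of the two sub-clusters lie at a distance comparable to the scale itself.\<close>

lemma separation:
  assumes x: "x \<in> annulus \<eta> z (R (Suc m))"
    and u: "len (z - u) < 2 * R (m div 2)" and v: "len (x - v) < 2 * R (Suc m div 2)"
  shows "\<eta> * R (Suc m) / 2 \<le> len (u - v)" "len (u - v) \<le> 2 * R (Suc m)"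
    "u \<noteq> v"
proof -
  let ?d = "\<lambda>x y. len (x - y)"
  have zx: "\<eta> * R (Suc m) \<le> ?d z x" "?d z x < R (Suc m)" using x by (auto simp: annulus_def lattice_ball_def)
  have t: "?d z x \<le> ?d z u + ?d u v + ?d x v" "?d u v \<le> ?d z u + ?d z x + ?d x v"
  proof -
    have "?d z x \<le> ?d z u + ?d u x" "?d u x \<le> ?d u v + ?d v x" "?d u v \<le> ?d u z + ?d z v" "?d z v \<le> ?d z x + ?d x v"
      using N_triangle_sub by auto
    moreover have "?d v x = ?d x v" "?d u z = ?d z u" using N_minus_commute by auto
    ultimately show "?d z x \<le> ?d z u + ?d u v + ?d x v" "?d u v \<le> ?d z u + ?d z x + ?d x v" by linarith+
  qed
  have "\<eta> * R (Suc m) \<le> 1 * R (Suc m)" using \<eta> R_pos[of "Suc m"] by (intro mult_right_mono) auto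
  then show "\<eta> * R (Suc m) / 2 \<le> ?d u v" "?d u v \<le> 2 * R (Suc m)"
    using zx t u v scales[of m] by linarith+
  then show "u \<noteq> v" using large[of m] r0_pos by auto
qed

lemma cluster_mem:
  "u \<in> cluster n z \<omega> \<Longrightarrow> len (z - u) < R n"
  using cluster_subset[of n z \<omega>] by (auto simp: lattice_ball_def)

lemma cluster_mem2:
  "u \<in> cluster n z \<omega> \<Longrightarrow> len (z - u) < 2 * R n"
  using cluster_mem[of u n z \<omega>] R_pos[of n] by linarith

lemma cluster_walk: "x \<in> cluster n z \<omega> \<Longrightarrow> (z, x) \<in> adj_rel \<omega> ^^ n"
proof (induction n arbitrary: z x rule: less_induct)
  case (less n)
  show ?case
  proof (cases n)
    case 0
    then show ?thesis using less.prems by simp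
  next
    case (Suc m)
    then obtain u v where x: "x \<in> annulus \<eta> z (R (Suc m))" and u: "u \<in> cluster (m div 2) z \<omega>"
        and v: "v \<in> cluster (Suc m div 2) x \<omega>" and uv: "\<omega> {u, v}"
      using less.prems by auto
    have "(u, v) \<in> adj_rel \<omega>"
      using separation(3)[OF x cluster_mem2[OF u] cluster_mem2[OF v]] uv by (simp add: lrp_adj_def)
    moreover have "(z, u) \<in> adj_rel \<omega> ^^ (m div 2)" using u by (intro less.IH) (auto simp: Suc)
    ultimately have zv: "(z, v) \<in> adj_rel \<omega> ^^ Suc (m div 2)" by (intro relpow_Suc_I)
    have "(x, v) \<in> adj_rel \<omega> ^^ (Suc m div 2)" using v by (intro less.IH) (auto simp: Suc)
    from relpow_trans[OF zv walk_commute[OF this]]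
    have "(z, x) \<in> adj_rel \<omega> ^^ (Suc (m div 2) + Suc m div 2)" .
    moreover have "Suc (m div 2) + Suc m div 2 = n" using Suc by presburger
    ultimately show ?thesis by (simp only:)
  qed
qed

definition region :: "int ^ 'n \<Rightarrow> real \<Rightarrow> (int ^ 'n) set set" where
  "region z r = {e \<in> lrp_edges. e \<subseteq> lattice_ball N z r}"

lemma finite_region: "finite (region z r)"
  by (rule finite_subset[of _ "Pow (lattice_ball N z r)"]) (auto simp: region_def finite_ball)

lemma region_lrp: "region z r \<subseteq> lrp_edges"
  by (auto simp: region_def)

lemma region_mono:
  assumes "len (z - x) + r \<le> r'" shows "region x r \<subseteq> region z r'"
proof -
  have "lattice_ball N x r \<subseteq> lattice_ball N z r'"
  proof
    fix y assume "y \<in> lattice_ball N x r"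
    then have "len (x - y) < r" by (simp add: lattice_ball_def)
    moreover have "len (z - y) \<le> len (z - x) + len (x - y)"
      using N_triangle_sub by simp
    ultimately show "y \<in> lattice_ball N z r'" using assms by (simp add: lattice_ball_def)
  qed
  then show ?thesis by (auto simp: region_def)
qed

lemma region_disjoint:
  assumes "r + r' \<le> len (z - x)" shows "region z r \<inter> region x r' = {}"
proof (rule ccontr)
  assume "region z r \<inter> region x r' \<noteq> {}"
  then obtain e where e: "e \<in> lrp_edges" "e \<subseteq> lattice_ball N z r" "e \<subseteq> lattice_ball N x r'"
    by (auto simp: region_def)
  then obtain y where "y \<in> lattice_ball N z r" "y \<in> lattice_ball N x r'" by (auto simp: lrp_edges_def)
  then have "len (z - y) < r" "len (x - y) < r'" by (auto simp: lattice_ball_def)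
  moreover have "len (z - x) \<le> len (z - y) + len (x - y)"
    using N_triangle_sub[of "lattice_vec z" "lattice_vec x" "lattice_vec y"]
      N_minus_commute[of "lattice_vec y" "lattice_vec x"] by simp
  ultimately show False using assms by simp
qed

text \<open>All the edges that are inspected in the construction lie in a ball of twice the radius.\<close>

lemma cluster_cong:
  "(\<And>e. e \<in> region z (2 * R n) \<Longrightarrow> \<omega> e = \<omega>' e) \<Longrightarrow> cluster n z \<omega> = cluster n z \<omega>'"
proof (induction n arbitrary: z rule: less_induct)
  case (less n)
  show ?case
  proof (cases n)
    case (Suc m)
    have "\<eta> * R (Suc m) \<le> 1 * R (Suc m)" using \<eta> R_pos[of "Suc m"] by (intro mult_right_mono) auto
    then have small: "8 * R (m div 2) \<le> R (Suc m)" "8 * R (Suc m div 2) \<le> R (Suc m)"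
      using scales[of m] by linarith+
    have "region z (2 * R (m div 2)) \<subseteq> region z (2 * R n)"
      using small R_pos[of "m div 2"] by (intro region_mono) (simp add: Suc)
    then have 1: "cluster (m div 2) z \<omega> = cluster (m div 2) z \<omega>'"
      using less.prems by (intro less.IH) (auto simp: Suc)
    have 2: "cluster (Suc m div 2) x \<omega> = cluster (Suc m div 2) x \<omega>'" if x: "x \<in> annulus \<eta> z (R (Suc m))" for x
    proof -
      have "region x (2 * R (Suc m div 2)) \<subseteq> region z (2 * R n)"
        using small x R_pos[of "Suc m div 2"] by (intro region_mono) (simp add: Suc annulus_def lattice_ball_def)
      then show ?thesis using less.prems by (intro less.IH) (auto simp: Suc)
    qed
    have 3: "\<omega> {u, v} = \<omega>' {u, v}" if x: "x \<in> annulus \<eta> z (R (Suc m))" and u: "u \<in> cluster (m div 2) z \<omega>'"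
        and v: "v \<in> cluster (Suc m div 2) x \<omega>'" for x u v
    proof -
      have "u \<noteq> v" using separation(3)[OF x cluster_mem2[OF u] cluster_mem2[OF v]] .
      moreover have "u \<in> lattice_ball N z (2 * R n)"
        using cluster_mem[OF u] small R_pos[of "m div 2"] by (simp add: lattice_ball_def Suc)
      moreover have "v \<in> lattice_ball N z (2 * R n)"
        using cluster_mem[OF v] x small R_pos[of "Suc m div 2"]
          N_triangle_sub[of "lattice_vec z" "lattice_vec v" "lattice_vec x"]
        by (simp add: lattice_ball_def Suc annulus_def)
      ultimately show ?thesis using less.prems by (simp add: region_def)
    qed
    show ?thesis unfolding Suc cluster.simps 1
      by (intro Collect_cong conj_cong refl bex_cong 2 3)
  qed simp
qed

definition good :: "nat \<Rightarrow> int ^ 'n \<Rightarrow> ((int ^ 'n) set \<Rightarrow> bool) \<Rightarrow> bool" where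
  "good n z \<omega> \<longleftrightarrow> c * R n ^ CARD('n) \<le> real (card (cluster n z \<omega>))"

lemma cluster_depends: "depends_on (\<lambda>\<omega>. P (cluster n z \<omega>)) (region z (2 * R n))"
  unfolding depends_on_def using cluster_cong by metis

lemma good_depends: "depends_on (good n z) (region z (2 * R n))"
  unfolding good_def[abs_def] by (rule cluster_depends)

lemma good_sets: "{\<omega> \<in> space M. good n z \<omega>} \<in> sets M" "{\<omega> \<in> space M. \<not> good n z \<omega>} \<in> sets M"
  using dependent_event(1)[OF finite_region region_lrp good_depends]
    dependent_event(1)[OF finite_region region_lrp depends_on_not[OF good_depends]] by auto

lemma cluster_sets: "{\<omega> \<in> space M. x \<in> cluster n z \<omega>} \<in> sets M"
  by (rule dependent_event(1)[OF finite_region region_lrp cluster_depends])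

text \<open>The failures that are due to the long edge alone.\<close>

definition unconnected :: "nat \<Rightarrow> int ^ 'n \<Rightarrow> int ^ 'n \<Rightarrow> ((int ^ 'n) set \<Rightarrow> bool) \<Rightarrow> bool" where
  "unconnected m z x \<omega> \<longleftrightarrow>
     good (m div 2) z \<omega> \<and> good (Suc m div 2) x \<omega> \<and> x \<notin> cluster (Suc m) z \<omega>"

lemma unconnected_sets: "{\<omega> \<in> space M. unconnected m z x \<omega>} \<in> sets M"
  unfolding unconnected_def by (intro sets.sets_Collect_conj sets.sets_Collect_neg good_sets cluster_sets)

text \<open>There are \<open>card A * card B\<close> candidates for the long edge, each of which is present with probability at least of
  order \<open>\<beta> R (m + 1) powr (- s)\<close>; the assumption \<open>connect\<close> makes the expected number of long edges large enough.\<close>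

lemma prob_no_edge_between:
  assumes x: "x \<in> annulus \<eta> z (R (Suc m))"
    and A: "A \<subseteq> lattice_ball N z (R (m div 2))" "c * R (m div 2) ^ CARD('n) \<le> real (card A)"
    and B: "B \<subseteq> lattice_ball N x (R (Suc m div 2))" "c * R (Suc m div 2) ^ CARD('n) \<le> real (card B)"
  defines "E \<equiv> (\<lambda>(u, v). {u, v}) ` (A \<times> B)"
  shows "finite E" "E \<subseteq> lrp_edges"
    "E \<inter> (region z (2 * R (m div 2)) \<union> region x (2 * R (Suc m div 2))) = {}"
    "prob {\<omega> \<in> space M. \<forall>e\<in>E. \<not> \<omega> e} \<le> 1 / (64 * real (m + 2))"
proof -
  have fin: "finite A" "finite B" using A B finite_ball finite_subset by blast+
  then show finE: "finite E" by (simp add: E_def)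
  have mem: "len (z - u) < R (m div 2)" if "u \<in> A" for u using A(1) that by (auto simp: lattice_ball_def)
  have mem': "len (x - v) < R (Suc m div 2)" if "v \<in> B" for v using B(1) that by (auto simp: lattice_ball_def)
  have mem2: "len (z - u) < 2 * R (m div 2)" if "u \<in> A" for u using mem[OF that] R_pos[of "m div 2"] by linarith
  have mem2': "len (x - v) < 2 * R (Suc m div 2)" if "v \<in> B" for v using mem'[OF that] R_pos[of "Suc m div 2"] by linarith
  note sep = separation[OF x]
  show lrpE: "E \<subseteq> lrp_edges" using sep(3)[OF mem2 mem2'] by (auto simp: E_def)
  show "E \<inter> (region z (2 * R (m div 2)) \<union> region x (2 * R (Suc m div 2))) = {}"
  proof (rule ccontr)
    assume "E \<inter> (region z (2 * R (m div 2)) \<union> region x (2 * R (Suc m div 2))) \<noteq> {}"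
    then obtain u v where uv: "u \<in> A" "v \<in> B"
      "{u, v} \<in> region z (2 * R (m div 2)) \<or> {u, v} \<in> region x (2 * R (Suc m div 2))"
      by (auto simp: E_def)
    from uv(3) show False
    proof
      assume "{u, v} \<in> region z (2 * R (m div 2))"
      then have "len (z - v) < 2 * R (m div 2)" by (auto simp: region_def lattice_ball_def)
      from sep(3)[OF this mem2'[OF uv(2)]] show False by simp
    next
      assume "{u, v} \<in> region x (2 * R (Suc m div 2))"
      then have "len (x - u) < 2 * R (Suc m div 2)" by (auto simp: region_def lattice_ball_def)
      from sep(3)[OF mem2[OF uv(1)] this] show False by simp
    qed
  qed
  have inj: "inj_on (\<lambda>(u, v). {u, v}) (A \<times> B)"
  proof (rule inj_onI, clarify)
    fix u v u' v' assume "u \<in> A" "v \<in> B" "u' \<in> A" "v' \<in> B" "{u, v} = {u', v'}"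
    moreover have "u' \<noteq> v" "u \<noteq> v'" using sep(3)[OF mem2 mem2'] calculation by auto
    ultimately show "u = u' \<and> v = v'" by (auto simp: doubleton_eq_iff)
  qed
  define \<theta> where "\<theta> = \<beta> / 2 * (2 * R (Suc m)) powr (- s)"
  have \<theta>: "0 \<le> \<theta>" using \<beta>_pos by (simp add: \<theta>_def)
  have s0: "0 < s" using s_gt_d by (rule le_less_trans[rotated]) simp
  have "prob {\<omega> \<in> space M. \<forall>e\<in>E. \<not> \<omega> e} = (\<Prod>e\<in>E. 1 - p e)"
    by (rule prob_absent[OF finE lrpE])
  also have "\<dots> \<le> (\<Prod>e\<in>E. exp (- \<theta>))"
  proof (rule prod_mono)
    fix e assume e: "e \<in> E"
    then obtain u v where uv: "u \<in> A" "v \<in> B" "e = {u, v}" by (auto simp: E_def)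
    have d: "\<eta> * R (Suc m) / 2 \<le> len (u - v)" "len (u - v) \<le> 2 * R (Suc m)"
      using sep[OF mem2[OF uv(1)] mem2'[OF uv(2)]] by auto
    have d0: "r0 \<le> len (u - v)" using d(1) large[of m] by simp
    have "1 - p e \<le> exp (- (\<beta> / 2 * len (u - v) powr (- s)))"
      unfolding uv(3) edge_prob_eq by (rule absent[OF d0])
    also have "\<dots> \<le> exp (- \<theta>)"
    proof -
      have "(2 * R (Suc m)) powr (- s) \<le> len (u - v) powr (- s)"
        using d d0 r0_pos s0 by (intro powr_mono2') auto
      then have "\<theta> \<le> \<beta> / 2 * len (u - v) powr (- s)"
        unfolding \<theta>_def using \<beta>_pos by (intro mult_left_mono) auto
      then show ?thesis by simp
    qed
    finally show "0 \<le> 1 - p e \<and> 1 - p e \<le> exp (- \<theta>)" using p_bounds e lrpE by auto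
  qed
  also have "\<dots> = exp (- (\<theta> * (real (card A) * real (card B))))"
    using inj fin by (simp add: E_def card_image card_cartesian_product exp_of_nat_mult[symmetric] mult_ac)
  also have "\<dots> \<le> exp (- ln (64 * real (m + 2)))"
  proof -
    have "0 \<le> c * R k ^ CARD('n)" for k using c_pos R_pos[of k] by simp
    then have "\<theta> * ((c * R (m div 2) ^ CARD('n)) * (c * R (Suc m div 2) ^ CARD('n)))
        \<le> \<theta> * (real (card A) * real (card B))"
      using A(2) B(2) \<theta> by (intro mult_left_mono mult_mono) auto
    then show ?thesis using connect[of m] by (simp add: \<theta>_def)
  qed
  also have "\<dots> = 1 / (64 * real (m + 2))" by (simp add: exp_minus inverse_eq_divide)
  finally show "prob {\<omega> \<in> space M. \<forall>e\<in>E. \<not> \<omega> e} \<le> 1 / (64 * real (m + 2))" .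
qed

text \<open>Conditioning on the two small clusters does not affect the edges between them, as these lie in neither of the two
  regions; the condition is written as a finite sum over the possible values of the clusters.\<close>

lemma prob_unconnected:
  assumes x: "x \<in> annulus \<eta> z (R (Suc m))"
  shows "prob {\<omega> \<in> space M. unconnected m z x \<omega>}
    \<le> 1 / (64 * real (m + 2))"
proof -
  let ?a = "m div 2" and ?b = "Suc m div 2"
  define \<A> where "\<A> = {A. A \<subseteq> lattice_ball N z (R ?a) \<and> c * R ?a ^ CARD('n) \<le> real (card A)}"
  define \<B> where "\<B> = {B. B \<subseteq> lattice_ball N x (R ?b) \<and> c * R ?b ^ CARD('n) \<le> real (card B)}"
  let ?F = "region z (2 * R ?a) \<union> region x (2 * R ?b)"
  let ?P = "\<lambda>A B \<omega>. cluster ?a z \<omega> = A \<and> cluster ?b x \<omega> = B"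
  let ?E = "\<lambda>A B. (\<lambda>(u, v). {u, v}) ` (A \<times> B)"
  let ?S = "\<lambda>A B. {\<omega> \<in> space M. ?P A B \<omega>}"
  let ?T = "\<lambda>A B. {\<omega> \<in> space M. ?P A B \<omega> \<and> (\<forall>e\<in>?E A B. \<not> \<omega> e)}"
  have fin: "finite (\<A> \<times> \<B>)"
    unfolding \<A>_def \<B>_def using finite_ball by (intro finite_cartesian_product finite_Collect_conjI) auto
  have F: "finite ?F" "?F \<subseteq> lrp_edges" using finite_region region_lrp by auto
  have depP: "depends_on (?P A B) ?F" for A B
    using depends_on_mono[OF cluster_depends[of "\<lambda>C. C = A" ?a z], of ?F]
      depends_on_mono[OF cluster_depends[of "\<lambda>C. C = B" ?b x], of ?F]
    by (intro depends_on_conj) auto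
  have setsS: "?S A B \<in> sets M" for A B by (rule dependent_event(1)[OF F depP])
  have depE: "depends_on (\<lambda>\<omega>. \<forall>e\<in>E. \<not> \<omega> e) E" for E :: "(int ^ 'n) set set"
    by (auto simp: depends_on_def)
  have T: "?T A B \<in> sets M" "prob (?T A B) \<le> prob (?S A B) * (1 / (64 * real (m + 2)))"
    if "A \<in> \<A>" "B \<in> \<B>" for A B
  proof -
    note E = prob_no_edge_between[OF x, of A B]
    have E': "finite (?E A B)" "?E A B \<subseteq> lrp_edges" "?E A B \<inter> ?F = {}"
        "prob {\<omega> \<in> space M. \<forall>e\<in>?E A B. \<not> \<omega> e} \<le> 1 / (64 * real (m + 2))"
      using E that unfolding \<A>_def \<B>_def by blast+
    have "?S A B \<inter> {\<omega> \<in> space M. \<forall>e\<in>?E A B. \<not> \<omega> e} \<in> sets M"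
      by (intro sets.Int setsS dependent_event(1)[OF E'(1,2) depE])
    moreover have "?S A B \<inter> {\<omega> \<in> space M. \<forall>e\<in>?E A B. \<not> \<omega> e} = ?T A B" by blast
    ultimately show "?T A B \<in> sets M" by (simp only:)
    have "prob (?T A B) = prob (?S A B) * prob {\<omega> \<in> space M. \<forall>e\<in>?E A B. \<not> \<omega> e}"
      using E'(3) by (intro prob_independent[OF F depP E'(1,2) depE]) blast
    also have "\<dots> \<le> prob (?S A B) * (1 / (64 * real (m + 2)))"
      using E'(4) by (intro mult_left_mono) auto
    finally show "prob (?T A B) \<le> prob (?S A B) * (1 / (64 * real (m + 2)))" .
  qed
  let ?I = "\<A> \<times> \<B>"
  have T': "(\<lambda>AB. ?T (fst AB) (snd AB)) ` ?I \<subseteq> sets M" by (intro image_subsetI T(1)) auto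
  have "{\<omega> \<in> space M. unconnected m z x \<omega>}
      \<subseteq> (\<Union>AB\<in>?I. ?T (fst AB) (snd AB))"
  proof
    fix \<omega> assume w: "\<omega> \<in> {\<omega> \<in> space M. unconnected m z x \<omega>}"
    then have "(cluster ?a z \<omega>, cluster ?b x \<omega>) \<in> ?I"
      using cluster_subset by (auto simp: \<A>_def \<B>_def good_def unconnected_def)
    moreover have "\<omega> \<in> ?T (cluster ?a z \<omega>) (cluster ?b x \<omega>)"
      using w x by (auto simp: unconnected_def)
    ultimately show "\<omega> \<in> (\<Union>AB\<in>?I. ?T (fst AB) (snd AB))"
      by (intro UN_I[of "(cluster ?a z \<omega>, cluster ?b x \<omega>)"]) (simp_all only: fst_conv snd_conv)
  qed
  moreover have "(\<Union>AB\<in>?I. ?T (fst AB) (snd AB)) \<in> sets M" by (rule sets.finite_UN[OF fin]) (use T' in blast)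
  ultimately have "prob {\<omega> \<in> space M. unconnected m z x \<omega>}
      \<le> prob (\<Union>AB\<in>?I. ?T (fst AB) (snd AB))"
    by (rule finite_measure_mono)
  also have "\<dots> \<le> (\<Sum>AB\<in>?I. prob (?T (fst AB) (snd AB)))"
    by (rule finite_measure_subadditive_finite[OF fin T'])
  also have "\<dots> \<le> (\<Sum>AB\<in>?I. prob (?S (fst AB) (snd AB)) * (1 / (64 * real (m + 2))))"
    by (intro sum_mono T(2)) auto
  also have "\<dots> = (\<Sum>AB\<in>?I. prob (?S (fst AB) (snd AB))) * (1 / (64 * real (m + 2)))"
    by (rule sum_distrib_right[symmetric])
  also have "(\<Sum>AB\<in>?I. prob (?S (fst AB) (snd AB))) = prob (\<Union>AB\<in>?I. ?S (fst AB) (snd AB))"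
  proof (rule finite_measure_finite_Union[symmetric, OF fin])
    show "(\<lambda>AB. ?S (fst AB) (snd AB)) ` ?I \<subseteq> sets M" by (intro image_subsetI setsS)
    show "disjoint_family_on (\<lambda>AB. ?S (fst AB) (snd AB)) ?I"
      by (auto simp: disjoint_family_on_def prod_eq_iff)
  qed
  also have "prob (\<Union>AB\<in>?I. ?S (fst AB) (snd AB)) * (1 / (64 * real (m + 2))) \<le> 1 * (1 / (64 * real (m + 2)))"
    by (intro mult_right_mono) auto
  finally show ?thesis by simp
qed

text \<open>Chebyshev's inequality makes the failures around the far ends negligible, so that along the recursion
  only the failure probability at \<open>z\<close> itself is inherited, with coefficient one.\<close>

proposition prob_not_good: "prob {\<omega> \<in> space M. \<not> good n z \<omega>} \<le> 1 / 8 * (1 - 1 / real (n + 1))"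
proof (induction n arbitrary: z rule: less_induct)
  case (less n)
  show ?case
  proof (cases n)
    case 0
    then show ?thesis using start by (simp add: good_def)
  next
    case (Suc m)
    let ?a = "m div 2" and ?b = "Suc m div 2"
    let ?A = "annulus \<eta> z (R (Suc m))"
    let ?near = "\<lambda>x y. len (x - y) < 4 * R ?b"
    define K where "K = vol * max 1 (4 * R ?b) ^ CARD('n)"
    have le1: "1 \<le> \<eta> * R (Suc m)" using large[of m] r0_pos by linarith
    have cardA: "2 * c * R (Suc m) ^ CARD('n) \<le> real (card ?A)" by (rule annulus_card[OF le1])
    have cpos: "0 < 2 * c * R (Suc m) ^ CARD('n)" using c_pos R_pos by simp
    then have A: "finite ?A" "?A \<noteq> {}" "0 < real (card ?A)" using cardA finite_annulus by auto
    have p8: "prob {\<omega> \<in> space M. \<not> good ?b x \<omega>} \<le> 1 / 8" for x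
    proof -
      have "prob {\<omega> \<in> space M. \<not> good ?b x \<omega>} \<le> 1 / 8 * (1 - 1 / real (?b + 1))"
        by (rule less.IH) (simp add: Suc)
      also have "\<dots> \<le> 1 / 8" by simp
      finally show ?thesis .
    qed
    have bad1: "prob {\<omega> \<in> space M. real (card ?A) / 4 \<le> real (card {x\<in>?A. \<not> good ?b x \<omega>})} \<le> 64 * K / real (card ?A)"
    proof (rule prob_many_events_chebyshev[where near = ?near])
      fix x assume x: "x \<in> ?A"
      have "card {y\<in>?A. ?near x y} \<le> card (lattice_ball N x (max 1 (4 * R ?b)))"
        by (intro card_mono finite_ball) (auto simp: lattice_ball_def)
      then show "real (card {y\<in>?A. ?near x y}) \<le> K"
        unfolding K_def using ball_card[of "max 1 (4 * R ?b)" x] by linarith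
      fix y assume "\<not> ?near x y"
      then have "region x (2 * R ?b) \<inter> region y (2 * R ?b) = {}" by (intro region_disjoint) simp
      then show "prob {\<omega> \<in> space M. \<not> good ?b x \<omega> \<and> \<not> good ?b y \<omega>}
          = prob {\<omega> \<in> space M. \<not> good ?b x \<omega>} * prob {\<omega> \<in> space M. \<not> good ?b y \<omega>}"
        by (intro prob_independent[of "region x (2 * R ?b)" _ "region y (2 * R ?b)"]
            finite_region region_lrp depends_on_not good_depends)
    qed (use A p8 good_sets in auto)
    have bad2: "prob {\<omega> \<in> space M. real (card ?A) / 4 \<le>
        real (card {x\<in>?A. unconnected m z x \<omega>})} \<le> 4 * (1 / (64 * real (m + 2)))"
    proof (rule prob_many_events_markov)
      fix x assume "x \<in> ?A"
      then show "prob {\<omega> \<in> space M. unconnected m z x \<omega>} \<le> 1 / (64 * real (m + 2))"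
        by (rule prob_unconnected)
      show "{\<omega> \<in> space M. unconnected m z x \<omega>} \<in> sets M" by (rule unconnected_sets)
    qed (use A in auto)
    let ?X = "{\<omega> \<in> space M. \<not> good ?a z \<omega>}"
    let ?Y = "{\<omega> \<in> space M. real (card ?A) / 4 \<le> real (card {x\<in>?A. \<not> good ?b x \<omega>})}"
    let ?Z = "{\<omega> \<in> space M. real (card ?A) / 4 \<le>
        real (card {x\<in>?A. unconnected m z x \<omega>})}"
    have Y: "?Y \<in> sets M" and Z: "?Z \<in> sets M"
      by (rule sets_Collect_subset_of_points[OF A(1)], intro good_sets unconnected_sets)+
    have sub: "{\<omega> \<in> space M. \<not> good n z \<omega>} \<subseteq> ?X \<union> ?Y \<union> ?Z"
    proof (rule subsetI, rule ccontr)
      fix \<omega> assume w: "\<omega> \<in> {\<omega> \<in> space M. \<not> good n z \<omega>}" and "\<omega> \<notin> ?X \<union> ?Y \<union> ?Z"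
      then have ga: "good ?a z \<omega>" and
        b1: "real (card {x\<in>?A. \<not> good ?b x \<omega>}) < real (card ?A) / 4" and
        b2: "real (card {x\<in>?A. unconnected m z x \<omega>}) < real (card ?A) / 4"
        by auto
      have "?A \<subseteq> cluster (Suc m) z \<omega> \<union> {x\<in>?A. \<not> good ?b x \<omega>}
          \<union> {x\<in>?A. unconnected m z x \<omega>}" using ga by (auto simp: unconnected_def)
      then have "card ?A \<le> card (cluster (Suc m) z \<omega> \<union> {x\<in>?A. \<not> good ?b x \<omega>}
          \<union> {x\<in>?A. unconnected m z x \<omega>})"
        using A(1) finite_cluster by (intro card_mono) auto
      also have "\<dots> \<le> card (cluster (Suc m) z \<omega>) + card {x\<in>?A. \<not> good ?b x \<omega>}
          + card {x\<in>?A. unconnected m z x \<omega>}"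
        by (intro order_trans[OF card_Un_le] add_mono card_Un_le order_refl)
      finally have "real (card ?A) / 2 \<le> real (card (cluster (Suc m) z \<omega>))" using b1 b2 by linarith
      then have "good n z \<omega>" using cardA unfolding good_def Suc by linarith
      then show False using w by simp
    qed
    have "prob {\<omega> \<in> space M. \<not> good n z \<omega>} \<le> prob (?X \<union> ?Y \<union> ?Z)"
      using good_sets Y Z by (intro finite_measure_mono[OF sub]) auto
    also have "\<dots> \<le> prob ?X + prob ?Y + prob ?Z"
    proof -
      have "prob (?X \<union> ?Y \<union> ?Z) \<le> prob (?X \<union> ?Y) + prob ?Z"
        using good_sets Y Z by (intro measure_Un_le) auto
      moreover have "prob (?X \<union> ?Y) \<le> prob ?X + prob ?Y"
        using good_sets Y by (intro measure_Un_le) auto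
      ultimately show ?thesis by linarith
    qed
    also have "\<dots> \<le> (1 / 8 - 1 / (4 * real (m + 2))) + 1 / (16 * real (m + 2)) + 1 / (16 * real (m + 2))"
    proof (intro add_mono)
      have "prob ?X \<le> 1 / 8 * (1 - 1 / real (?a + 1))" by (rule less.IH) (simp add: Suc)
      moreover have "2 / real (m + 2) \<le> 1 / real (?a + 1)"
      proof -
        have "2 * (?a + 1) \<le> m + 2" by simp
        then have "2 * real (?a + 1) \<le> real (m + 2)" by linarith
        then show ?thesis by (simp add: field_simps)
      qed
      moreover have "P \<le> 1 / 8 - 1 / (4 * x)" if "P \<le> 1 / 8 * (1 - 1 / a)" "2 / x \<le> 1 / a" for P a x :: real
      proof -
        define u v where "u = 1 / a" and "v = 1 / x"
        have "P \<le> 1 / 8 * (1 - u)" "2 * v \<le> u" using that by (simp_all add: u_def v_def)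
        then have "P \<le> 1 / 8 - v / 4" by (simp add: field_simps)
        then show ?thesis by (simp add: v_def)
      qed
      ultimately show "prob ?X \<le> 1 / 8 - 1 / (4 * real (m + 2))" by blast
      have "64 * K * (16 * real (m + 2)) \<le> real (card ?A)"
        using order_trans[OF sparse[of m] cardA] unfolding K_def .
      then have "64 * K / real (card ?A) \<le> 1 / (16 * real (m + 2))"
        using A(3) by (simp add: field_simps)
      then show "prob ?Y \<le> 1 / (16 * real (m + 2))" using bad1 by linarith
      have "4 * (1 / (64 * x)) = 1 / (16 * x)" for x :: real by simp
      with bad2 show "prob ?Z \<le> 1 / (16 * real (m + 2))" by (simp only:)
    qed
    also have "\<dots> = 1 / 8 * (1 - 1 / real (n + 1))" 
    proof -
      have "(1 / 8 - 1 / (4 * x)) + 1 / (16 * x) + 1 / (16 * x) = 1 / 8 * (1 - 1 / x)" if "x \<noteq> 0" for x :: real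
        using that by (simp add: field_simps)
      from this[of "real (m + 2)"] show ?thesis by (simp add: Suc)
    qed
    finally show ?thesis .
  qed
qed

corollary prob_many_close_points:
  "7 / 8 \<le> prob {\<omega> \<in> space M.
     c * R n ^ CARD('n) \<le> real (card {x \<in> lattice_ball N 0 (R n). chem_dist \<omega> 0 x \<le> enat n})}"
proof -
  have "7 / 8 \<le> 1 - prob {\<omega> \<in> space M. \<not> good n 0 \<omega>}"
  proof -
    have "1 / 8 * (1 - 1 / real (n + 1)) \<le> 1 / 8" by simp
    then show ?thesis using prob_not_good[of n 0] by linarith
  qed
  also have "\<dots> = prob (space M - {\<omega> \<in> space M. \<not> good n 0 \<omega>})"
    by (rule prob_compl[symmetric]) (rule good_sets)
  also have "\<dots> \<le> prob {\<omega> \<in> space M.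
     c * R n ^ CARD('n) \<le> real (card {x \<in> lattice_ball N 0 (R n). chem_dist \<omega> 0 x \<le> enat n})}"
  proof (intro finite_measure_mono subsetI)
    fix \<omega> assume w: "\<omega> \<in> space M - {\<omega> \<in> space M. \<not> good n 0 \<omega>}"
    have "card (cluster n 0 \<omega>) \<le> card {x \<in> lattice_ball N 0 (R n). chem_dist \<omega> 0 x \<le> enat n}"
      using cluster_subset[of n 0 \<omega>] walk_chem_dist[OF cluster_walk[of _ n 0 \<omega>]]
      by (intro card_mono) (auto simp: finite_ball)
    then show "\<omega> \<in> {\<omega> \<in> space M.
       c * R n ^ CARD('n) \<le> real (card {x \<in> lattice_ball N 0 (R n). chem_dist \<omega> 0 x \<le> enat n})}"
      using w by (auto simp: good_def)
  qed (intro point_set_measurable finite_ball)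
  finally show ?thesis .
qed

end

section \<open>Radii\<close>

locale lrp_model = lrp_kernel N s q for N :: "real ^ 'n \<Rightarrow> real" and s q +
  assumes s_less: "s < 2 * real CARD('n)"
begin

sublocale lrp_exponents "real CARD('n)" s
  using s_gt_d s_less by unfold_locales auto

lemma lrp_at: "0 < \<beta> \<Longrightarrow> lrp N s q \<beta>"
  by unfold_locales

lemma exp_power_card: "exp x ^ CARD('n) = exp (real CARD('n) * x)"
  by (simp add: exp_of_nat_mult)

text \<open>The profile is at least its value \<open>1 / (2 d - s)\<close> at 1.\<close>

lemma rad_nonneg:
  assumes "0 \<le> lam" "1 \<le> t" shows "0 \<le> rad lam t"
proof -
  have "1 / (2 * real CARD('n) - s) \<le> growth ^ level t / (2 * real CARD('n) - s)"
    using growth_bounds s_less by (intro divide_right_mono one_le_power) auto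
  also have "\<dots> \<le> profile t" by (rule profile_ge_growth[OF assms(2)])
  finally show ?thesis using assms(1) by (simp add: rad_def)
qed

text \<open>The radii for which few and many points, respectively, are reached by \<open>n\<close> steps.\<close>

definition outer_radius :: "real \<Rightarrow> real \<Rightarrow> real \<Rightarrow> real \<Rightarrow> nat \<Rightarrow> real" where
  "outer_radius A B C \<beta> n = exp (rad (ln \<beta>) (real (n + 1)) + corr A B C (real (n + 1)))"

definition inner_radius :: "real \<Rightarrow> real \<Rightarrow> real \<Rightarrow> real \<Rightarrow> nat \<Rightarrow> real" where
  "inner_radius A B C \<beta> n = exp (rad (ln \<beta>) (real (n + 1)) - corr A B C (real (n + 1)))"

text \<open>The constants of \<open>skeletons_exist\<close> and the factors \<open>n\<close> from the choice and the length of the long edge contribute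
  \<open>(s + 1) ln n\<close> and a constant to the recursion of the logarithmic radii.\<close>

proposition few_close_points:
  obtains A B C where "0 \<le> A"
    "\<And>\<beta> n r \<eta>. 1 \<le> \<beta> \<Longrightarrow> 0 < \<eta> \<Longrightarrow> annulus \<eta> 0 r \<noteq> {} \<Longrightarrow>
       outer_radius A B C \<beta> n < \<eta> * r \<Longrightarrow>
       measure (lrp_measure q \<beta>) {\<omega> \<in> space (lrp_measure q \<beta>).
         real (card (annulus \<eta> 0 r)) / 4 \<le> real (card {x \<in> annulus \<eta> 0 r. chem_dist \<omega> 0 x \<le> enat n})}
       \<le> 4 * (outer_radius A B C \<beta> n / (\<eta> * r)) powr s"
proof -
  obtain c where c: "1 \<le> c" "\<And>\<beta> x y. 1 \<le> \<beta> \<Longrightarrow> x \<noteq> y \<Longrightarrow>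
       conn_prob q \<beta> x y \<le> c * \<beta> * len (x - y) powr (- s)"
    using conn_prob_upper by blast
  obtain T where T: "0 < T" "\<And>R. 1 \<le> R \<Longrightarrow>
    (\<integral>\<^sup>+x. ennreal (tail s R x) \<partial>count_space UNIV) \<le> ennreal (T * R ^ CARD('n))"
    using tail_sum_bound[OF s_gt_d] by blast
  define E' where "E' = \<bar>ln c + s * ln 2 + 2 * ln T\<bar>"
  obtain A B C where abc: "0 \<le> A" "0 \<le> B" "0 \<le> C"
    "\<And>a b. 1 \<le> a \<Longrightarrow> 1 \<le> b \<Longrightarrow>
       real CARD('n) * (corr A B C a + corr A B C b) + (s + 1) * ln (a + b) + E' \<le> s * corr A B C (a + b)"
    "\<And>t. 1 \<le> t \<Longrightarrow> 0 \<le> corr A B C t"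
    using corr_absorbs[of "s + 1" E'] s_pos by (auto simp: E'_def)
  show thesis
  proof (rule that[OF abc(1)])
    fix \<beta> \<eta> r :: real and n :: nat
    assume \<beta>: "1 \<le> \<beta>" and \<eta>: "0 < \<eta>" and ne: "annulus \<eta> 0 r \<noteq> {}"
    define L where "L t = rad (ln \<beta>) t + corr A B C t" for t
    assume "outer_radius A B C \<beta> n < \<eta> * r"
    then have small: "exp (L (real (n + 1))) < \<eta> * r" by (simp add: L_def outer_radius_def)
    interpret lrp N s q \<beta> using \<beta> by (intro lrp_at) simp
    define R where "R k = exp (L (real (k + 1)))" for k
    have lam: "0 \<le> ln \<beta>" using \<beta> by simp
    have L0: "0 \<le> L t" if "1 \<le> t" for t
      unfolding L_def using rad_nonneg[OF lam that] abc(5)[OF that] by simp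
    have skel: "\<exists>\<K>. skeletons \<K> n x y \<and> total_weight \<K> \<le> ennreal (tail s (R n) (x - y))" for n x y
    proof (rule skeletons_exist[OF \<beta> _ c(2)[OF \<beta>] T])
      show "0 < c" using c(1) by simp
      show "1 \<le> R k" for k unfolding R_def using L0[of "real (k + 1)"] by simp
      fix a b :: nat
      let ?a = "real (a + 1)" and ?b = "real (b + 1)" and ?n = "real (a + b + 1)"
      have n: "0 < ?n" by simp
      have split: "real CARD('n) * (L ?a + L ?b) + ln \<beta> + (s + 1) * ln (?a + ?b) + E' \<le> s * L (?a + ?b)"
        using rad_split_le[OF lam, of ?a ?b] abc(4)[of ?a ?b] by (simp add: L_def algebra_simps)
      have "ln ?n \<le> ln (?a + ?b)" by simp
      then have lnn: "(s + 1) * ln ?n \<le> (s + 1) * ln (?a + ?b)" using s_pos by (intro mult_left_mono) auto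
      have "c * \<beta> * (2 * ?n) powr s * (T * R a ^ CARD('n)) * (T * R b ^ CARD('n)) * ?n
          = exp (ln c + ln \<beta> + s * (ln 2 + ln ?n) + (ln T + real CARD('n) * L ?a) + (ln T + real CARD('n) * L ?b) + ln ?n)"
      proof -
        have "(2 * x) powr s = exp (s * (ln 2 + ln x))" if "0 < x" for x
          using that by (simp add: powr_def ln_mult)
        note pw = this[OF n]
        show ?thesis
          unfolding exp_add R_def exp_power_card pw using c(1) \<beta> T(1) n by simp
      qed
      also have "\<dots> \<le> exp (s * L (?a + ?b))"
        using split lnn unfolding E'_def by (simp add: algebra_simps abs_le_iff)
      also have "\<dots> = R (a + b + 1) powr s"
        by (simp add: R_def powr_def algebra_simps)
      finally show "c * \<beta> * (2 * ?n) powr s * (T * R a ^ CARD('n)) * (T * R b ^ CARD('n)) * ?n \<le> R (a + b + 1) powr s" .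
    qed
    have Rr: "R n < \<eta> * r" using small by (simp add: R_def)
    have "0 < R n" by (simp add: R_def)
    then have \<eta>r: "0 < \<eta> * r" using Rr by linarith
    have "prob {\<omega> \<in> space M. real (card (annulus \<eta> 0 r)) / 4
        \<le> real (card {x \<in> annulus \<eta> 0 r. chem_dist \<omega> 0 x \<le> enat n})} \<le> 4 * (R n / (\<eta> * r)) powr s"
    proof (rule prob_many_events_markov[OF finite_annulus ne])
      show "{\<omega> \<in> space M. chem_dist \<omega> 0 x \<le> enat n} \<in> sets M" for x by (rule chem_dist_le_sets)
      fix x assume x: "x \<in> annulus \<eta> 0 r"
      then have d: "\<eta> * r \<le> len (0 - x)" by (simp add: annulus_def)
      obtain \<K> where \<K>: "skeletons \<K> n 0 x" "total_weight \<K> \<le> ennreal (tail s (R n) (0 - x))" using skel by blast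
      have "ennreal (prob {\<omega> \<in> space M. chem_dist \<omega> 0 x \<le> enat n}) \<le> ennreal (tail s (R n) (0 - x))"
        using prob_skeletons[OF \<K>(1)] \<K>(2) by (simp add: emeasure_eq_measure[symmetric])
      then have "prob {\<omega> \<in> space M. chem_dist \<omega> 0 x \<le> enat n} \<le> tail s (R n) (0 - x)"
        using tail_nonneg by (simp add: ennreal_le_iff)
      also have "\<dots> = (R n / len (0 - x)) powr s"
        using d Rr by (auto simp: tail_def)
      also have "\<dots> \<le> (R n / (\<eta> * r)) powr s"
        using d \<eta>r \<open>0 < R n\<close> s_pos by (intro powr_mono2 divide_left_mono) auto
      finally show "prob {\<omega> \<in> space M. chem_dist \<omega> 0 x \<le> enat n} \<le> (R n / (\<eta> * r)) powr s" .
    qed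
    then show "measure (lrp_measure q \<beta>) {\<omega> \<in> space (lrp_measure q \<beta>).
         real (card (annulus \<eta> 0 r)) / 4 \<le> real (card {x \<in> annulus \<eta> 0 r. chem_dist \<omega> 0 x \<le> enat n})}
       \<le> 4 * (outer_radius A B C \<beta> n / (\<eta> * r)) powr s"
      by (simp add: R_def L_def outer_radius_def)
  qed
qed

text \<open>For large \<open>\<beta>\<close> the correction is a small perturbation even of the increments of the radii.\<close>

lemma corrected_increment:
  assumes B: "0 \<le> B" "0 \<le> C" and corr0: "\<And>t. 1 \<le> t \<Longrightarrow> 0 \<le> corr A B C t"
    and lam: "4 * growth * s * (\<kappa> + A) \<le> lam" and \<kappa>: "0 \<le> \<kappa> + A"
    and t: "1 \<le> t'" "t' \<le> 3 / 4 * t"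
  shows "\<kappa> * t powr vol_exp \<le> (rad lam t - corr A B C t) - (rad lam t' - corr A B C t')"
proof -
  have g: "0 < 4 * growth * s" using growth_bounds s_pos by simp
  have t1: "1 \<le> t" using t by simp
  have "0 \<le> 4 * growth * s * (\<kappa> + A)" using g \<kappa> by simp
  then have lam0: "0 \<le> lam" using lam by linarith
  have "(\<kappa> + A) * t powr vol_exp = 4 * growth * s * (\<kappa> + A) * (t powr vol_exp / (4 * growth * s))"
    using growth_bounds s_pos by simp
  also have "\<dots> \<le> lam * (t powr vol_exp / (4 * growth * s))"
    using lam g by (intro mult_right_mono) auto
  also have "\<dots> \<le> lam * (profile t - profile t')"
    using lam0 profile_increment[OF t] by (intro mult_left_mono)
  also have "\<dots> = rad lam t - rad lam t'" by (simp add: rad_def algebra_simps)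
  finally show ?thesis using corr_le[OF B t1, of A] corr0[OF t(1)] by (simp add: algebra_simps)
qed

text \<open>The conditions \<open>scales\<close>, \<open>large\<close> and \<open>sparse\<close> of \<open>lrp_hierarchy\<close> say that consecutive scales are far apart, and
  follow from an increment of at least \<open>\<kappa> t powr vol_exp\<close> of the logarithmic radii.\<close>

proposition many_close_points:
  obtains A B C c lam0 where "0 \<le> A" "0 < c"
    "\<And>\<beta> n. 1 \<le> \<beta> \<Longrightarrow> lam0 \<le> ln \<beta> \<Longrightarrow>
       7 / 8 \<le> measure (lrp_measure q \<beta>) {\<omega> \<in> space (lrp_measure q \<beta>).
         c * inner_radius A B C \<beta> n ^ CARD('n) \<le>
         real (card {x \<in> lattice_ball N 0 (inner_radius A B C \<beta> n).
           chem_dist \<omega> 0 x \<le> enat n})}"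
proof -
  let ?d = "real CARD('n)"
  obtain r0 where r0: "1 \<le> r0"
    "\<And>\<beta> x y. 0 \<le> \<beta> \<Longrightarrow> r0 \<le> len (x - y) \<Longrightarrow>
       1 - conn_prob q \<beta> x y \<le> exp (- (\<beta> / 2 * len (x - y) powr (- s)))"
    using conn_prob_lower by blast
  obtain \<eta> c' where \<eta>: "0 < \<eta>" "\<eta> < 1" and c': "0 < c'"
    "\<And>z r. 1 \<le> \<eta> * r \<Longrightarrow> c' * r ^ CARD('n) \<le> real (card (annulus \<eta> z r))"
    using card_annulus_lower by blast
  obtain vol where vol: "0 < vol"
    "\<And>z r. 1 \<le> r \<Longrightarrow> real (card (lattice_ball N z r)) \<le> vol * r ^ CARD('n)"
    using card_lattice_ball_upper by blast
  define c where "c = min 1 (c' / 2)"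
  have c: "0 < c" "c \<le> 1" "2 * c \<le> c'" using c'(1) by (auto simp: c_def)
  \<comment> \<open>The constants in \<open>connect\<close>, where \<open>ln x\<close> on the left is estimated by \<open>x\<close>.\<close>
  define E' where "E' = ln 64 + ln 2 + s * ln 2 - 2 * ln c"
  have E'0: "0 \<le> E'" 
  proof -
    have "ln c \<le> 0" using c by simp
    moreover have "0 \<le> s * ln 2" using s_pos by simp
    moreover have "0 \<le> ln (64::real)" "0 \<le> ln (2::real)" by simp_all
    ultimately show ?thesis unfolding E'_def by linarith
  qed
  obtain A B C where abc: "0 \<le> A" "0 \<le> B" "0 \<le> C"
    "\<And>a b. 1 \<le> a \<Longrightarrow> 1 \<le> b \<Longrightarrow>
       ?d * (corr A B C a + corr A B C b) + 1 * ln (a + b) + E' \<le> s * corr A B C (a + b)"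
    "\<And>t. 1 \<le> t \<Longrightarrow> 0 \<le> corr A B C t"
    using corr_absorbs[of 1 E'] E'0 by auto
  \<comment> \<open>By the choice of \<open>Q\<close> the condition \<open>sparse\<close> follows from \<open>Q t w ^ d \<le> 1\<close> with \<open>w = exp (- \<kappa> t powr vol_exp)\<close>.\<close>
  define Q where "Q = 512 * vol * 4 ^ CARD('n) * exp (A * ?d) / c"
  have Q: "0 < Q" using vol(1) c(1) by (simp add: Q_def)
  \<comment> \<open>The three summands serve \<open>scales\<close>, \<open>large\<close> and \<open>sparse\<close>.\<close>
  define \<kappa> where "\<kappa> = \<bar>ln 8 - ln \<eta>\<bar> + (A + \<bar>ln (2 * r0 / \<eta>)\<bar>) + (\<bar>ln Q\<bar> + 1 / vol_exp) / ?d"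
  have k3: "0 \<le> (\<bar>ln Q\<bar> + 1 / vol_exp) / ?d" using vol_exp_bounds by simp
  have \<kappa>: "0 \<le> \<kappa>" "ln 8 - ln \<eta> \<le> \<kappa>" "ln (2 * r0 / \<eta>) + A \<le> \<kappa>" "(\<bar>ln Q\<bar> + 1 / vol_exp) / ?d \<le> \<kappa>"
    unfolding \<kappa>_def using k3 abc(1) by linarith+
  define lam0 where "lam0 = 4 * growth * s * (\<kappa> + A)"
  show thesis
  proof (rule that[OF abc(1) c(1)])
    fix \<beta> :: real and n :: nat
    assume \<beta>: "1 \<le> \<beta>" and lam: "lam0 \<le> ln \<beta>"
    define L where "L t = rad (ln \<beta>) t - corr A B C t" for t
    define R where "R k = exp (L (real (k + 1)))" for k
    have inc: "\<kappa> * t powr vol_exp \<le> L t - L t'" if "1 \<le> t'" "t' \<le> 3 / 4 * t" for t t'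
      unfolding L_def using that \<kappa>(1) abc lam
      by (intro corrected_increment) (auto simp: lam0_def)
    have p1: "1 \<le> t powr vol_exp" if "1 \<le> t" for t
      using that vol_exp_bounds by (intro ge_one_powr_ge_zero) auto
    have inc1: "\<kappa> \<le> L t - L t'" if "1 \<le> t'" "t' \<le> 3 / 4 * t" for t t'
      using inc[OF that] mult_left_mono[OF p1[of t] \<kappa>(1)] that by simp
    have L1: "- A \<le> L 1" using abc(2,3) by (simp add: L_def rad_one corr_def)
    have shift: "real (m div 2 + 1) = real ((m + 2) div 2)" "real (Suc m div 2 + 1) = real (m + 2 - (m + 2) div 2)"
      "real (Suc m + 1) = real (m + 2)" for m
    proof -
      have "m div 2 + 1 = (m + 2) div 2" "Suc m div 2 + 1 = m + 2 - (m + 2) div 2" "Suc m + 1 = m + 2" by presburger+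
      then show "real (m div 2 + 1) = real ((m + 2) div 2)" "real (Suc m div 2 + 1) = real (m + 2 - (m + 2) div 2)"
        "real (Suc m + 1) = real (m + 2)" by presburger+
    qed
    interpret lrp_hierarchy N s q \<beta> R \<eta> c vol r0
    proof (unfold_locales)
      show "0 < \<beta>" using \<beta> by simp
      show "0 < R k" for k by (simp add: R_def)
      show "2 * c * r ^ CARD('n) \<le> real (card (annulus \<eta> z r))" if "1 \<le> \<eta> * r" for r z
      proof -
        have "0 < \<eta> * r" using that by simp
        then have "0 < r" using \<eta>(1) by (simp add: zero_less_mult_iff)
        then have "2 * c * r ^ CARD('n) \<le> c' * r ^ CARD('n)" using c(3) by (intro mult_right_mono) auto
        then show ?thesis using c'(2)[OF that, of z] by linarith
      qed
      show "c * R 0 ^ CARD('n) \<le> 1"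
      proof -
        have "R 0 \<le> 1" using abc(5)[of 1] by (simp add: R_def L_def rad_one)
        then have "R 0 ^ CARD('n) \<le> 1" by (intro power_le_one) (auto simp: R_def)
        then show ?thesis using c mult_le_one[of c "R 0 ^ CARD('n)"] by (simp add: R_def)
      qed
      fix m :: nat
      define t where "t = real (m + 2)"
      define ta where "ta = real (m div 2 + 1)"
      define tb where "tb = real (Suc m div 2 + 1)"
      have t: "2 \<le> t" by (simp add: t_def)
      have ta: "1 \<le> ta" "ta \<le> 3 / 4 * t" and tb: "1 \<le> tb" "tb \<le> 3 / 4 * t" and tab: "ta + tb = t"
      proof -
        show "1 \<le> ta" "1 \<le> tb" by (auto simp: ta_def tb_def)
        have "4 * (m div 2 + 1) \<le> 3 * (m + 2)" "4 * (Suc m div 2 + 1) \<le> 3 * (m + 2)" by presburger+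
        then have "real (4 * (m div 2 + 1)) \<le> real (3 * (m + 2))" "real (4 * (Suc m div 2 + 1)) \<le> real (3 * (m + 2))"
          by (simp_all only: of_nat_le_iff)
        then show "ta \<le> 3 / 4 * t" "tb \<le> 3 / 4 * t" by (simp_all add: ta_def tb_def t_def)
        have "(m div 2 + 1) + (Suc m div 2 + 1) = m + 2" by presburger
        then show "ta + tb = t" unfolding ta_def tb_def t_def by (simp only: of_nat_add[symmetric])
      qed
      have R: "R (m div 2) = exp (L ta)" "R (Suc m div 2) = exp (L tb)" "R (Suc m) = exp (L t)"
        by (simp_all add: R_def ta_def tb_def t_def)
      have step: "8 * exp (L t') \<le> \<eta> * exp (L t)" if "1 \<le> t'" "t' \<le> 3 / 4 * t" for t'
      proof -
        have "8 * exp (L t') = exp (ln 8 + L t')" by (simp add: exp_add)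
        also have "\<dots> \<le> exp (ln \<eta> + L t)" using inc1[OF that] \<kappa>(2) by simp
        finally show ?thesis using \<eta>(1) by (simp add: exp_add)
      qed
      show "8 * R (m div 2) \<le> \<eta> * R (Suc m)" "8 * R (Suc m div 2) \<le> \<eta> * R (Suc m)"
        unfolding R using step ta tb by auto
      show "2 * r0 \<le> \<eta> * R (Suc m)"
      proof -
        have "2 * r0 / \<eta> = exp (ln (2 * r0 / \<eta>))" using r0(1) \<eta>(1) by simp
        also have "\<dots> \<le> exp (L t)" using inc1[of 1 t] t L1 \<kappa>(3) by simp
        finally show ?thesis using \<eta>(1) by (simp add: R field_simps)
      qed
      show "ln (64 * real (m + 2)) \<le>
       \<beta> / 2 * (2 * R (Suc m)) powr (- s) * ((c * R (m div 2) ^ CARD('n)) * (c * R (Suc m div 2) ^ CARD('n)))"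
      proof -
        have "ln \<beta> + ?d * (rad (ln \<beta>) ta + rad (ln \<beta>) tb) = s * rad (ln \<beta>) t"
          unfolding ta_def tb_def t_def shift(1,2)[of m] by (rule rad_split_eq) simp
        then have L: "ln t + E' + s * L t \<le> ln \<beta> + ?d * (L ta + L tb)"
          using abc(4)[OF ta(1) tb(1)] by (simp add: L_def tab algebra_simps)
        have "ln (64 * t) \<le> 64 * t" using t ln_le_minus_one[of "64 * t"] by simp
        also have "64 * t = exp (ln 64 + ln t)" using t by (simp add: exp_add)
        also have "\<dots> \<le> exp ((ln \<beta> - ln 2) + (- s * (ln 2 + L t)) + ((ln c + ?d * L ta) + (ln c + ?d * L tb)))"
          using L by (simp add: E'_def algebra_simps)
        also have "\<dots> = \<beta> / 2 * (2 * exp (L t)) powr (- s) * ((c * exp (L ta) ^ CARD('n)) * (c * exp (L tb) ^ CARD('n)))"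
          unfolding exp_add exp_diff exp_power_card using \<beta> c(1) by (simp add: powr_def ln_mult)
        finally show ?thesis by (simp add: R t_def)
      qed
      show "64 * (vol * max 1 (4 * R (Suc m div 2)) ^ CARD('n)) * (16 * real (m + 2))
         \<le> 2 * c * R (Suc m) ^ CARD('n)"
      proof -
        define w where "w = exp (- (\<kappa> * t powr vol_exp))"
        have w: "0 < w" by (simp add: w_def)
        have "4 * exp (L tb) \<le> 4 * exp (A) * (exp (L t) * w)"
        proof -
          have "exp (L tb) \<le> exp (L t + - (\<kappa> * t powr vol_exp))" using inc[OF tb] by simp
          also have "\<dots> = 1 * (exp (L t) * w)" by (simp add: w_def exp_add[symmetric])
          also have "\<dots> \<le> exp A * (exp (L t) * w)" using abc(1) w by (intro mult_right_mono) auto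
          finally show ?thesis by simp
        qed
        moreover have "1 \<le> 4 * exp A * (exp (L t) * w)"
        proof -
          have "0 \<le> A + (L t + - (\<kappa> * t powr vol_exp))" using inc[of 1 t] t L1 by simp
          then have "1 \<le> exp (A + (L t + - (\<kappa> * t powr vol_exp)))" by simp
          also have "\<dots> = exp A * (exp (L t) * w)" by (simp add: w_def exp_add[symmetric])
          finally show ?thesis by simp
        qed
        ultimately have "max 1 (4 * exp (L tb)) ^ CARD('n) \<le> (4 * exp A * (exp (L t) * w)) ^ CARD('n)"
          by (intro power_mono) auto
        also have "\<dots> = 4 ^ CARD('n) * exp (A * ?d) * w ^ CARD('n) * exp (L t) ^ CARD('n)"
          by (simp add: power_mult_distrib exp_power_card mult.commute)
        finally have "64 * (vol * max 1 (4 * exp (L tb)) ^ CARD('n)) * (16 * t)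
            \<le> 64 * (vol * (4 ^ CARD('n) * exp (A * ?d) * w ^ CARD('n) * exp (L t) ^ CARD('n))) * (16 * t)"
          using vol(1) t by (intro mult_right_mono mult_left_mono) auto
        also have "\<dots> = 2 * c * exp (L t) ^ CARD('n) * (Q * t * w ^ CARD('n))"
          using c(1) by (simp add: Q_def)
        also have "\<dots> \<le> 2 * c * exp (L t) ^ CARD('n) * 1"
        proof (rule mult_left_mono)
          have "ln t = ln (t powr vol_exp) / vol_exp" using t vol_exp_bounds by (simp add: ln_powr)
          also have "\<dots> \<le> t powr vol_exp / vol_exp"
            using t vol_exp_bounds ln_le_minus_one[of "t powr vol_exp"] by (intro divide_right_mono) auto
          finally have lnt: "ln t \<le> 1 / vol_exp * t powr vol_exp" by simp
          have "ln Q \<le> \<bar>ln Q\<bar> * t powr vol_exp" using p1[of t] t mult_left_mono[of 1 "t powr vol_exp" "\<bar>ln Q\<bar>"] by simp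
          with lnt have "ln Q + ln t \<le> (\<bar>ln Q\<bar> + 1 / vol_exp) * t powr vol_exp" by (simp add: algebra_simps)
          also have "\<dots> \<le> ?d * \<kappa> * t powr vol_exp"
            using \<kappa>(4) by (intro mult_right_mono) (auto simp: field_simps)
          finally have "exp (ln Q + ln t - ?d * (\<kappa> * t powr vol_exp)) \<le> 1" by simp
          then show "Q * t * w ^ CARD('n) \<le> 1"
            using Q t by (simp add: w_def exp_power_card exp_diff exp_add exp_minus field_simps)
        qed (use c(1) in auto)
        finally show ?thesis by (simp add: R t_def)
      qed
    qed (use \<eta> c r0 vol \<beta> in auto)
    show "7 / 8 \<le> measure (lrp_measure q \<beta>) {\<omega> \<in> space (lrp_measure q \<beta>).
         c * inner_radius A B C \<beta> n ^ CARD('n) \<le>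
         real (card {x \<in> lattice_ball N 0 (inner_radius A B C \<beta> n).
           chem_dist \<omega> 0 x \<le> enat n})}"
      using prob_many_close_points[of n] unfolding R_def L_def inner_radius_def .
  qed
qed

end

section \<open>Bounds for the limiting constants\<close>

locale lrp_limit = lrp_model N s q for N :: "real ^ 'n \<Rightarrow> real" and s q +
  fixes \<phi> :: "real \<Rightarrow> real \<Rightarrow> real"
  assumes family: "phi_family s N q \<phi>"
begin

lemma Delta_eq: "lrp_Delta CARD('n) s = 1 / vol_exp"
  by (simp add: lrp_Delta_def vol_exp_def growth_def)

lemma gamma_eq: "lrp_gamma CARD('n) s = 1 / growth"
  by (simp add: lrp_gamma_def growth_def)

lemma growth_powr_Delta: "growth powr lrp_Delta CARD('n) s = 2"
  using vol_exp_bounds by (simp add: Delta_eq two_powr_vol_exp[symmetric] powr_powr)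

lemma phi_pos: "0 < \<beta> \<Longrightarrow> 1 < r \<Longrightarrow> 0 < \<phi> \<beta> r"
  using family by (simp add: phi_family_def)

lemma phi_continuous: "0 < \<beta> \<Longrightarrow> continuous_on {1<..} (\<phi> \<beta>)"
  using family by (simp add: phi_family_def)

lemma phi_antimono: "1 < r \<Longrightarrow> 0 < \<beta> \<Longrightarrow> \<beta> \<le> \<beta>' \<Longrightarrow> \<phi> \<beta>' r \<le> \<phi> \<beta> r"
  using family by (auto simp: phi_family_def monotone_on_def)

lemma phi_growth:
  assumes "0 < \<beta>" "0 < y" shows "\<phi> \<beta> (exp (growth * y)) = \<phi> \<beta> (exp y)"
proof -
  have "1 < exp (growth * y)" using assms growth_bounds by simp
  then have "\<phi> \<beta> (exp (growth * y) powr (1 / growth)) = \<phi> \<beta> (exp (growth * y))"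
    using family assms(1) by (simp add: phi_family_def gamma_eq)
  then show ?thesis using growth_bounds by (simp add: powr_def)
qed

lemma phi_growth_power:
  assumes "0 < \<beta>" "0 < y" shows "\<phi> \<beta> (exp (growth ^ K * y)) = \<phi> \<beta> (exp y)"
proof (induction K)
  case (Suc K)
  have "0 < growth ^ K * y" using assms growth_bounds by simp
  from phi_growth[OF assms(1) this] show ?case using Suc by (simp add: mult.assoc)
qed simp

text \<open>The typical distance at scale \<open>r = exp y\<close> in the limit of large scales. Its behaviour under multiplication of \<open>y\<close> by
  \<open>growth\<close> mirrors that of the inverse function of the profile.\<close>

definition scaled :: "real \<Rightarrow> real \<Rightarrow> real" where
  "scaled \<beta> y = \<phi> \<beta> (exp y) * y powr lrp_Delta CARD('n) s"

lemma scaled_pos: "0 < \<beta> \<Longrightarrow> 0 < y \<Longrightarrow> 0 < scaled \<beta> y"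
  by (simp add: scaled_def phi_pos)

lemma scaled_growth_power:
  assumes "0 < \<beta>" "0 < y" shows "scaled \<beta> (growth ^ K * y) = 2 ^ K * scaled \<beta> y"
proof -
  have "(growth ^ K) powr lrp_Delta CARD('n) s = (growth powr lrp_Delta CARD('n) s) powr real K"
    using growth_bounds by (simp add: powr_realpow[symmetric] powr_powr mult.commute)
  also have "\<dots> = 2 ^ K" by (simp add: growth_powr_Delta powr_realpow)
  finally show ?thesis
    using assms growth_bounds by (simp add: scaled_def phi_growth_power powr_mult)
qed

lemma scaled_antimono: "0 < \<beta> \<Longrightarrow> \<beta> \<le> \<beta>' \<Longrightarrow> 0 < y \<Longrightarrow> scaled \<beta>' y \<le> scaled \<beta> y"
  unfolding scaled_def by (intro mult_right_mono phi_antimono) auto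

lemma tendsto_scaled:
  assumes "0 < \<beta>" "0 < y" and lim: "(Y \<longlongrightarrow> y) F"
  shows "((\<lambda>i. scaled \<beta> (Y i)) \<longlongrightarrow> scaled \<beta> y) F"
proof -
  have "isCont (\<phi> \<beta>) (exp y)"
    using phi_continuous[OF assms(1)] assms(2) by (simp add: continuous_on_eq_continuous_at)
  then have "((\<lambda>i. \<phi> \<beta> (exp (Y i))) \<longlongrightarrow> \<phi> \<beta> (exp y)) F"
    by (rule isCont_tendsto_compose) (intro tendsto_intros lim)
  then show ?thesis
    unfolding scaled_def using assms(2) by (intro tendsto_intros lim) auto
qed

definition concentrated :: "real \<Rightarrow> bool" where
  "concentrated \<beta> \<longleftrightarrow> (\<forall>\<epsilon>>0. tendsto_zero_in_prob (lrp_measure q \<beta>)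
     (\<lambda>r \<omega>. real (card (atypical_points s N (\<phi> \<beta>) \<epsilon> r \<omega>)) / r ^ CARD('n)))"

lemma concentrated_outside_countable:
  obtains \<Sigma> where "countable \<Sigma>" "\<And>\<beta>. 0 < \<beta> \<Longrightarrow> \<beta> \<notin> \<Sigma> \<Longrightarrow> concentrated \<beta>"
  using family unfolding phi_family_def concentrated_def by auto

text \<open>The factor \<open>2 ^ K\<close> brings the scale \<open>exp l\<close> back to the bounded argument \<open>l / growth ^ K\<close>.\<close>

lemma typical_distance:
  assumes \<beta>: "0 < \<beta>" and l: "0 < l" and x: "x \<in> lattice_ball N 0 (exp l)"
    and typical: "x \<notin> atypical_points s N (\<phi> \<beta>) \<epsilon> (exp l) \<omega>"
  obtains k where "chem_dist \<omega> 0 x = enat k"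
    "(1 - \<epsilon>) * (2 ^ K * scaled \<beta> (l / growth ^ K)) \<le> real k"
    "real k \<le> (1 + \<epsilon>) * (2 ^ K * scaled \<beta> (l / growth ^ K))"
proof -
  define f where "f = 2 ^ K * scaled \<beta> (l / growth ^ K)"
  have "f = \<phi> \<beta> (exp l) * ln (exp l) powr lrp_Delta CARD('n) s"
    unfolding f_def using scaled_growth_power[OF \<beta>, of "l / growth ^ K" K] l growth_bounds
    by (simp add: scaled_def)
  then have dev: "\<not> \<bar>ereal_of_enat (chem_dist \<omega> 0 x) / ereal f - 1\<bar> > ereal \<epsilon>"
    using x typical by (simp add: atypical_points_def)
  have f: "0 < f" unfolding f_def using l growth_bounds \<beta> by (intro mult_pos_pos scaled_pos) auto
  show thesis
  proof (cases "chem_dist \<omega> 0 x")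
    case (enat k)
    then have "\<bar>real k / f - 1\<bar> \<le> \<epsilon>" using dev f by (simp add: one_ereal_def not_less)
    then have "(1 - \<epsilon>) \<le> real k / f" "real k / f \<le> 1 + \<epsilon>" by linarith+
    then show thesis using that[of k] enat f by (simp add: f_def[symmetric] field_simps)
  qed (use dev f in simp)
qed

lemma finite_atypical: "finite (atypical_points s N f \<epsilon> r \<omega>)"
  unfolding atypical_points_def using finite_ball by simp

lemma growth_power_at_top: "filterlim (\<lambda>K. growth ^ K) at_top sequentially"
proof (rule filterlim_at_infinity_imp_filterlim_at_top)
  show "filterlim (\<lambda>K. growth ^ K) at_infinity sequentially"
    using growth_bounds by (intro filterlim_realpow_sequentially_gt1) auto
qed (use growth_bounds in auto)

lemma radii_at_top:
  assumes "(\<lambda>K. L K / growth ^ K) \<longlonglongrightarrow> y" "0 < y"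
  shows "filterlim (\<lambda>K. exp (L K)) at_top sequentially" "\<forall>\<^sub>F K in sequentially. 0 < L K"
proof -
  have "filterlim (\<lambda>K. L K / growth ^ K * growth ^ K) at_top sequentially"
    by (rule filterlim_tendsto_pos_mult_at_top[OF assms growth_power_at_top])
  then have L: "filterlim L at_top sequentially" using growth_bounds by simp
  then show "filterlim (\<lambda>K. exp (L K)) at_top sequentially" by (rule filterlim_compose[OF exp_at_top])
  show "\<forall>\<^sub>F K in sequentially. 0 < L K" using L by (auto simp: filterlim_at_top_dense)
qed

text \<open>Otherwise \<open>E K\<close> would be contained in an event whose probability tends to zero.\<close>

lemma few_atypical_points:
  assumes \<beta>: "0 < \<beta>" "concentrated \<beta>" and "0 < \<epsilon>" "0 < \<delta>"
    and r: "filterlim r at_top sequentially"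
    and E: "\<forall>\<^sub>F K in sequentially. E K \<in> sets (lrp_measure q \<beta>) \<and> 1 / 2 \<le> measure (lrp_measure q \<beta>) (E K)"
  shows "\<forall>\<^sub>F K in sequentially. \<exists>\<omega>\<in>E K.
    real (card (atypical_points s N (\<phi> \<beta>) \<epsilon> (r K) \<omega>)) \<le> \<delta> * r K ^ CARD('n)"
proof -
  interpret lrp N s q \<beta> by (rule lrp_at[OF \<beta>(1)])
  let ?X = "\<lambda>r \<omega>. real (card (atypical_points s N (\<phi> \<beta>) \<epsilon> r \<omega>)) / r ^ CARD('n)"
  let ?B = "\<lambda>r. {\<omega> \<in> space M. \<bar>?X r \<omega>\<bar> > \<delta>}"
  have "((\<lambda>r. prob (?B r)) \<longlongrightarrow> 0) at_top"
    using \<beta>(2) assms(3,4) unfolding concentrated_def tendsto_zero_in_prob_def by blast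
  then have "(\<lambda>K. prob (?B (r K))) \<longlonglongrightarrow> 0" by (rule filterlim_compose[OF _ r])
  then have "\<forall>\<^sub>F K in sequentially. prob (?B (r K)) < 1 / 2" by (rule order_tendstoD) simp
  moreover have "\<forall>\<^sub>F K in sequentially. 0 < r K" using r by (auto simp: filterlim_at_top_dense)
  ultimately show ?thesis using E
  proof eventually_elim
    case (elim K)
    have B: "?B (r K) \<in> sets M"
      unfolding atypical_points_def by (rule point_set_measurable[OF finite_ball])
    have "\<not> E K \<subseteq> ?B (r K)"
      using finite_measure_mono[OF _ B, of "E K"] elim by linarith
    moreover have "E K \<subseteq> space M" using elim by (intro sets.sets_into_space) simp
    ultimately obtain \<omega> where \<omega>: "\<omega> \<in> E K" "\<not> \<bar>?X (r K) \<omega>\<bar> > \<delta>" by blast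
    then have "?X (r K) \<omega> \<le> \<delta>" by linarith
    then show ?case using \<omega>(1) elim by (intro bexI[of _ \<omega>]) (auto simp: field_simps)
  qed
qed

text \<open>With probability at least \<open>7 / 8\<close> a positive proportion of the ball is reached by \<open>n = \<lfloor>2^K t\<rfloor> - 1\<close> steps, so some of
  these points are typical.\<close>

proposition scaled_upper_concentrated:
  obtains A lam0 where "0 \<le> A"
    "\<And>\<beta> t. 1 \<le> \<beta> \<Longrightarrow> lam0 \<le> ln \<beta> \<Longrightarrow> concentrated \<beta> \<Longrightarrow> 1 \<le> t \<Longrightarrow>
       0 < ln \<beta> * profile t - A * t powr vol_exp \<Longrightarrow>
       scaled \<beta> (ln \<beta> * profile t - A * t powr vol_exp) \<le> t"
proof -
  obtain A B C c lam0 where A: "0 \<le> A" "0 < c" and many: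
    "\<And>\<beta> n. 1 \<le> \<beta> \<Longrightarrow> lam0 \<le> ln \<beta> \<Longrightarrow>
       7 / 8 \<le> measure (lrp_measure q \<beta>) {\<omega> \<in> space (lrp_measure q \<beta>).
         c * inner_radius A B C \<beta> n ^ CARD('n) \<le>
         real (card {x \<in> lattice_ball N 0 (inner_radius A B C \<beta> n).
           chem_dist \<omega> 0 x \<le> enat n})}"
    by (rule many_close_points) (erule that; assumption)
  show thesis
  proof (rule that[OF A(1)])
    fix \<beta> t assume \<beta>: "1 \<le> \<beta>" "lam0 \<le> ln \<beta>" "concentrated \<beta>" and t: "1 \<le> (t::real)"
      and y0: "0 < ln \<beta> * profile t - A * t powr vol_exp"
    define y where "y = ln \<beta> * profile t - A * t powr vol_exp"
    define m where "m K = nat \<lfloor>2 ^ K * t\<rfloor>" for K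
    define L where "L K = rad (ln \<beta>) (m K) - corr A B C (m K)" for K
    have m: "real (m K) \<le> 2 ^ K * t" "m K - 1 + 1 = m K" for K
    proof -
      show "real (m K) \<le> 2 ^ K * t" using nat_floor_scaled(3)[OF t] by (simp add: m_def)
      have "1 \<le> real (m K)" using nat_floor_scaled(2)[OF t, of K] one_le_power[of "2::real" K] unfolding m_def by linarith
      then show "m K - 1 + 1 = m K" by simp
    qed
    have \<beta>0: "0 < \<beta>" using \<beta> by simp
    interpret lrp N s q \<beta> by (rule lrp_at[OF \<beta>0])
    have lim: "(\<lambda>K. L K / growth ^ K) \<longlonglongrightarrow> y"
      unfolding L_def y_def diff_divide_distrib m_def
      by (intro tendsto_diff rad_scaled_limit corr_scaled_limit t)
    have y: "0 < y" using y0 by (simp add: y_def)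
    let ?close = "\<lambda>K \<omega>. {x \<in> lattice_ball N 0 (exp (L K)). chem_dist \<omega> 0 x \<le> enat (m K - 1)}"
    define E where "E K = {\<omega> \<in> space M. c * exp (L K) ^ CARD('n) \<le> real (card (?close K \<omega>))}" for K
    have E: "E K \<in> sets M \<and> 1 / 2 \<le> prob (E K)" for K
    proof
      show "E K \<in> sets M" unfolding E_def by (rule point_set_measurable[OF finite_ball])
      have "7 / 8 \<le> prob (E K)" using many[OF \<beta>(1,2), of "m K - 1"] unfolding inner_radius_def m(2) E_def L_def .
      then show "1 / 2 \<le> prob (E K)" by simp
    qed
    have "(1 - \<epsilon>) * scaled \<beta> y \<le> t" if \<epsilon>: "0 < \<epsilon>" "\<epsilon> < 1" for \<epsilon>
    proof (rule tendsto_upperbound)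
      show "(\<lambda>K. (1 - \<epsilon>) * scaled \<beta> (L K / growth ^ K)) \<longlonglongrightarrow> (1 - \<epsilon>) * scaled \<beta> y"
        by (intro tendsto_intros tendsto_scaled \<beta>0 y lim)
      have "\<forall>\<^sub>F K in sequentially. \<exists>\<omega>\<in>E K.
          real (card (atypical_points s N (\<phi> \<beta>) \<epsilon> (exp (L K)) \<omega>)) \<le> c / 2 * exp (L K) ^ CARD('n)"
        by (rule few_atypical_points[OF \<beta>0 \<beta>(3) \<epsilon>(1) _ radii_at_top(1)[OF lim y]]) (use A E in auto)
      then show "\<forall>\<^sub>F K in sequentially. (1 - \<epsilon>) * scaled \<beta> (L K / growth ^ K) \<le> t"
        using radii_at_top(2)[OF lim y]
      proof eventually_elim
        case (elim K)
        then obtain \<omega> where \<omega>: "\<omega> \<in> E K"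
          "real (card (atypical_points s N (\<phi> \<beta>) \<epsilon> (exp (L K)) \<omega>)) \<le> c / 2 * exp (L K) ^ CARD('n)" by blast
        have "0 < c / 2 * exp (L K) ^ CARD('n)" using A by simp
        then have "card (atypical_points s N (\<phi> \<beta>) \<epsilon> (exp (L K)) \<omega>) < card (?close K \<omega>)"
          using \<omega> by (simp add: E_def)
        then have "\<not> ?close K \<omega> \<subseteq> atypical_points s N (\<phi> \<beta>) \<epsilon> (exp (L K)) \<omega>"
          using card_mono[OF finite_atypical] by (meson not_less)
        then obtain x where x: "x \<in> lattice_ball N 0 (exp (L K))" "chem_dist \<omega> 0 x \<le> enat (m K - 1)"
            "x \<notin> atypical_points s N (\<phi> \<beta>) \<epsilon> (exp (L K)) \<omega>" by blast
        from typical_distance[OF \<beta>0 elim(2) x(1,3)] obtain k where k: "chem_dist \<omega> 0 x = enat k"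
          "(1 - \<epsilon>) * (2 ^ K * scaled \<beta> (L K / growth ^ K)) \<le> real k" by metis
        have "k \<le> m K" using x(2) k(1) by simp
        then have "real k \<le> 2 ^ K * t" using m(1)[of K] by linarith
        with k(2) have "2 ^ K * ((1 - \<epsilon>) * scaled \<beta> (L K / growth ^ K)) \<le> 2 ^ K * t"
          unfolding mult.left_commute[of "2 ^ K" "1 - \<epsilon>"] by linarith
        then show ?case by simp
      qed
    qed simp
    from this[of "1 - z" for z] have "z * scaled \<beta> y \<le> t" if "0 < z" "z < 1" for z
      using that by simp
    then show "scaled \<beta> (ln \<beta> * profile t - A * t powr vol_exp) \<le> t"
      unfolding y_def by (rule field_le_mult_one_interval)
  qed
qed

text \<open>If the radius exceeds the outer radius by a factor \<open>e^K\<close>, which does not change the limit of \<open>ln r / growth^K\<close>, then the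
  points reached by \<open>n\<close> steps have vanishing density, and most of the others are typical.\<close>

proposition scaled_lower_concentrated:
  obtains A where "0 \<le> A"
    "\<And>\<beta> t. 1 < \<beta> \<Longrightarrow> concentrated \<beta> \<Longrightarrow> 1 \<le> t \<Longrightarrow>
       t \<le> scaled \<beta> (ln \<beta> * profile t + A * t powr vol_exp)"
proof -
  obtain A B C where A: "0 \<le> A" and few:
    "\<And>\<beta> n r \<eta>. 1 \<le> \<beta> \<Longrightarrow> 0 < \<eta> \<Longrightarrow> annulus \<eta> 0 r \<noteq> {} \<Longrightarrow>
       outer_radius A B C \<beta> n < \<eta> * r \<Longrightarrow>
       measure (lrp_measure q \<beta>) {\<omega> \<in> space (lrp_measure q \<beta>).
         real (card (annulus \<eta> 0 r)) / 4 \<le> real (card {x \<in> annulus \<eta> 0 r. chem_dist \<omega> 0 x \<le> enat n})}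
       \<le> 4 * (outer_radius A B C \<beta> n / (\<eta> * r)) powr s"
    by (rule few_close_points) (erule that; assumption)
  obtain \<eta> c where \<eta>: "0 < \<eta>" "\<eta> < 1" and c: "0 < c"
    "\<And>z r. 1 \<le> \<eta> * r \<Longrightarrow> c * r ^ CARD('n) \<le> real (card (annulus \<eta> z r))"
    using card_annulus_lower by blast
  show thesis
  proof (rule that[OF A])
    fix \<beta> t assume \<beta>: "1 < \<beta>" "concentrated \<beta>" and t: "1 \<le> (t::real)"
    define y where "y = ln \<beta> * profile t + A * t powr vol_exp"
    define m where "m K = nat \<lfloor>2 ^ K * t\<rfloor>" for K
    define l where "l K = rad (ln \<beta>) (m K) + corr A B C (m K)" for K
    \<comment> \<open>Any summand that tends to infinity more slowly than \<open>growth ^ K\<close> would do.\<close>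
    define L where "L K = l K + real K" for K
    have m: "m K - 1 + 1 = m K" for K
    proof -
      have "1 \<le> real (m K)" using nat_floor_scaled(2)[OF t, of K] one_le_power[of "2::real" K] unfolding m_def by linarith
      then show "m K - 1 + 1 = m K" by simp
    qed
    have \<beta>0: "0 < \<beta>" using \<beta> by simp
    interpret lrp N s q \<beta> by (rule lrp_at[OF \<beta>0])
    have "(\<lambda>K. rad (ln \<beta>) (m K) / growth ^ K + corr A B C (m K) / growth ^ K + (1 * real K + 0) / growth ^ K)
        \<longlonglongrightarrow> ln \<beta> * profile t + A * t powr vol_exp + 0"
      unfolding m_def by (intro tendsto_add rad_scaled_limit corr_scaled_limit linear_over_growth_power t)
    then have lim: "(\<lambda>K. L K / growth ^ K) \<longlonglongrightarrow> y"
      by (simp add: L_def l_def y_def add_divide_distrib)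
    have y: "0 < y"
    proof -
      have "0 < ln \<beta> * profile t" using \<beta>(1) profile_pos[OF t] by simp
      then show ?thesis using A by (simp add: y_def add_pos_nonneg)
    qed
    let ?A = "\<lambda>K. annulus \<eta> 0 (exp (L K))"
    let ?close = "\<lambda>K \<omega>. {x \<in> ?A K. chem_dist \<omega> 0 x \<le> enat (m K - 1)}"
    define G where "G K = {\<omega> \<in> space M. real (card (?A K)) / 4 \<le> real (card (?close K \<omega>))}" for K
    have G: "G K \<in> sets M" for K unfolding G_def by (rule point_set_measurable[OF finite_annulus])
    have big: "\<forall>\<^sub>F K in sequentially. 1 / \<eta> \<le> exp (L K)"
      using radii_at_top(1)[OF lim y] by (simp add: filterlim_at_top)
    have dec: "(\<lambda>K. exp (- real K) / \<eta>) \<longlonglongrightarrow> 0"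
    proof -
      have "(\<lambda>K. (exp (- 1)) ^ K / \<eta>) \<longlonglongrightarrow> 0 / \<eta>"
        using \<eta> by (intro tendsto_divide tendsto_const LIMSEQ_realpow_zero) auto
      then show ?thesis by (simp add: exp_of_nat_mult[symmetric])
    qed
    have "(\<lambda>K. 4 * (exp (- real K) / \<eta>) powr s) \<longlonglongrightarrow> 4 * 0 powr s"
      using s_pos \<eta> by (intro tendsto_mult tendsto_const tendsto_powr' dec) auto
    then have small: "\<forall>\<^sub>F K in sequentially. 4 * (exp (- real K) / \<eta>) powr s < 1 / 2"
      by (rule order_tendstoD(2)) simp
    have small': "\<forall>\<^sub>F K in sequentially. exp (- real K) / \<eta> < 1"
      using dec by (rule order_tendstoD(2)) simp
    have E: "\<forall>\<^sub>F K in sequentially. space M - G K \<in> sets M \<and> 1 / 2 \<le> prob (space M - G K)"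
      using big small small'
    proof eventually_elim
      case (elim K)
      have r1: "1 \<le> \<eta> * exp (L K)" using elim(1) \<eta> by (simp add: field_simps)
      have "0 < c * exp (L K) ^ CARD('n)" using c by simp
      then have ne: "?A K \<noteq> {}" using c(2)[OF r1, of 0] by auto
      have ratio: "exp (l K) / (\<eta> * exp (L K)) = exp (- real K) / \<eta>"
        by (simp add: L_def exp_add exp_minus field_simps)
      have lt: "outer_radius A B C \<beta> (m K - 1) < \<eta> * exp (L K)"
      proof -
        have "exp (l K) / (\<eta> * exp (L K)) < 1" unfolding ratio by (rule elim(3))
        then show ?thesis unfolding outer_radius_def m l_def[symmetric] using \<eta> by (simp add: field_simps)
      qed
      have "prob (G K) \<le> 4 * (exp (l K) / (\<eta> * exp (L K))) powr s"
        using few[OF _ \<eta>(1) ne lt] \<beta>(1) unfolding outer_radius_def m G_def l_def by simp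
      then have "prob (G K) \<le> 1 / 2" unfolding ratio using elim(2) by linarith
      then show ?case using prob_compl[OF G[of K]] G by auto
    qed
    have "t \<le> (1 + \<epsilon>) * scaled \<beta> y" if \<epsilon>: "0 < \<epsilon>" for \<epsilon>
    proof (rule tendsto_le)
      show "(\<lambda>K. (1 + \<epsilon>) * scaled \<beta> (L K / growth ^ K)) \<longlonglongrightarrow> (1 + \<epsilon>) * scaled \<beta> y"
        by (intro tendsto_intros tendsto_scaled \<beta>0 y lim)
      show "(\<lambda>K. real (m K) / 2 ^ K) \<longlonglongrightarrow> t" unfolding m_def by (rule nat_floor_scaled(1)[OF t])
      have "\<forall>\<^sub>F K in sequentially. \<exists>\<omega>\<in>space M - G K.
          real (card (atypical_points s N (\<phi> \<beta>) \<epsilon> (exp (L K)) \<omega>)) \<le> c / 2 * exp (L K) ^ CARD('n)"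
        by (rule few_atypical_points[OF \<beta>0 \<beta>(2) \<epsilon>(1) _ radii_at_top(1)[OF lim y] E]) (use c in auto)
      then show "\<forall>\<^sub>F K in sequentially. real (m K) / 2 ^ K \<le> (1 + \<epsilon>) * scaled \<beta> (L K / growth ^ K)"
        using radii_at_top(2)[OF lim y] big
      proof eventually_elim
        case (elim K)
        then obtain \<omega> where \<omega>: "\<omega> \<in> space M - G K"
          "real (card (atypical_points s N (\<phi> \<beta>) \<epsilon> (exp (L K)) \<omega>)) \<le> c / 2 * exp (L K) ^ CARD('n)" by blast
        let ?atyp = "atypical_points s N (\<phi> \<beta>) \<epsilon> (exp (L K)) \<omega>"
        have r1: "1 \<le> \<eta> * exp (L K)" using elim(3) \<eta> by (simp add: field_simps)
        have pos: "0 < c * exp (L K) ^ CARD('n)" using c by simp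
        have cardA: "c * exp (L K) ^ CARD('n) \<le> real (card (?A K))" by (rule c(2)[OF r1])
        have "real (card (?close K \<omega>)) < real (card (?A K)) / 4" using \<omega>(1) by (auto simp: G_def)
        then have "real (card (?close K \<omega>)) + real (card ?atyp) < real (card (?A K))"
          using \<omega>(2) cardA pos by linarith
        then have "card (?close K \<omega> \<union> ?atyp) < card (?A K)"
          using card_Un_le[of "?close K \<omega>" ?atyp] by linarith
        moreover have "finite (?close K \<omega> \<union> ?atyp)" using finite_annulus finite_atypical by simp
        ultimately have "\<not> ?A K \<subseteq> ?close K \<omega> \<union> ?atyp" using card_mono by (meson not_less)
        then obtain x where x: "x \<in> ?A K" "\<not> chem_dist \<omega> 0 x \<le> enat (m K - 1)" "x \<notin> ?atyp" by blast
        have "x \<in> lattice_ball N 0 (exp (L K))" using x(1) by (simp add: annulus_def)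
        from typical_distance[OF \<beta>0 elim(2) this x(3)] obtain k where k: "chem_dist \<omega> 0 x = enat k"
          "real k \<le> (1 + \<epsilon>) * (2 ^ K * scaled \<beta> (L K / growth ^ K))" by metis
        have "m K \<le> k" using x(2) k(1) m[of K] by simp
        then have "real (m K) \<le> (1 + \<epsilon>) * (2 ^ K * scaled \<beta> (L K / growth ^ K))" using k(2) by linarith
        then show ?case by (simp add: field_simps)
      qed
    qed simp
    note le = this
    have "z * t \<le> scaled \<beta> y" if "0 < z" "z < 1" for z
    proof -
      have "0 < 1 / z - 1" using that by (simp add: field_simps)
      then have "t \<le> (1 + (1 / z - 1)) * scaled \<beta> y" by (rule le)
      then show ?thesis using that by (simp add: field_simps)
    qed
    then show "t \<le> scaled \<beta> (ln \<beta> * profile t + A * t powr vol_exp)"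
      unfolding y_def by (rule field_le_mult_one_interval)
  qed
qed

text \<open>Monotonicity in \<open>\<beta>\<close> and continuity in \<open>r\<close> carry the bounds over to the exceptional values of \<open>\<beta>\<close>.\<close>

lemma scaled_upper:
  obtains A lam0 where "0 \<le> A"
    "\<And>\<beta> t. 1 < \<beta> \<Longrightarrow> lam0 < ln \<beta> \<Longrightarrow> 1 \<le> t \<Longrightarrow>
       0 < ln \<beta> * profile t - A * t powr vol_exp \<Longrightarrow>
       scaled \<beta> (ln \<beta> * profile t - A * t powr vol_exp) \<le> t"
proof -
  obtain A lam0 where A: "0 \<le> A" and le:
    "\<And>\<beta> t. 1 \<le> \<beta> \<Longrightarrow> lam0 \<le> ln \<beta> \<Longrightarrow> concentrated \<beta> \<Longrightarrow> 1 \<le> t \<Longrightarrow>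
       0 < ln \<beta> * profile t - A * t powr vol_exp \<Longrightarrow>
       scaled \<beta> (ln \<beta> * profile t - A * t powr vol_exp) \<le> t"
    by (rule scaled_upper_concentrated) (erule that; assumption)
  obtain \<Sigma> where \<Sigma>: "countable \<Sigma>" "\<And>\<beta>. 0 < \<beta> \<Longrightarrow> \<beta> \<notin> \<Sigma> \<Longrightarrow> concentrated \<beta>"
    using concentrated_outside_countable by blast
  show thesis
  proof (rule that[OF A], rule ccontr)
    fix \<beta> t :: real assume \<beta>: "1 < \<beta>" "lam0 < ln \<beta>" and t: "1 \<le> t"
    define Y where "Y b = ln b * profile t - A * t powr vol_exp" for b
    assume "0 < ln \<beta> * profile t - A * t powr vol_exp" "\<not> scaled \<beta> (ln \<beta> * profile t - A * t powr vol_exp) \<le> t"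
    then have Y: "0 < Y \<beta>" "t < scaled \<beta> (Y \<beta>)" by (auto simp: Y_def)
    have limln: "(ln \<longlongrightarrow> ln \<beta>) (at_left \<beta>)" using \<beta> by (intro tendsto_intros) auto
    have limY: "(Y \<longlongrightarrow> Y \<beta>) (at_left \<beta>)" unfolding Y_def using \<beta> by (intro tendsto_intros) auto
    have "((\<lambda>b. scaled \<beta> (Y b)) \<longlongrightarrow> scaled \<beta> (Y \<beta>)) (at_left \<beta>)"
      using \<beta> Y by (intro tendsto_scaled limY) auto
    then have "\<forall>\<^sub>F b in at_left \<beta>. t < scaled \<beta> (Y b)" using Y(2) by (rule order_tendstoD)
    moreover have "\<forall>\<^sub>F b in at_left \<beta>. lam0 < ln b" using limln \<beta>(2) by (rule order_tendstoD)
    moreover have "\<forall>\<^sub>F b in at_left \<beta>. 0 < Y b" using limY Y(1) by (rule order_tendstoD)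
    moreover have "\<forall>\<^sub>F b in at_left \<beta>. 1 < b" using \<beta>(1) by (rule order_tendstoD[OF tendsto_ident_at])
    ultimately have "\<forall>\<^sub>F b in at_left \<beta>. t < scaled \<beta> (Y b) \<and> lam0 < ln b \<and> 0 < Y b \<and> 1 < b"
      by eventually_elim simp
    then obtain b0 where b0: "b0 < \<beta>"
      "\<And>b. b0 < b \<Longrightarrow> b < \<beta> \<Longrightarrow> t < scaled \<beta> (Y b) \<and> lam0 < ln b \<and> 0 < Y b \<and> 1 < b"
      unfolding eventually_at_left[OF \<beta>(1)] by blast
    have "\<not> {b0<..<\<beta>} \<subseteq> \<Sigma>"
      using uncountable_open_interval[of b0 \<beta>] b0(1) \<Sigma>(1) countable_subset by blast
    then obtain b where "b \<in> {b0<..<\<beta>}" "b \<notin> \<Sigma>" by blast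
    then have b: "b0 < b" "b < \<beta>" "b \<notin> \<Sigma>" by simp_all
    note b' = b0(2)[OF b(1,2)]
    have "scaled \<beta> (Y b) \<le> scaled b (Y b)" using b b' by (intro scaled_antimono) auto
    also have "\<dots> \<le> t" unfolding Y_def
      using b' b(3) \<Sigma>(2)[of b] t by (intro le) (auto simp: Y_def)
    finally show False using b' by simp
  qed
qed

lemma scaled_lower:
  obtains A where "0 \<le> A"
    "\<And>\<beta> t. 1 < \<beta> \<Longrightarrow> 1 \<le> t \<Longrightarrow> t \<le> scaled \<beta> (ln \<beta> * profile t + A * t powr vol_exp)"
proof -
  obtain A where A: "0 \<le> A" and le:
    "\<And>\<beta> t. 1 < \<beta> \<Longrightarrow> concentrated \<beta> \<Longrightarrow> 1 \<le> t \<Longrightarrow>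
       t \<le> scaled \<beta> (ln \<beta> * profile t + A * t powr vol_exp)"
    by (rule scaled_lower_concentrated) (erule that; assumption)
  obtain \<Sigma> where \<Sigma>: "countable \<Sigma>" "\<And>\<beta>. 0 < \<beta> \<Longrightarrow> \<beta> \<notin> \<Sigma> \<Longrightarrow> concentrated \<beta>"
    using concentrated_outside_countable by blast
  show thesis
  proof (rule that[OF A], rule ccontr)
    fix \<beta> t :: real assume \<beta>: "1 < \<beta>" and t: "1 \<le> t"
    define Y where "Y b = ln b * profile t + A * t powr vol_exp" for b
    assume "\<not> t \<le> scaled \<beta> (ln \<beta> * profile t + A * t powr vol_exp)"
    then have Y: "scaled \<beta> (Y \<beta>) < t" by (simp add: Y_def)
    have prof: "0 < profile t" by (rule profile_pos[OF t])
    have Ypos: "0 < Y b" if "1 < b" for b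
      unfolding Y_def using that prof A by (intro add_pos_nonneg mult_pos_pos) auto
    have limY: "(Y \<longlongrightarrow> Y \<beta>) (at_right \<beta>)" unfolding Y_def using \<beta> by (intro tendsto_intros) auto
    have "((\<lambda>b. scaled \<beta> (Y b)) \<longlongrightarrow> scaled \<beta> (Y \<beta>)) (at_right \<beta>)"
      using \<beta> Ypos by (intro tendsto_scaled limY) auto
    then have "\<forall>\<^sub>F b in at_right \<beta>. scaled \<beta> (Y b) < t" using Y by (rule order_tendstoD)
    then obtain b0 where b0: "\<beta> < b0" "\<And>b. \<beta> < b \<Longrightarrow> b < b0 \<Longrightarrow> scaled \<beta> (Y b) < t"
      unfolding eventually_at_right[OF less_add_one[of \<beta>]] by blast
    have "\<not> {\<beta><..<b0} \<subseteq> \<Sigma>"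
      using uncountable_open_interval[of \<beta> b0] b0(1) \<Sigma>(1) countable_subset by blast
    then obtain b where "b \<in> {\<beta><..<b0}" "b \<notin> \<Sigma>" by blast
    then have b: "\<beta> < b" "b < b0" "b \<notin> \<Sigma>" by simp_all
    have "t \<le> scaled b (Y b)" unfolding Y_def using b \<beta> t \<Sigma>(2)[of b] by (intro le) auto
    also have "\<dots> \<le> scaled \<beta> (Y b)" using b \<beta> Ypos[of b] by (intro scaled_antimono) auto
    finally show False using b0(2)[OF b(1,2)] by simp
  qed
qed

section \<open>The limit\<close>

text \<open>A uniform lower bound for the slopes on the range that is used for the limit.\<close>

lemma profile_steep:
  assumes "1 \<le> x" "x \<le> y" "y < 8" shows "slope 2 * (y - x) \<le> profile y - profile x"
proof -
  have "2 ^ level y \<le> y" using assms by (intro level_bounds) auto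
  also have "\<dots> < 2 ^ 3" using assms by simp
  finally have "level y \<le> 2" by (subst (asm) power_strict_increasing_iff) auto
  then have "(growth / 2) ^ 2 \<le> (growth / 2) ^ level y"
    using growth_bounds by (intro power_decreasing) auto
  then have "slope 2 \<le> slope (level y)" using s_pos by (simp add: slope_def divide_right_mono)
  then have "slope 2 * (y - x) \<le> slope (level y) * (y - x)" using assms by (intro mult_right_mono) auto
  also have "\<dots> \<le> profile y - profile x"
    using profile_slope[of y x] assms by (simp add: algebra_simps)
  finally show ?thesis .
qed

text \<open>The correction of fixed size is compensated by moving \<open>t\<close> by at most \<open>e\<close>, since the slope of \<open>\<lambda> \<Xi>\<close> is of order
  \<open>\<lambda>\<close>. On the interval \<open>[2, 4]\<close> the moved point stays above 1.\<close>

proposition scaled_limit: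
  assumes e: "0 < e" "e < 1"
  shows "\<forall>\<^sub>F \<beta> in at_top. \<forall>t\<in>{2..4}. \<bar>scaled \<beta> (ln \<beta> * profile t) - t\<bar> \<le> e"
proof -
  obtain A lam0 where A: "0 \<le> A" and up:
    "\<And>\<beta> t. 1 < \<beta> \<Longrightarrow> lam0 < ln \<beta> \<Longrightarrow> 1 \<le> t \<Longrightarrow>
       0 < ln \<beta> * profile t - A * t powr vol_exp \<Longrightarrow>
       scaled \<beta> (ln \<beta> * profile t - A * t powr vol_exp) \<le> t"
    by (rule scaled_upper) (erule that; assumption)
  obtain A' where A': "0 \<le> A'" and lo:
    "\<And>\<beta> t. 1 < \<beta> \<Longrightarrow> 1 \<le> t \<Longrightarrow> t \<le> scaled \<beta> (ln \<beta> * profile t + A' * t powr vol_exp)"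
    by (rule scaled_lower) (erule that; assumption)
  define c where "c = slope 2 * e"
  have c: "0 < c" using slope_bounds(1)[of 2] e by (simp add: c_def)
  have "filterlim (ln :: real \<Rightarrow> real) at_top at_top" by (rule ln_at_top)
  then have "\<forall>Z. \<forall>\<^sub>F \<beta> in at_top. Z < ln (\<beta>::real)" unfolding filterlim_at_top_dense .
  then have "\<forall>\<^sub>F \<beta> in at_top. max 0 (max lam0 (8 * max A A' / c)) < ln (\<beta>::real)" by (rule spec)
  then show ?thesis using eventually_gt_at_top[of 1]
  proof eventually_elim
    case (elim \<beta>)
    define lam where "lam = ln \<beta>"
    have lam: "0 < lam" "lam0 < lam" "8 * max A A' / c < lam" and \<beta>: "1 < \<beta>"
      using elim by (auto simp: lam_def)
    have "8 * max A A' \<le> lam * c" using lam(3) c by (simp add: field_simps)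
    then have big: "8 * A \<le> lam * c" "8 * A' \<le> lam * c" by auto
    have p8: "a * x powr vol_exp \<le> 8 * a" if "1 \<le> x" "x < 8" "0 \<le> a" for a x :: real
    proof -
      have "x powr vol_exp \<le> x powr 1" using that vol_exp_bounds by (intro powr_mono) auto
      then have "a * x powr vol_exp \<le> a * 8" using that by (intro mult_left_mono) auto
      then show ?thesis by simp
    qed
    have contp: "continuous_on {a..b} (\<lambda>x. lam * profile x + k * x powr vol_exp)" if "1 \<le> a" for a b k
      using that
      by (intro continuous_intros continuous_on_subset[OF continuous_on_profile]) auto
    show ?case
    proof
      fix t :: real assume t: "t \<in> {2..4}"
      \<comment> \<open>Both one-sided bounds hold at points near \<open>t\<close> whose corrected arguments are exactly \<open>y\<close>.\<close>
      define y where "y = lam * profile t"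
      have y: "0 < y" using t lam profile_pos[of t] by (simp add: y_def)
      have "\<exists>x. t \<le> x \<and> x \<le> t + e \<and> lam * profile x + (- A) * x powr vol_exp = y"
      proof (rule IVT')
        show "lam * profile t + (- A) * t powr vol_exp \<le> y" using A by (simp add: y_def)
        have "c \<le> profile (t + e) - profile t" using profile_steep[of t "t + e"] t e by (simp add: c_def)
        then have "lam * c \<le> lam * (profile (t + e) - profile t)" using lam by (intro mult_left_mono) auto
        moreover have "A * (t + e) powr vol_exp \<le> 8 * A" using t e A by (intro p8) auto
        ultimately show "y \<le> lam * profile (t + e) + (- A) * (t + e) powr vol_exp"
          using big by (simp add: y_def algebra_simps)
        show "continuous_on {t..t + e} (\<lambda>x. lam * profile x + (- A) * x powr vol_exp)"
          by (rule contp) (use t in simp)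
      qed (use e in simp)
      then obtain x where x: "t \<le> x" "x \<le> t + e" "ln \<beta> * profile x - A * x powr vol_exp = y"
        by (auto simp: lam_def)
      have "scaled \<beta> y \<le> x"
        using up[OF \<beta>, of x] x y t lam(2) by (simp add: lam_def)
      then have 1: "scaled \<beta> y \<le> t + e" using x by simp
      have "\<exists>x. t - e \<le> x \<and> x \<le> t \<and> lam * profile x + A' * x powr vol_exp = y"
      proof (rule IVT')
        show "y \<le> lam * profile t + A' * t powr vol_exp" using A' by (simp add: y_def)
        have "c \<le> profile t - profile (t - e)" using profile_steep[of "t - e" t] t e by (simp add: c_def)
        then have "lam * c \<le> lam * (profile t - profile (t - e))" using lam by (intro mult_left_mono) auto
        moreover have "A' * (t - e) powr vol_exp \<le> 8 * A'" using t e A' by (intro p8) auto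
        ultimately show "lam * profile (t - e) + A' * (t - e) powr vol_exp \<le> y"
          using big by (simp add: y_def algebra_simps)
      qed (use t e contp in auto)
      then obtain x' where x': "t - e \<le> x'" "x' \<le> t" "ln \<beta> * profile x' + A' * x' powr vol_exp = y"
        by (auto simp: lam_def)
      have "x' \<le> scaled \<beta> y" using lo[OF \<beta>, of x'] x' t e by simp
      then have 2: "t - e \<le> scaled \<beta> y" using x' by simp
      show "\<bar>scaled \<beta> (ln \<beta> * profile t) - t\<bar> \<le> e" using 1 2 by (simp add: y_def lam_def abs_le_iff)
    qed
  qed
qed

lemma phi_gamma_powi:
  assumes "0 < \<beta>" "0 < y"
  shows "\<phi> \<beta> (exp (lrp_gamma CARD('n) s powi m * y)) = \<phi> \<beta> (exp y)"
proof (cases "0 \<le> m")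
  case True
  have "0 < lrp_gamma CARD('n) s powi m * y" using assms growth_bounds by (simp add: gamma_eq)
  from phi_growth_power[OF assms(1) this, of "nat m"] True growth_bounds show ?thesis
    by (simp add: gamma_eq power_int_def power_one_over)
next
  case False
  then show ?thesis
    using phi_growth_power[OF assms, of "nat (- m)"] growth_bounds
    by (simp add: gamma_eq power_int_def power_one_over)
qed

text \<open>The point on the first piece of the profile that corresponds to the exponent \<open>t\<close>.\<close>

definition position :: "real \<Rightarrow> real" where
  "position t = (s * growth powr t - 2 * (s - real CARD('n))) / (2 * real CARD('n) - s)"

lemma position_bounds:
  assumes "t \<in> {0..1}" shows "1 \<le> position t" "position t \<le> 2"
proof -
  have g: "1 \<le> growth powr t" using assms growth_bounds by (intro ge_one_powr_ge_zero) auto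
  have g': "growth powr t \<le> growth" using assms growth_bounds powr_mono[of t 1 growth] by simp
  have "s * 1 \<le> s * growth powr t" using g s_pos by (intro mult_left_mono) auto
  then show "1 \<le> position t" using s_less by (simp add: position_def field_simps)
  have "s * growth powr t \<le> s * growth" using g' s_pos by (intro mult_left_mono) auto
  then show "position t \<le> 2" using s_less by (simp add: position_def s_growth field_simps)
qed

lemma profile_position:
  assumes "t \<in> {0..1}" shows "profile (position t) = growth powr t / (2 * real CARD('n) - s)"
proof -
  have "profile (position t) = line 0 (position t)"
    using position_bounds[OF assms] by (intro profile_eq_line) auto
  also have "\<dots> = (position t - 1) / s + 1 / (2 * real CARD('n) - s)" by (simp add: line_def)
  also have "position t - 1 = s * (growth powr t - 1) / (2 * real CARD('n) - s)"
    using s_less by (simp add: position_def field_simps)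
  also have "\<dots> / s + 1 / (2 * real CARD('n) - s) = growth powr t / (2 * real CARD('n) - s)"
    using s_pos by (simp add: diff_divide_distrib)
  finally show ?thesis .
qed

text \<open>Up to an integer power of \<open>\<gamma>\<close>, which \<open>\<phi> \<beta>\<close> ignores, the exponent in \<open>lrp_psi\<close> is \<open>ln \<beta> * profile (position t)\<close>. One
  doubling moves \<open>position t\<close> from \<open>[1, 2]\<close> to \<open>[2, 4]\<close>.\<close>

lemma psi_eq:
  assumes \<beta>: "1 < \<beta>" and t: "t \<in> {0..1}"
  defines "d \<equiv> CARD('n)"
  shows "ln \<beta> powr lrp_Delta CARD('n) s *
      lrp_psi d s \<phi> \<beta> (t + ln (lrp_u d s \<beta> / (2 * real d - s)) / ln (1 / lrp_gamma d s))
    = scaled \<beta> (ln \<beta> * profile (2 * position t)) / 2 * 2 powr (- t) * (2 * real d - s) powr lrp_Delta CARD('n) s"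
proof -
  let ?\<gamma> = "lrp_gamma d s"
  have \<gamma>: "?\<gamma> = 1 / growth" "0 < ?\<gamma>" "?\<gamma> < 1" using growth_bounds by (auto simp: d_def gamma_eq)
  have lam: "0 < ln \<beta>" using \<beta> by simp
  have e: "0 < 2 * real d - s" using s_less by (simp add: d_def)
  define v where "v = lrp_u d s \<beta> / (2 * real d - s)"
  have v: "0 < v" using lam e \<gamma>(2) by (simp add: v_def lrp_u_def)
  define y where "y = ln \<beta> * profile (position t)"
  have y_eq: "y = growth powr t * (ln \<beta> / (2 * real d - s))"
    using profile_position[OF t] by (simp add: y_def d_def)
  have y: "0 < y" using lam e growth_bounds by (simp add: y_eq)
  have "?\<gamma> powr (- (t + ln v / ln (1 / ?\<gamma>))) = ?\<gamma> powr (- t) * ?\<gamma> powr (ln v / ln ?\<gamma>)"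
    using \<gamma> by (simp add: powr_add[symmetric] ln_div)
  also have "?\<gamma> powr (ln v / ln ?\<gamma>) = v" using \<gamma> v by (simp add: powr_def)
  also have "?\<gamma> powr (- t) = growth powr t"
    using growth_bounds by (simp add: \<gamma>(1) powr_minus powr_divide)
  also have "growth powr t * v = ?\<gamma> powi lrp_m d s \<beta> * y"
    by (simp add: v_def lrp_u_def y_eq)
  finally have "lrp_psi d s \<phi> \<beta> (t + ln v / ln (1 / ?\<gamma>)) = \<phi> \<beta> (exp y)"
    unfolding lrp_psi_def using phi_gamma_powi[of \<beta> y] \<beta> y by (simp add: d_def)
  moreover have "\<phi> \<beta> (exp y) * ln \<beta> powr lrp_Delta CARD('n) s = scaled \<beta> y * 2 powr (- t) * (2 * real d - s) powr lrp_Delta CARD('n) s"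
  proof -
    have "(growth powr t) powr lrp_Delta CARD('n) s = (growth powr lrp_Delta CARD('n) s) powr t" by (simp add: powr_powr mult.commute)
    then have "(growth powr t) powr lrp_Delta CARD('n) s = 2 powr t" by (simp add: growth_powr_Delta)
    then have "y powr lrp_Delta CARD('n) s = 2 powr t * (ln \<beta> powr lrp_Delta CARD('n) s / (2 * real d - s) powr lrp_Delta CARD('n) s)"
      using lam e growth_bounds by (simp add: y_eq powr_mult powr_divide)
    then show ?thesis using e by (simp add: scaled_def powr_minus field_simps)
  qed
  moreover have "scaled \<beta> (ln \<beta> * profile (2 * position t)) = 2 * scaled \<beta> y"
    using scaled_growth_power[of \<beta> y 1] profile_double[OF position_bounds(1)[OF t]] \<beta> y
    by (simp add: y_def mult_ac)
  ultimately show ?thesis by (simp add: v_def mult.commute)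
qed

end

theorem theorem1p2:
  fixes s :: real
    and N :: "real ^ 'n \<Rightarrow> real"
    and q :: "int ^ 'n \<Rightarrow> ennreal"
    and \<phi> :: "real \<Rightarrow> real \<Rightarrow> real"
    and d :: nat and \<gamma> \<Delta> :: real
  defines "d \<equiv> CARD('n)"
    and "\<gamma> \<equiv> lrp_gamma d s"
    and "\<Delta> \<equiv> lrp_Delta d s"
  assumes "real d < s" and "s < 2 * real d"
    and "is_norm N"
    and "admissible_kernel s N q"
    and "phi_family s N q \<phi>"
  shows "uniform_limit {0..1}
           (\<lambda>\<beta> t. ln \<beta> powr \<Delta> *
              lrp_psi d s \<phi> \<beta> (t + ln (lrp_u d s \<beta> / (2 * real d - s)) / ln (1 / \<gamma>)))
           (\<lambda>t. (s / (2 * real d - s) * (2 * \<gamma>) powr (- t)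
                  - 2 * ((s - real d) / (2 * real d - s)) * 2 powr (- t))
                * (2 * real d - s) powr \<Delta>)
           at_top"
proof -
  interpret lrp_limit N s q \<phi>
    using assms by unfold_locales (auto simp: d_def)
  let ?c = "(2 * real d - s) powr \<Delta>"
  have e: "0 < 2 * real d - s" using assms by simp
  have c: "0 < ?c" using e by simp
  have limit_eq: "(s / (2 * real d - s) * (2 * \<gamma>) powr (- t)
      - 2 * ((s - real d) / (2 * real d - s)) * 2 powr (- t)) * ?c = position t * 2 powr (- t) * ?c" for t
  proof -
    have "(2 * \<gamma>) powr (- t) = growth powr t * 2 powr (- t)"
      using growth_bounds by (simp add: \<gamma>_def d_def gamma_eq powr_minus powr_divide powr_mult inverse_eq_divide)
    then show ?thesis by (simp add: position_def d_def diff_divide_distrib add_divide_distrib algebra_simps)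
  qed
  show ?thesis
    unfolding uniform_limit_iff
  proof (intro allI impI)
    fix \<epsilon> :: real assume \<epsilon>: "0 < \<epsilon>"
    define e where "e = min (1 / 2) (\<epsilon> / ?c)"
    have e: "0 < e" "e < 1" "e \<le> \<epsilon> / ?c" using \<epsilon> c by (auto simp: e_def)
    show "\<forall>\<^sub>F \<beta> in at_top. \<forall>t\<in>{0..1}.
      dist (ln \<beta> powr \<Delta> * lrp_psi d s \<phi> \<beta> (t + ln (lrp_u d s \<beta> / (2 * real d - s)) / ln (1 / \<gamma>)))
       ((s / (2 * real d - s) * (2 * \<gamma>) powr (- t)
         - 2 * ((s - real d) / (2 * real d - s)) * 2 powr (- t)) * ?c) < \<epsilon>"
      using scaled_limit[OF e(1,2)] eventually_gt_at_top[of 1]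
    proof eventually_elim
      case (elim \<beta>)
      show ?case
      proof
        fix t :: real assume t: "t \<in> {0..1}"
        have "2 * position t \<in> {2..4}" using position_bounds[OF t] by simp
        then have close: "\<bar>scaled \<beta> (ln \<beta> * profile (2 * position t)) - 2 * position t\<bar> \<le> e"
          using elim(1) by blast
        define w where "w = 2 powr (- t) * ?c"
        have "2 powr (- t) \<le> 2 powr 0" using t by (intro powr_mono) auto
        then have "w \<le> 1 * ?c" unfolding w_def using c by (intro mult_right_mono) auto
        then have w: "0 < w" "w \<le> ?c" using c by (auto simp: w_def)
        have diff: "ln \<beta> powr \<Delta> * lrp_psi d s \<phi> \<beta> (t + ln (lrp_u d s \<beta> / (2 * real d - s)) / ln (1 / \<gamma>))
            - position t * 2 powr (- t) * ?c
            = (scaled \<beta> (ln \<beta> * profile (2 * position t)) - 2 * position t) / 2 * w"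
          using psi_eq[OF elim(2) t] by (simp add: \<Delta>_def \<gamma>_def d_def w_def algebra_simps)
        have "dist (ln \<beta> powr \<Delta> * lrp_psi d s \<phi> \<beta> (t + ln (lrp_u d s \<beta> / (2 * real d - s)) / ln (1 / \<gamma>)))
            (position t * 2 powr (- t) * ?c)
            = \<bar>scaled \<beta> (ln \<beta> * profile (2 * position t)) - 2 * position t\<bar> / 2 * w"
          unfolding dist_real_def diff using w by (simp add: abs_mult)
        also have "\<dots> \<le> e / 2 * ?c" using close w e by (intro mult_mono) auto
        also have "\<dots> < \<epsilon>"
        proof -
          have "e * ?c \<le> \<epsilon>" using e(3) c by (simp add: field_simps)
          then show ?thesis using \<epsilon> by simp
        qed
        finally show "dist (ln \<beta> powr \<Delta> * lrp_psi d s \<phi> \<beta> (t + ln (lrp_u d s \<beta> / (2 * real d - s)) / ln (1 / \<gamma>)))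
          ((s / (2 * real d - s) * (2 * \<gamma>) powr (- t)
            - 2 * ((s - real d) / (2 * real d - s)) * 2 powr (- t)) * ?c) < \<epsilon>"
          unfolding limit_eq .
      qed
    qed
  qed
qed

end
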